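(* Let $(M^7,\varphi)$ be a manifold with a $G_2$ structure. To any associative submanifold $Y^3\subset (M,\varphi)$ with a non-vanishing oriented $2$-plane field, $\chi$ defines an almost complex structure on its normal bundle $\nu(Y)$. (Notice that in particular any coassociative submanifold $X\subset M$ has an almost complex structure if its normal bundle has a non-vanishing section.)
   Context: A $G_2$ structure on a smooth $7$-manifold $M$ is a $3$-form $\varphi\in\Omega^3(M)$ such that at each $x\in M$ the pair $(T_xM,\varphi(x))$ is isomorphic to $(\mathbb R^7,\varphi_0)$, where $\varphi_0=e^{123}+e^{145}+e^{167}+e^{246}-e^{257}-e^{347}-e^{356}$ and $e^{ijk}=dx^i\wedge dx^j\wedge dx^k$; it determines an orientation and a metric $\langle\cdot,\cdot\rangle$ on $M$, hence a Hodge star $*$. The tangent bundle valued $3$-form $\chi\in\Omega^3(M,TM)$ is defined by the identity $\langle\chi(u,v,w),z\rangle=*\varphi(u,v,w,z)$. A $3$-dimensional submanifold $Y\subset M$ is associative if $\varphi|_Y\equiv \mathrm{vol}(Y)$ (equivalently $\chi|_Y\equiv 0$); a $4$-dimensional submanifold $X\subset M$ is coassociative if $\varphi|_X=0$. The $2$-plane field on $Y$ is a field of oriented $2$-planes tangent to $Y$. An almost complex structure on a real vector bundle is a bundle endomorphism whose square is $-\mathrm{Id}$; an almost complex structure on a manifold is one on its tangent bundle. *)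

theory Defs
  imports "HOL-Analysis.Analysis" "HOL-Library.Function_Algebras"
begin

section \<open>Functions as a real vector space\<close>

instantiation "fun" :: (type, real_vector) real_vector
begin

definition scaleR_fun :: "real \<Rightarrow> ('a \<Rightarrow> 'b) \<Rightarrow> 'a \<Rightarrow> 'b" where
  "scaleR_fun r f = (\<lambda>x. r *\<^sub>R f x)"

instance
  by standard (simp_all add: scaleR_fun_def plus_fun_def fun_eq_iff scaleR_add_right scaleR_add_left)

end


section \<open>Smooth maps between Euclidean spaces\<close>

text \<open>Only used for open sets \<open>S\<close>.  In finite dimension a map is \<open>C\<^bsup>k+1\<^esup>\<close> iff it is
  differentiable and all its directional derivatives are \<open>C\<^sup>k\<close>.\<close>

primrec Ck_on :: "nat \<Rightarrow> 'a::euclidean_space set \<Rightarrow> ('a \<Rightarrow> 'b::real_normed_vector) \<Rightarrow> bool" where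
  "Ck_on 0 S f \<longleftrightarrow> continuous_on S f"
| "Ck_on (Suc k) S f \<longleftrightarrow>
     (\<forall>x\<in>S. f differentiable (at x)) \<and> (\<forall>v. Ck_on k S (\<lambda>x. frechet_derivative f (at x) v))"

definition smooth_on :: "'a::euclidean_space set \<Rightarrow> ('a \<Rightarrow> 'b::real_normed_vector) \<Rightarrow> bool" where
  "smooth_on S f \<longleftrightarrow> (\<forall>k. Ck_on k S f)"


section \<open>Smooth manifolds\<close>

text \<open>The manifold is the whole type \<open>'m\<close>.  A chart is a pair of a domain and a coordinate map;
  the values of the coordinate map outside the domain are irrelevant.\<close>

type_synonym ('m, 'n) chart = "'m set \<times> ('m \<Rightarrow> real ^ 'n)"

abbreviation chart_inv :: "('m, 'n) chart \<Rightarrow> real ^ 'n \<Rightarrow> 'm" where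
  "chart_inv c \<equiv> inv_into (fst c) (snd c)"

abbreviation transition :: "('m, 'n) chart \<Rightarrow> ('m, 'n) chart \<Rightarrow> real ^ 'n \<Rightarrow> real ^ 'n" where
  "transition c d \<equiv> snd d \<circ> chart_inv c"

definition is_chart :: "('m::topological_space, 'n::finite) chart \<Rightarrow> bool" where
  "is_chart c \<longleftrightarrow> open (fst c) \<and> open (snd c ` fst c) \<and>
     homeomorphism (fst c) (snd c ` fst c) (snd c) (chart_inv c)"

definition compatible :: "('m, 'n::finite) chart \<Rightarrow> ('m, 'n) chart \<Rightarrow> bool" where
  "compatible c d \<longleftrightarrow>
     smooth_on (snd c ` (fst c \<inter> fst d)) (transition c d) \<and>
     smooth_on (snd d ` (fst c \<inter> fst d)) (transition d c)"

text \<open>A smooth structure is a maximal smooth atlas.\<close>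

definition smooth_structure :: "('m::topological_space, 'n::finite) chart set \<Rightarrow> bool" where
  "smooth_structure A \<longleftrightarrow>
     (\<forall>c\<in>A. is_chart c) \<and> (\<Union>c\<in>A. fst c) = UNIV \<and> (\<forall>c\<in>A. \<forall>d\<in>A. compatible c d) \<and>
     (\<forall>c. is_chart c \<and> (\<forall>d\<in>A. compatible c d) \<longrightarrow> c \<in> A)"

text \<open>A tangent vector at \<open>p\<close> is the family of its coordinate vectors in all charts around \<open>p\<close>,
  related by the derivatives of the transition maps (and padded by \<open>0\<close> on all other charts).
  In particular the vector space operations are the pointwise ones.\<close>

type_synonym ('m, 'n) tvec = "('m, 'n) chart \<Rightarrow> real ^ 'n"

definition tangent_space :: "('m, 'n::finite) chart set \<Rightarrow> 'm \<Rightarrow> ('m, 'n) tvec set" where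
  "tangent_space A p = {v.
     (\<forall>c. \<not> (c \<in> A \<and> p \<in> fst c) \<longrightarrow> v c = 0) \<and>
     (\<forall>c\<in>A. \<forall>d\<in>A. p \<in> fst c \<inter> fst d \<longrightarrow>
        v d = frechet_derivative (transition c d) (at (snd c p)) (v c))}"

text \<open>The tangent vector at \<open>p\<close> whose coordinate vector in the chart \<open>c\<close> is \<open>x\<close>; for constant \<open>x\<close>
  this is the constant-coefficient combination of the coordinate vector fields of \<open>c\<close>.\<close>

definition coord_vec :: "('m, 'n::finite) chart set \<Rightarrow> ('m, 'n) chart \<Rightarrow> 'm \<Rightarrow> real ^ 'n \<Rightarrow> ('m, 'n) tvec"
  where "coord_vec A c p x = (\<lambda>d. if d \<in> A \<and> p \<in> fst d
     then frechet_derivative (transition c d) (at (snd c p)) x else 0)"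


section \<open>Submanifolds, sections and plane fields\<close>

definition slice_chart ::
    "('m, 'n::finite) chart set \<Rightarrow> 'm set \<Rightarrow> ('m, 'n) chart \<Rightarrow> (real ^ 'n) set \<Rightarrow> bool" where
  "slice_chart A Y c S \<longleftrightarrow> c \<in> A \<and> subspace S \<and> snd c ` (fst c \<inter> Y) = snd c ` fst c \<inter> S"

definition submanifold :: "('m, 'n::finite) chart set \<Rightarrow> nat \<Rightarrow> 'm set \<Rightarrow> bool" where
  "submanifold A k Y \<longleftrightarrow> (\<forall>p\<in>Y. \<exists>c S. slice_chart A Y c S \<and> p \<in> fst c \<and> dim S = k)"

definition tangent_sub :: "('m, 'n::finite) chart set \<Rightarrow> 'm set \<Rightarrow> 'm \<Rightarrow> ('m, 'n) tvec set" where
  "tangent_sub A Y p =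
     {v \<in> tangent_space A p. \<exists>c S. slice_chart A Y c S \<and> p \<in> fst c \<and> v c \<in> S}"

text \<open>Smooth sections over \<open>Y\<close> of the restriction to \<open>Y\<close> of the tangent bundle of the manifold;
  smoothness on a subset means local extendability to a smooth map on an open set.\<close>

definition smooth_section ::
    "('m, 'n::finite) chart set \<Rightarrow> 'm set \<Rightarrow> ('m \<Rightarrow> ('m, 'n) tvec) \<Rightarrow> bool" where
  "smooth_section A Y s \<longleftrightarrow> (\<forall>p\<in>Y. s p \<in> tangent_space A p \<and>
     (\<exists>c\<in>A. p \<in> fst c \<and> (\<exists>F. smooth_on (snd c ` fst c) F \<and>
        (\<forall>q\<in>Y \<inter> fst c. s q c = F (snd c q)))))"

text \<open>Ordered families of \<open>k\<close> vectors are elements of \<open>'v ^ 'k\<close>.  An oriented \<open>k\<close>-plane is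
  represented by the set of its positively oriented ordered bases, i.e. by all families obtained
  from one basis by a change of basis with positive determinant.\<close>

definition independent_family :: "'v::real_vector ^ 'k::finite \<Rightarrow> bool" where
  "independent_family b \<longleftrightarrow> inj (($) b) \<and> independent (range (($) b))"

definition oriented_plane :: "'v::real_vector ^ 'k::finite \<Rightarrow> ('v ^ 'k) set" where
  "oriented_plane b = {b'. \<exists>P :: real ^ 'k ^ 'k. det P > 0 \<and> b' = (\<chi> i. \<Sum>j\<in>UNIV. P $ i $ j *\<^sub>R b $ j)}"

text \<open>A (smooth) field on \<open>Y\<close> of oriented \<open>k\<close>-planes tangent to \<open>Y\<close>.  If \<open>Y\<close> has dimension \<open>k\<close>,
  this is the same thing as an orientation of \<open>Y\<close>.\<close>

definition oriented_plane_field ::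
    "('m::topological_space, 'n::finite) chart set \<Rightarrow> 'm set \<Rightarrow>
     ('m \<Rightarrow> (('m, 'n) tvec ^ 'k::finite) set) \<Rightarrow> bool" where
  "oriented_plane_field A Y P \<longleftrightarrow> (\<forall>p\<in>Y. \<exists>W b. open W \<and> p \<in> W \<and>
     (\<forall>i. smooth_section A (Y \<inter> W) (\<lambda>q. b q $ i)) \<and>
     (\<forall>q\<in>Y \<inter> W. independent_family (b q) \<and> (\<forall>i. b q $ i \<in> tangent_sub A Y q) \<and>
        P q = oriented_plane (b q)))"


section \<open>Linear algebra of oriented inner product spaces\<close>

definition orthonormal :: "('v \<Rightarrow> 'v \<Rightarrow> real) \<Rightarrow> 'v ^ 'k::finite \<Rightarrow> bool" where
  "orthonormal g e \<longleftrightarrow> (\<forall>i j. g (e $ i) (e $ j) = (if i = j then 1 else 0))"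

definition onb :: "('v \<Rightarrow> 'v \<Rightarrow> real) \<Rightarrow> ('v ^ 'k::finite) set \<Rightarrow> 'v ^ 'k" where
  "onb g ori = (SOME e. e \<in> ori \<and> orthonormal g e)"

text \<open>The volume form of the oriented plane \<open>ori\<close>, that is \<open>e\<^sup>1 \<and> \<dots> \<and> e\<^sup>k\<close> for any positively
  oriented orthonormal basis \<open>e\<close>.\<close>

definition vol_form :: "('v \<Rightarrow> 'v \<Rightarrow> real) \<Rightarrow> ('v ^ 'k::finite) set \<Rightarrow> 'v ^ 'k \<Rightarrow> real" where
  "vol_form g ori v = det (\<chi> i j. g (onb g ori $ i) (v $ j))"

text \<open>The Hodge star of a 3-form \<open>\<alpha>\<close> in dimension 7.  It is the linear map with
  \<open>*(e\<^sup>i \<and> e\<^sup>j \<and> e\<^sup>k) = vol(e\<^sub>i, e\<^sub>j, e\<^sub>k, _, _, _, _)\<close> for an orthonormal basis \<open>e\<close>, which is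
  the convention \<open>\<alpha> \<and> *\<beta> = \<langle>\<alpha>, \<beta>\<rangle> vol\<close>; since \<open>\<alpha>\<close> is the sum of
  \<open>\<alpha>(e\<^sub>i, e\<^sub>j, e\<^sub>k) e\<^sup>i \<and> e\<^sup>j \<and> e\<^sup>k\<close> over \<open>i < j < k\<close>, summing over all triples produces
  the factor \<open>1/3!\<close>.\<close>

definition hodge_star3 ::
    "('v::zero \<Rightarrow> 'v \<Rightarrow> real) \<Rightarrow> ('v ^ 7) set \<Rightarrow> ('v \<Rightarrow> 'v \<Rightarrow> 'v \<Rightarrow> real) \<Rightarrow>
     'v \<Rightarrow> 'v \<Rightarrow> 'v \<Rightarrow> 'v \<Rightarrow> real" where
  "hodge_star3 g ori \<alpha> u v w z = (let e = onb g ori in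
     (1 / 6) * (\<Sum>i\<in>UNIV. \<Sum>j\<in>UNIV. \<Sum>k\<in>UNIV.
        \<alpha> (e $ i) (e $ j) (e $ k) * vol_form g ori (vector [e $ i, e $ j, e $ k, u, v, w, z])))"


section \<open>\<open>G\<^sub>2\<close> structures\<close>

type_synonym ('m, 'n) form3 =
  "'m \<Rightarrow> ('m, 'n) tvec \<Rightarrow> ('m, 'n) tvec \<Rightarrow> ('m, 'n) tvec \<Rightarrow> real"

definition alternating3 :: "'v::real_vector set \<Rightarrow> ('v \<Rightarrow> 'v \<Rightarrow> 'v \<Rightarrow> real) \<Rightarrow> bool" where
  "alternating3 V \<alpha> \<longleftrightarrow>
     (\<forall>u\<in>V. \<forall>u'\<in>V. \<forall>v\<in>V. \<forall>w\<in>V. \<forall>a b.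
        \<alpha> (a *\<^sub>R u + b *\<^sub>R u') v w = a * \<alpha> u v w + b * \<alpha> u' v w) \<and>
     (\<forall>u\<in>V. \<forall>v\<in>V. \<forall>w\<in>V. \<alpha> v u w = - \<alpha> u v w \<and> \<alpha> u w v = - \<alpha> u v w)"

definition smooth_form3 :: "('m, 'n::finite) chart set \<Rightarrow> ('m, 'n) form3 \<Rightarrow> bool" where
  "smooth_form3 A \<alpha> \<longleftrightarrow> (\<forall>p. alternating3 (tangent_space A p) (\<alpha> p)) \<and>
     (\<forall>c\<in>A. \<forall>x y z. smooth_on (snd c ` fst c) (\<lambda>t. let p = chart_inv c t in
        \<alpha> p (coord_vec A c p x) (coord_vec A c p y) (coord_vec A c p z)))"

definition e3 :: "7 \<Rightarrow> 7 \<Rightarrow> 7 \<Rightarrow> real ^ 7 \<Rightarrow> real ^ 7 \<Rightarrow> real ^ 7 \<Rightarrow> real" where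
  "e3 i j k u v w = det (vector
     [vector [u $ i, u $ j, u $ k], vector [v $ i, v $ j, v $ k], vector [w $ i, w $ j, w $ k]]
     :: real ^ 3 ^ 3)"

definition phi0 :: "real ^ 7 \<Rightarrow> real ^ 7 \<Rightarrow> real ^ 7 \<Rightarrow> real" where
  "phi0 u v w = e3 1 2 3 u v w + e3 1 4 5 u v w + e3 1 6 7 u v w + e3 2 4 6 u v w
     - e3 2 5 7 u v w - e3 3 4 7 u v w - e3 3 5 6 u v w"

text \<open>\<open>E\<close> is an isomorphism from \<open>(\<real>\<^sup>7, \<phi>\<^sub>0)\<close> to the tangent space at \<open>p\<close> with \<open>\<phi>(p)\<close>.\<close>

definition g2_frame ::
    "('m, 7) chart set \<Rightarrow> ('m, 7) form3 \<Rightarrow> 'm \<Rightarrow> (real ^ 7 \<Rightarrow> ('m, 7) tvec) \<Rightarrow> bool" where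
  "g2_frame A \<phi> p E \<longleftrightarrow> linear E \<and> bij_betw E UNIV (tangent_space A p) \<and>
     (\<forall>x y z. \<phi> p (E x) (E y) (E z) = phi0 x y z)"

definition g2_structure :: "('m, 7) chart set \<Rightarrow> ('m, 7) form3 \<Rightarrow> bool" where
  "g2_structure A \<phi> \<longleftrightarrow> smooth_form3 A \<phi> \<and> (\<forall>p. \<exists>E. g2_frame A \<phi> p E)"

text \<open>The metric and the orientation at \<open>p\<close> are transported from the standard ones of \<open>\<real>\<^sup>7\<close>.
  They do not depend on the choice of the frame, because the stabilizer of \<open>\<phi>\<^sub>0\<close> in
  \<open>GL(7, \<real>)\<close> is the group \<open>G\<^sub>2\<close>, which is contained in \<open>SO(7)\<close>.\<close>

definition some_g2_frame ::
    "('m, 7) chart set \<Rightarrow> ('m, 7) form3 \<Rightarrow> 'm \<Rightarrow> real ^ 7 \<Rightarrow> ('m, 7) tvec" where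
  "some_g2_frame A \<phi> p = (SOME E. g2_frame A \<phi> p E)"

definition g2_metric ::
    "('m, 7) chart set \<Rightarrow> ('m, 7) form3 \<Rightarrow> 'm \<Rightarrow> ('m, 7) tvec \<Rightarrow> ('m, 7) tvec \<Rightarrow> real" where
  "g2_metric A \<phi> p u v = inv (some_g2_frame A \<phi> p) u \<bullet> inv (some_g2_frame A \<phi> p) v"

definition g2_orientation ::
    "('m, 7) chart set \<Rightarrow> ('m, 7) form3 \<Rightarrow> 'm \<Rightarrow> (('m, 7) tvec ^ 7) set" where
  "g2_orientation A \<phi> p = oriented_plane (\<chi> i. some_g2_frame A \<phi> p (axis i 1))"

definition star_phi ::
    "('m, 7) chart set \<Rightarrow> ('m, 7) form3 \<Rightarrow> 'm \<Rightarrow>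
     ('m, 7) tvec \<Rightarrow> ('m, 7) tvec \<Rightarrow> ('m, 7) tvec \<Rightarrow> ('m, 7) tvec \<Rightarrow> real" where
  "star_phi A \<phi> p = hodge_star3 (g2_metric A \<phi> p) (g2_orientation A \<phi> p) (\<phi> p)"

definition chi_form ::
    "('m, 7) chart set \<Rightarrow> ('m, 7) form3 \<Rightarrow> 'm \<Rightarrow>
     ('m, 7) tvec \<Rightarrow> ('m, 7) tvec \<Rightarrow> ('m, 7) tvec \<Rightarrow> ('m, 7) tvec" where
  "chi_form A \<phi> p u v w = (THE x. x \<in> tangent_space A p \<and>
     (\<forall>z\<in>tangent_space A p. g2_metric A \<phi> p x z = star_phi A \<phi> p u v w z))"

definition normal_bundle ::
    "('m, 7) chart set \<Rightarrow> ('m, 7) form3 \<Rightarrow> 'm set \<Rightarrow> 'm \<Rightarrow> ('m, 7) tvec set" where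
  "normal_bundle A \<phi> Y p =
     {v \<in> tangent_space A p. \<forall>w\<in>tangent_sub A Y p. g2_metric A \<phi> p v w = 0}"

text \<open>The equation \<open>\<phi>|Y = vol(Y)\<close> presupposes an orientation \<open>ori\<close> of \<open>Y\<close>.\<close>

definition associative :: "('m::topological_space, 7) chart set \<Rightarrow> ('m, 7) form3 \<Rightarrow> 'm set \<Rightarrow> bool" where
  "associative A \<phi> Y \<longleftrightarrow> submanifold A 3 Y \<and>
     (\<exists>ori :: 'm \<Rightarrow> (('m, 7) tvec ^ 3) set. oriented_plane_field A Y ori \<and>
        (\<forall>p\<in>Y. \<forall>u\<in>tangent_sub A Y p. \<forall>v\<in>tangent_sub A Y p. \<forall>w\<in>tangent_sub A Y p.
           \<phi> p u v w = vol_form (g2_metric A \<phi> p) (ori p) (vector [u, v, w])))"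

definition coassociative :: "('m, 7) chart set \<Rightarrow> ('m, 7) form3 \<Rightarrow> 'm set \<Rightarrow> bool" where
  "coassociative A \<phi> X \<longleftrightarrow> submanifold A 4 X \<and>
     (\<forall>p\<in>X. \<forall>u\<in>tangent_sub A X p. \<forall>v\<in>tangent_sub A X p. \<forall>w\<in>tangent_sub A X p.
        \<phi> p u v w = 0)"


section \<open>Almost complex structures\<close>

text \<open>Here \<open>V\<close> is a subbundle of the restriction to \<open>Y\<close> of the tangent bundle of the manifold.
  Smoothness means that in charts the endomorphism is locally given by a smooth matrix.  The
  values of \<open>J p\<close> off \<open>V p\<close> are irrelevant.\<close>

definition bundle_endomorphism ::
    "('m, 'n::finite) chart set \<Rightarrow> 'm set \<Rightarrow> ('m \<Rightarrow> ('m, 'n) tvec set) \<Rightarrow>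
     ('m \<Rightarrow> ('m, 'n) tvec \<Rightarrow> ('m, 'n) tvec) \<Rightarrow> bool" where
  "bundle_endomorphism A Y V J \<longleftrightarrow> (\<forall>p\<in>Y.
     (\<forall>v\<in>V p. J p v \<in> V p) \<and>
     (\<forall>v\<in>V p. \<forall>w\<in>V p. \<forall>a b. J p (a *\<^sub>R v + b *\<^sub>R w) = a *\<^sub>R J p v + b *\<^sub>R J p w) \<and>
     (\<exists>c\<in>A. p \<in> fst c \<and> (\<exists>F :: real ^ 'n \<Rightarrow> real ^ 'n ^ 'n. smooth_on (snd c ` fst c) F \<and>
        (\<forall>q\<in>Y \<inter> fst c. \<forall>v\<in>V q. J q v c = F (snd c q) *v v c))))"

definition almost_complex_structure ::
    "('m, 'n::finite) chart set \<Rightarrow> 'm set \<Rightarrow> ('m \<Rightarrow> ('m, 'n) tvec set) \<Rightarrow>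
     ('m \<Rightarrow> ('m, 'n) tvec \<Rightarrow> ('m, 'n) tvec) \<Rightarrow> bool" where
  "almost_complex_structure A Y V J \<longleftrightarrow>
     bundle_endomorphism A Y V J \<and> (\<forall>p\<in>Y. \<forall>v\<in>V p. J p (J p v) = - v)"

end

theory Submission
  imports Defs
begin

text \<open>
  On a tangent space with a \<open>G\<^sub>2\<close> form there is the cross product \<open>\<langle>u \<times> v, w\<rangle> = \<phi>(u, v, w)\<close>, and
  for a unit vector \<open>n\<close> the map \<open>x \<mapsto> n \<times> x\<close> squares to \<open>-1\<close> on the complement of \<open>n\<close>.  For orthonormal
  \<open>u, v\<close> and \<open>x\<close> orthogonal to both, \<open>\<chi>(u, v, x) = (u \<times> v) \<times> x\<close>.  On an associative \<open>Y\<close> the tangent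
  spaces are closed under the cross product, so \<open>n = u \<times> v\<close> is tangent and \<open>n \<times> _\<close> preserves the normal
  bundle.  On a coassociative \<open>X\<close> and for \<open>0 \<noteq> t \<in> TX\<close> one has \<open>NX = t \<times> TX\<close> by a dimension count,
  so that \<open>n \<times> _\<close> preserves \<open>TX\<close> for every normal \<open>n\<close>.

  The metric is defined pointwise through arbitrary frames, so its smoothness has to be recovered from
  \<open>\<phi>\<close>.  If \<open>\<phi>\<close> is the pullback of \<open>\<phi>\<^sub>0\<close> under \<open>K\<close> and \<open>\<Phi>\<^sub>u\<close> is the matrix of \<open>\<phi>(u, _, _)\<close>, then
  \<open>det(\<Phi>\<^sub>u + u u\<^sup>T) = \<plusminus> (det K)\<^sup>2 |K u|\<^sup>4 |u|\<^sup>4\<close>; hence \<open>|det K| |K u|\<^sup>2\<close> is a smooth function of \<open>\<phi>\<close>, and the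
  determinant \<open>|det K|\<^sup>9\<close> of the polarised Gram matrix yields \<open>|det K|\<close>.
\<close>

section \<open>Calculus of smooth maps\<close>

text \<open>The form \<open>\<phi>(u, _, _)\<close> is skew in odd dimension and has
  \<open>u\<close> in its kernel, so the determinant of its matrix always vanishes; the rank-one
  term \<open>u u\<^sup>T\<close> fills this kernel. The ambiguous sign is removed by squaring,
  after which every root is taken of a positive smooth function. The power 9 is 7 + 2: polarisation
  yields \<open>|det K| K\<^sup>T K\<close>, a matrix of size 7. A plane field is given through sets
  of bases, and a basis picked at each point varies without any regularity. Smoothness survives
  because a change of basis only multiplies \<open>u \<times> v\<close> by its determinant: an
  oriented plane fixes the ray of \<open>n\<close>, so \<open>J\<close> may be written with an
  arbitrary pointwise choice and compared with a smooth local one up to positive factors. For the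
  same reason \<open>J\<close> agrees with \<open>\<chi>\<close> for each oriented orthonormal basis
  of the plane. The link to \<open>\<chi>\<close> is the formula \<open>\<chi>(u, v, w) = (u
  \<times> v) \<times> w - \<langle>u, w\<rangle> v + \<langle>v, w\<rangle> u\<close>, valid for
  all vectors; orthogonality removes the last two terms.\<close>

lemma Ck_on_imp_continuous_on: "Ck_on k S f \<Longrightarrow> continuous_on S f"
  by (cases k) (auto intro!: continuous_at_imp_continuous_on differentiable_imp_continuous_within)

text \<open>The derivative at a point of \<open>S\<close> sees the values nearby; agreement on
  \<open>S\<close> controls it because \<open>S\<close> is open.\<close>

lemma Ck_on_cong:
  assumes "open S" "\<And>x. x \<in> S \<Longrightarrow> f x = g x" "Ck_on k S f"
  shows "Ck_on k S g"
  using assms(2,3)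
proof (induction k arbitrary: f g)
  case 0
  then show ?case by (auto cong: continuous_on_cong)
next
  case (Suc k)
  have "g differentiable (at x)" if "x \<in> S" for x
    using Suc.prems that assms(1)
    by (metis Ck_on.simps(2) differentiable_def has_derivative_transform_within_open)
  moreover have "Ck_on k S (\<lambda>x. frechet_derivative g (at x) v)" for v
    using Suc.IH[of "\<lambda>x. frechet_derivative f (at x) v" "\<lambda>x. frechet_derivative g (at x) v"]
      frechet_derivative_transform_within_open[OF _ assms(1), of f _ g] Suc.prems by fastforce
  ultimately show ?case by simp
qed

lemma Ck_on_subset: "Ck_on k S f \<Longrightarrow> T \<subseteq> S \<Longrightarrow> Ck_on k T f"
  by (induction k arbitrary: f) (auto intro: continuous_on_subset)

lemma Ck_on_SucD: "Ck_on (Suc k) S f \<Longrightarrow> Ck_on k S f"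
proof (induction k arbitrary: f)
  case 0
  then show ?case by (simp add: Ck_on_imp_continuous_on[where k = 1])
next
  case (Suc k)
  then show ?case by (metis Ck_on.simps(2))
qed

lemma Ck_on_const: "Ck_on k S (\<lambda>x. c)"
  by (induction k arbitrary: c) (auto simp: frechet_derivative_const)

text \<open>\<open>frechet_derivative\<close> is obtained by choice; with this rule a proof may name
  the derivative by a formula and has to treat only that formula.\<close>

lemma Ck_on_SucI:
  assumes "open S" "\<And>x. x \<in> S \<Longrightarrow> (f has_derivative f' x) (at x)" "\<And>v. Ck_on k S (\<lambda>x. f' x v)"
  shows "Ck_on (Suc k) S f"
proof -
  have "Ck_on k S (\<lambda>x. frechet_derivative f (at x) v)" for v
    by (rule Ck_on_cong[OF assms(1) _ assms(3)[of v]]) (metis assms(2) frechet_derivative_at)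
  then show ?thesis
    using assms(2) by (auto simp: differentiable_def)
qed

lemma Ck_on_SucE:
  assumes "Ck_on (Suc k) S f"
  shows "x \<in> S \<Longrightarrow> (f has_derivative frechet_derivative f (at x)) (at x)"
    and "Ck_on k S (\<lambda>x. frechet_derivative f (at x) v)"
  using assms by (auto simp: frechet_derivative_works)

lemma Ck_on_bounded_linear:
  assumes "bounded_linear L" "open S" "Ck_on k S f"
  shows "Ck_on k S (\<lambda>x. L (f x))"
  using assms(3)
proof (induction k arbitrary: f)
  case 0
  then show ?case
    using bounded_linear.continuous_on[OF assms(1)] by simp
next
  case (Suc k)
  show ?case
    by (rule Ck_on_SucI[OF assms(2), where f' = "\<lambda>x v. L (frechet_derivative f (at x) v)"])
       (use Ck_on_SucE[OF Suc.prems] Suc.IH in \<open>auto intro: bounded_linear.has_derivative[OF assms(1)]\<close>)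
qed

lemma Ck_on_add:
  assumes "open S" "Ck_on k S f" "Ck_on k S g"
  shows "Ck_on k S (\<lambda>x. f x + g x)"
  using assms(2,3)
proof (induction k arbitrary: f g)
  case 0
  then show ?case by (simp add: continuous_on_add)
next
  case (Suc k)
  show ?case
    by (rule Ck_on_SucI[OF assms(1), where f' = "\<lambda>x v. frechet_derivative f (at x) v + frechet_derivative g (at x) v"])
       (use Ck_on_SucE[OF Suc.prems(1)] Ck_on_SucE[OF Suc.prems(2)] Suc.IH in \<open>auto intro: has_derivative_add\<close>)
qed

lemma Ck_on_sum:
  assumes "open S" "\<And>i. i \<in> I \<Longrightarrow> Ck_on k S (f i)"
  shows "Ck_on k S (\<lambda>x. \<Sum>i\<in>I. f i x)"
  using assms(2) by (induction I rule: infinite_finite_induct) (auto intro: Ck_on_const Ck_on_add[OF assms(1)])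

lemma Ck_on_bounded_bilinear:
  assumes "bounded_bilinear B" "open S" "Ck_on k S f" "Ck_on k S g"
  shows "Ck_on k S (\<lambda>x. B (f x) (g x))"
  using assms(3,4)
proof (induction k arbitrary: f g)
  case 0
  then show ?case
    using bounded_bilinear.continuous_on[OF assms(1)] by simp
next
  case (Suc k)
  note f = Ck_on_SucE[OF Suc.prems(1)] Ck_on_SucD[OF Suc.prems(1)]
  note g = Ck_on_SucE[OF Suc.prems(2)] Ck_on_SucD[OF Suc.prems(2)]
  show ?case
    by (rule Ck_on_SucI[OF assms(2), where f' =
          "\<lambda>x v. B (f x) (frechet_derivative g (at x) v) + B (frechet_derivative f (at x) v) (g x)"])
       (use f g Suc.IH in \<open>auto intro!: Ck_on_add[OF assms(2)] bounded_bilinear.FDERIV[OF assms(1)]\<close>)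
qed

lemma Ck_on_compose:
  fixes f :: "'b::euclidean_space \<Rightarrow> 'c::real_normed_vector" and g :: "'a::euclidean_space \<Rightarrow> 'b"
  assumes "open S" "open T" "g ` S \<subseteq> T" "Ck_on k S g" "Ck_on k T f"
  shows "Ck_on k S (\<lambda>x. f (g x))"
  using assms(4,5)
proof (induction k arbitrary: f)
  case 0
  then show ?case
    using assms(3) by (auto intro: continuous_on_compose2)
next
  case (Suc k)
  note f = Ck_on_SucE[OF Suc.prems(2)] and g = Ck_on_SucE[OF Suc.prems(1)] Ck_on_SucD[OF Suc.prems(1)]
  let ?f' = "\<lambda>y. frechet_derivative f (at y)" and ?g' = "\<lambda>x. frechet_derivative g (at x)"
  have "Ck_on k S (\<lambda>x. ?f' (g x) (?g' x v))" for v
  proof (rule Ck_on_cong[OF assms(1)])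
    \<comment> \<open>Regularity is available for derivatives in a fixed direction, whereas
      \<open>?g' x v\<close> moves with \<open>x\<close>. Expanding it in \<open>Basis\<close>
      leaves fixed directions with regular coefficients, and the induction hypothesis applies to
      each partial derivative of \<open>f\<close>.\<close>
    show "Ck_on k S (\<lambda>x. \<Sum>b\<in>Basis. (?g' x v \<bullet> b) *\<^sub>R ?f' (g x) b)"
      by (intro Ck_on_sum Ck_on_bounded_bilinear[OF bounded_bilinear_scaleR] assms(1) Suc.IH f g
          Ck_on_bounded_linear[OF bounded_linear_inner_left])
    fix x assume "x \<in> S"
    then have lin: "linear (?f' (g x))"
      using f(1)[of "g x"] assms(3) by (auto intro: has_derivative_linear)
    show "(\<Sum>b\<in>Basis. (?g' x v \<bullet> b) *\<^sub>R ?f' (g x) b) = ?f' (g x) (?g' x v)"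
      by (simp add: linear_sum[OF lin, symmetric] linear_scale[OF lin, symmetric] euclidean_representation)
  qed
  moreover have "((\<lambda>x. f (g x)) has_derivative (\<lambda>v. ?f' (g x) (?g' x v))) (at x)" if "x \<in> S" for x
    using diff_chain_at[OF g(1)[OF that] f(1)[of "g x"]] that assms(3) by (auto simp: o_def)
  ultimately show ?case
    by (intro Ck_on_SucI[OF assms(1)])
qed

lemma smooth_on_imp_differentiable: "smooth_on S f \<Longrightarrow> x \<in> S \<Longrightarrow> f differentiable (at x)"
  unfolding smooth_on_def by (metis Ck_on.simps(2))

lemma smooth_on_imp_continuous_on: "smooth_on S f \<Longrightarrow> continuous_on S f"
  unfolding smooth_on_def by (metis Ck_on.simps(1))

lemma smooth_on_cong: "open S \<Longrightarrow> (\<And>x. x \<in> S \<Longrightarrow> f x = g x) \<Longrightarrow> smooth_on S f \<Longrightarrow> smooth_on S g"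
  unfolding smooth_on_def using Ck_on_cong by blast

lemma smooth_on_subset: "smooth_on S f \<Longrightarrow> T \<subseteq> S \<Longrightarrow> smooth_on T f"
  unfolding smooth_on_def using Ck_on_subset by blast

lemma smooth_on_const: "smooth_on S (\<lambda>x. c)"
  by (simp add: smooth_on_def Ck_on_const)

lemma smooth_on_bounded_linear:
  "bounded_linear L \<Longrightarrow> open S \<Longrightarrow> smooth_on S f \<Longrightarrow> smooth_on S (\<lambda>x. L (f x))"
  by (simp add: smooth_on_def Ck_on_bounded_linear)

lemma smooth_on_add:
  "open S \<Longrightarrow> smooth_on S f \<Longrightarrow> smooth_on S g \<Longrightarrow> smooth_on S (\<lambda>x. f x + g x)"
  by (simp add: smooth_on_def Ck_on_add)

lemma smooth_on_sum:
  "open S \<Longrightarrow> (\<And>i. i \<in> I \<Longrightarrow> smooth_on S (f i)) \<Longrightarrow> smooth_on S (\<lambda>x. \<Sum>i\<in>I. f i x)"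
  by (simp add: smooth_on_def Ck_on_sum)

lemma smooth_on_scaleR:
  "open S \<Longrightarrow> smooth_on S f \<Longrightarrow> smooth_on S g \<Longrightarrow> smooth_on S (\<lambda>x. f x *\<^sub>R g x)"
  by (simp add: smooth_on_def Ck_on_bounded_bilinear[OF bounded_bilinear_scaleR])

lemma smooth_on_mult:
  fixes f g :: "_ \<Rightarrow> real"
  shows "open S \<Longrightarrow> smooth_on S f \<Longrightarrow> smooth_on S g \<Longrightarrow> smooth_on S (\<lambda>x. f x * g x)"
  using smooth_on_scaleR[of S f g] by simp

lemma smooth_on_minus: "open S \<Longrightarrow> smooth_on S f \<Longrightarrow> smooth_on S (\<lambda>x. - f x)"
  using smooth_on_bounded_linear[OF bounded_linear_minus[OF bounded_linear_ident]] by auto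

lemma smooth_on_diff:
  "open S \<Longrightarrow> smooth_on S f \<Longrightarrow> smooth_on S g \<Longrightarrow> smooth_on S (\<lambda>x. f x - g x)"
  using smooth_on_add[OF _ _ smooth_on_minus, of S f g] by simp

lemma smooth_on_compose:
  fixes f :: "'b::euclidean_space \<Rightarrow> 'c::real_normed_vector" and g :: "'a::euclidean_space \<Rightarrow> 'b"
  shows "open S \<Longrightarrow> open T \<Longrightarrow> g ` S \<subseteq> T \<Longrightarrow> smooth_on S g \<Longrightarrow> smooth_on T f \<Longrightarrow> smooth_on S (\<lambda>x. f (g x))"
  unfolding smooth_on_def using Ck_on_compose by blast

lemma smooth_on_frechet_derivative:
  "smooth_on S f \<Longrightarrow> smooth_on S (\<lambda>x. frechet_derivative f (at x) v)"
  unfolding smooth_on_def by (metis Ck_on.simps(2))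

lemma smooth_on_nth: "open S \<Longrightarrow> smooth_on S f \<Longrightarrow> smooth_on S (\<lambda>x. f x $ i)"
  for f :: "_ \<Rightarrow> 'b::real_normed_vector ^ 'n"
  by (rule smooth_on_bounded_linear[OF bounded_linear_vec_nth])

lemma smooth_on_vec:
  fixes f :: "_ \<Rightarrow> 'n::finite \<Rightarrow> 'b::euclidean_space"
  assumes "open S" "\<And>i. smooth_on S (\<lambda>x. f x i)"
  shows "smooth_on S (\<lambda>x. \<chi> i. f x i)"
proof -
  have "linear (axis i :: 'b \<Rightarrow> 'b ^ 'n)" for i
    by (auto intro!: linearI simp: axis_def vec_eq_iff)
  then have "smooth_on S (\<lambda>x. axis i (f x i) :: 'b ^ 'n)" for i
    using smooth_on_bounded_linear[of "axis i" S "\<lambda>x. f x i"] assms by (simp add: linear_conv_bounded_linear)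
  then have "smooth_on S (\<lambda>x. \<Sum>i\<in>UNIV. axis i (f x i) :: 'b ^ 'n)"
    by (intro smooth_on_sum assms(1))
  moreover have "(\<Sum>i\<in>UNIV. axis i (f x i)) = (\<chi> i. f x i)" for x
    by (simp add: vec_eq_iff axis_def if_distrib cong: if_cong)
  ultimately show ?thesis by simp
qed

lemma smooth_on_prod:
  fixes f :: "_ \<Rightarrow> _ \<Rightarrow> real"
  assumes "open S" "\<And>i. i \<in> I \<Longrightarrow> smooth_on S (f i)"
  shows "smooth_on S (\<lambda>x. \<Prod>i\<in>I. f i x)"
  using assms(2) by (induction I rule: infinite_finite_induct) (auto intro: smooth_on_const smooth_on_mult[OF assms(1)])

lemma smooth_on_det:
  fixes f :: "_ \<Rightarrow> real ^ 'n ^ 'n"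
  assumes "open S" "\<And>i j. smooth_on S (\<lambda>x. f x $ i $ j)"
  shows "smooth_on S (\<lambda>x. det (f x))"
  unfolding det_def
  by (intro smooth_on_sum smooth_on_mult smooth_on_prod smooth_on_const assms)

text \<open>The exponent stays arbitrary in the induction because differentiation lowers it by one.
  Roots and the reciprocal are both instances.\<close>

lemma Ck_on_powr: "Ck_on k {0<..} (\<lambda>x::real. x powr a)"
proof (induction k arbitrary: a)
  case 0
  then show ?case by (auto intro!: continuous_intros)
next
  case (Suc k)
  show ?case
  proof (rule Ck_on_SucI)
    fix x :: real assume "x \<in> {0<..}"
    then show "((\<lambda>x. x powr a) has_derivative (\<lambda>v. a * x powr (a - 1) * v)) (at x)"
      using has_real_derivative_powr[of x a] by (simp add: has_field_derivative_def)
  qed (auto intro!: Ck_on_bounded_bilinear[OF bounded_bilinear_mult] Ck_on_const Suc.IH)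
qed

lemma smooth_on_powr:
  fixes f :: "_ \<Rightarrow> real"
  assumes "open S" "smooth_on S f" "\<And>x. x \<in> S \<Longrightarrow> 0 < f x"
  shows "smooth_on S (\<lambda>x. f x powr a)"
  by (rule smooth_on_compose[of S "{0<..}" f "\<lambda>x. x powr a"])
     (use assms Ck_on_powr in \<open>auto simp: smooth_on_def\<close>)


section \<open>The cross product and the metric of a \<open>G\<^sub>2\<close> form\<close>

lemma exhaust_7:
  fixes x :: 7
  shows "x = 1 \<or> x = 2 \<or> x = 3 \<or> x = 4 \<or> x = 5 \<or> x = 6 \<or> x = 7"
proof (induct x)
  case (of_int z)
  then have "z = 0 \<or> z = 1 \<or> z = 2 \<or> z = 3 \<or> z = 4 \<or> z = 5 \<or> z = 6" by fastforce
  then show ?case by auto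
qed

lemma forall_7: "(\<forall>i::7. P i) \<longleftrightarrow> P 1 \<and> P 2 \<and> P 3 \<and> P 4 \<and> P 5 \<and> P 6 \<and> P 7"
  by (metis exhaust_7)

lemma UNIV_7: "UNIV = {1, 2, 3, 4, 5, 6, 7::7}"
  using exhaust_7 by auto

lemma sum_7: "sum f (UNIV::7 set) = f 1 + f 2 + f 3 + f 4 + f 5 + f 6 + f 7"
  unfolding UNIV_7 by (simp add: ac_simps)

lemma vector_7 [simp]:
  "(vector [a,b,c,d,e,f,g] ::('a::zero)^7)$1 = a"
  "(vector [a,b,c,d,e,f,g] ::('a::zero)^7)$2 = b"
  "(vector [a,b,c,d,e,f,g] ::('a::zero)^7)$3 = c"
  "(vector [a,b,c,d,e,f,g] ::('a::zero)^7)$4 = d"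
  "(vector [a,b,c,d,e,f,g] ::('a::zero)^7)$5 = e"
  "(vector [a,b,c,d,e,f,g] ::('a::zero)^7)$6 = f"
  "(vector [a,b,c,d,e,f,g] ::('a::zero)^7)$7 = g"
  unfolding vector_def by simp_all

lemma e3_expand:
  "e3 i j k u v w = u$i * (v$j * w$k - v$k * w$j) - u$j * (v$i * w$k - v$k * w$i)
     + u$k * (v$i * w$j - v$j * w$i)"
  by (simp add: e3_def det_3 algebra_simps)

text \<open>The imaginary part of the product of imaginary octonions, for the multiplication table
  encoded in \<open>phi0\<close>.\<close>

definition cross7 :: "real ^ 7 \<Rightarrow> real ^ 7 \<Rightarrow> real ^ 7" where
  "cross7 u v = (\<chi> k. phi0 u v (axis k 1))"

lemma cross7_nth:
  "cross7 u v $ 1 = (u $ 2 * v $ 3 - u $ 3 * v $ 2) + (u $ 4 * v $ 5 - u $ 5 * v $ 4) + (u $ 6 * v $ 7 - u $ 7 * v $ 6)"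
  "cross7 u v $ 2 = (u $ 3 * v $ 1 - u $ 1 * v $ 3) + (u $ 4 * v $ 6 - u $ 6 * v $ 4) - (u $ 5 * v $ 7 - u $ 7 * v $ 5)"
  "cross7 u v $ 3 = (u $ 1 * v $ 2 - u $ 2 * v $ 1) - (u $ 4 * v $ 7 - u $ 7 * v $ 4) - (u $ 5 * v $ 6 - u $ 6 * v $ 5)"
  "cross7 u v $ 4 = (u $ 5 * v $ 1 - u $ 1 * v $ 5) + (u $ 6 * v $ 2 - u $ 2 * v $ 6) - (u $ 7 * v $ 3 - u $ 3 * v $ 7)"
  "cross7 u v $ 5 = (u $ 1 * v $ 4 - u $ 4 * v $ 1) - (u $ 7 * v $ 2 - u $ 2 * v $ 7) - (u $ 6 * v $ 3 - u $ 3 * v $ 6)"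
  "cross7 u v $ 6 = (u $ 7 * v $ 1 - u $ 1 * v $ 7) + (u $ 2 * v $ 4 - u $ 4 * v $ 2) - (u $ 3 * v $ 5 - u $ 5 * v $ 3)"
  "cross7 u v $ 7 = (u $ 1 * v $ 6 - u $ 6 * v $ 1) - (u $ 2 * v $ 5 - u $ 5 * v $ 2) - (u $ 3 * v $ 4 - u $ 4 * v $ 3)"
  by (simp_all add: cross7_def phi0_def e3_expand axis_def)

lemma inner_7: "u \<bullet> v = u $ 1 * v $ 1 + u $ 2 * v $ 2 + u $ 3 * v $ 3 + u $ 4 * v $ 4
    + u $ 5 * v $ 5 + u $ 6 * v $ 6 + u $ 7 * v $ 7" for u v :: "real ^ 7"
  by (simp add: inner_vec_def sum_7)

lemma cross7_inner: "cross7 u v \<bullet> w = phi0 u v w"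
  unfolding inner_7 cross7_nth phi0_def e3_expand by (simp add: algebra_simps)

lemma phi0_swap: "phi0 v u w = - phi0 u v w" "phi0 u w v = - phi0 u v w"
  unfolding phi0_def e3_expand by (simp_all add: algebra_simps)

lemma cross7_swap: "cross7 v u = - cross7 u v"
  by (simp add: cross7_def vec_eq_iff phi0_swap(1)[of v u])

lemma bilinear_cross7: "bilinear cross7"
  by (auto simp: bilinear_def vec_eq_iff forall_7 cross7_nth algebra_simps intro!: linearI)

text \<open>The source of every complex structure below: on the complement of a unit vector
  \<open>u\<close> it says that \<open>u \<times> _\<close> squares to -1. It reflects the
  alternative law of the octonions, and each of its seven coordinates is a polynomial
  identity.\<close>

lemma cross7_cross7: "cross7 u (cross7 u v) = (u \<bullet> v) *\<^sub>R u - (u \<bullet> u) *\<^sub>R v"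
  unfolding vec_eq_iff forall_7 
  apply (intro conjI)
  apply (simp_all only: cross7_nth inner_7 vector_minus_component vector_scaleR_component real_scaleR_def)
  apply (simp_all add: algebra_simps)
done
lemma cross7_inner_self: "cross7 u v \<bullet> cross7 u v = (u \<bullet> u) * (v \<bullet> v) - (u \<bullet> v)\<^sup>2"
proof -
  have "cross7 u v \<bullet> cross7 u v = - (cross7 u (cross7 u v) \<bullet> v)"
    by (simp add: cross7_inner phi0_swap(2)[of u v])
  then show ?thesis
    by (simp add: cross7_cross7 inner_diff_left power2_eq_square)
qed

lemma prod_7: "prod f (UNIV::7 set) = f 1 * f 2 * f 3 * f 4 * f 5 * f 6 * f 7"
  unfolding UNIV_7 by (simp add: ac_simps)

section \<open>The Hodge dual of the model form\<close>

definition e4 :: "7 \<Rightarrow> 7 \<Rightarrow> 7 \<Rightarrow> 7 \<Rightarrow> real ^ 7 \<Rightarrow> real ^ 7 \<Rightarrow> real ^ 7 \<Rightarrow> real ^ 7 \<Rightarrow> real" where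
  "e4 i j k l u v w z = u $ i * e3 j k l v w z - u $ j * e3 i k l v w z
     + u $ k * e3 i j l v w z - u $ l * e3 i j k v w z"

text \<open>The product belonging to a permutation that moves 1, 2 or 3 contains a zero entry of a
  unit row. So 24 permutations remain of 5040, and these are expanded.\<close>

lemma det_block_3_4:
  fixes A :: "real ^ 7 ^ 7"
  assumes "A $ 1 = axis 1 1" "A $ 2 = axis 2 1" "A $ 3 = axis 3 1"
  shows "det A = e4 4 5 6 7 (A $ 4) (A $ 5) (A $ 6) (A $ 7)"
proof -
  have zero: "(\<Prod>i\<in>UNIV. A $ i $ p i) = 0" if "p permutes UNIV" "\<not> p permutes {4,5,6,7}" for p
  proof -
    have "\<not> (\<forall>x. x \<notin> {4,5,6,7} \<longrightarrow> p x = x)"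
      using that unfolding permutes_def by blast
    then have "\<exists>x. x \<in> {1,2,3} \<and> p x \<noteq> x"
      using exhaust_7 by blast
    then obtain x where "x \<in> {1,2,3}" "p x \<noteq> x" by blast
    then have "A $ x $ p x = 0"
      using assms by (auto simp: axis_def)
    then show ?thesis
      by (meson UNIV_I finite prod_zero)
  qed
  have "det A = (\<Sum>p\<in>{p. p permutes {4,5,6,7}}. of_int (sign p) * (\<Prod>i\<in>UNIV. A $ i $ p i))"
    unfolding det_def
    by (rule sum.mono_neutral_right) (auto simp: zero finite_permutations permutes_subset)
  also have "\<dots> = (\<Sum>p\<in>{p. p permutes {4,5,6,7}}. of_int (sign p) * (A$4$p 4 * A$5$p 5 * A$6$p 6 * A$7$p 7))"
  proof (rule sum.cong[OF refl])
    fix p :: "7 \<Rightarrow> 7" assume "p \<in> {p. p permutes {4,5,6,7}}"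
    then have "p 1 = 1" "p 2 = 2" "p 3 = 3"
      using permutes_not_in[of p "{4,5,6,7}"] by simp_all
    then show "of_int (sign p) * (\<Prod>i\<in>UNIV. A $ i $ p i) = of_int (sign p) * (A$4$p 4 * A$5$p 5 * A$6$p 6 * A$7$p 7)"
      by (simp add: prod_7 assms axis_def)
  qed
  finally have *: "det A = \<dots>" .
  have f: "finite {5,6,7::7}" "4 \<notin> {5,6,7::7}" "finite {6,7::7}" "5 \<notin> {6,7::7}" "finite {7::7}" "6 \<notin> {7::7}"
    by auto
  show ?thesis
    unfolding * e4_def e3_expand
    unfolding sum_over_permutations_insert[OF f(1,2)]
    unfolding sum_over_permutations_insert[OF f(3,4)]
    unfolding sum_over_permutations_insert[OF f(5,6)]
    unfolding permutes_sing
    by (simp add: sign_swap_id permutation_swap_id permutation_compose sign_compose sign_id swap_id_eq algebra_simps)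
qed

text \<open>Permuting the columns by \<open>p\<close> carries the three unit rows to the first three
  unit vectors, which is the block case; the sign of \<open>p\<close> is its own inverse.\<close>

lemma det_axis_permuted:
  assumes p: "p permutes UNIV"
  shows "det (vector [axis (p 1) 1, axis (p 2) 1, axis (p 3) 1, u, v, w, z] :: real ^ 7 ^ 7)
    = of_int (sign p) * e4 (p 4) (p 5) (p 6) (p 7) u v w z"
proof -
  let ?A = "vector [axis (p 1) 1, axis (p 2) 1, axis (p 3) 1, u, v, w, z] :: real ^ 7 ^ 7"
  let ?B = "\<chi> i j. ?A $ i $ p j"
  have inj: "p i = p j \<longleftrightarrow> i = j" for i j
    using permutes_inj[OF p] by (auto dest: injD)
  have "det ?B = e4 4 5 6 7 (?B $ 4) (?B $ 5) (?B $ 6) (?B $ 7)"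
    by (rule det_block_3_4) (simp_all add: vec_eq_iff axis_def inj)
  also have "\<dots> = e4 (p 4) (p 5) (p 6) (p 7) u v w z"
    by (simp add: e4_def e3_expand)
  finally have "e4 (p 4) (p 5) (p 6) (p 7) u v w z = of_int (sign p) * det ?A"
    using det_permute_columns[OF p, of ?A] by simp
  then show ?thesis
    by (cases p rule: sign_cases) simp_all
qed

text \<open>This triple and the six that follow are the terms of \<open>phi0\<close>. Each time the
  permutation sends 1, 2, 3 to the triple and 4, 5, 6, 7 to its complement in increasing order; all
  seven permutations are even, so no sign appears.\<close>

lemma det_axis_123:
  "det (vector [axis 1 1, axis 2 1, axis 3 1, u, v, w, z] :: real ^ 7 ^ 7) = e4 4 5 6 7 u v w z"
  using det_axis_permuted[of id u v w z] by (simp add: permutes_id sign_id)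

lemma det_axis_145:
  "det (vector [axis 1 1, axis 4 1, axis 5 1, u, v, w, z] :: real ^ 7 ^ 7) = e4 2 3 6 7 u v w z"
  using det_axis_permuted[of "Transposition.transpose 2 4 \<circ> Transposition.transpose 3 5" u v w z]
  by (simp_all add: permutes_compose permutes_swap_id sign_compose permutation_compose permutation_swap_id sign_swap_id transpose_def)

lemma det_axis_167:
  "det (vector [axis 1 1, axis 6 1, axis 7 1, u, v, w, z] :: real ^ 7 ^ 7) = e4 2 3 4 5 u v w z"
  using det_axis_permuted[of "Transposition.transpose 2 6 \<circ> Transposition.transpose 3 7 \<circ> Transposition.transpose 4 6 \<circ> Transposition.transpose 5 7" u v w z]
  by (simp_all add: permutes_compose permutes_swap_id sign_compose permutation_compose permutation_swap_id sign_swap_id transpose_def)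

lemma det_axis_246:
  "det (vector [axis 2 1, axis 4 1, axis 6 1, u, v, w, z] :: real ^ 7 ^ 7) = e4 1 3 5 7 u v w z"
  using det_axis_permuted[of "Transposition.transpose 1 2 \<circ> Transposition.transpose 2 4 \<circ> Transposition.transpose 3 6 \<circ> Transposition.transpose 5 6" u v w z]
  by (simp_all add: permutes_compose permutes_swap_id sign_compose permutation_compose permutation_swap_id sign_swap_id transpose_def)

lemma det_axis_257:
  "det (vector [axis 2 1, axis 5 1, axis 7 1, u, v, w, z] :: real ^ 7 ^ 7) = e4 1 3 4 6 u v w z"
  using det_axis_permuted[of "Transposition.transpose 1 2 \<circ> Transposition.transpose 2 5 \<circ> Transposition.transpose 3 7 \<circ> Transposition.transpose 4 5 \<circ> Transposition.transpose 5 7 \<circ> Transposition.transpose 6 7" u v w z]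
  by (simp_all add: permutes_compose permutes_swap_id sign_compose permutation_compose permutation_swap_id sign_swap_id transpose_def)

lemma det_axis_347:
  "det (vector [axis 3 1, axis 4 1, axis 7 1, u, v, w, z] :: real ^ 7 ^ 7) = e4 1 2 5 6 u v w z"
  using det_axis_permuted[of "Transposition.transpose 1 3 \<circ> Transposition.transpose 2 4 \<circ> Transposition.transpose 3 7 \<circ> Transposition.transpose 4 7 \<circ> Transposition.transpose 5 7 \<circ> Transposition.transpose 6 7" u v w z]
  by (simp_all add: permutes_compose permutes_swap_id sign_compose permutation_compose permutation_swap_id sign_swap_id transpose_def)

lemma det_axis_356:
  "det (vector [axis 3 1, axis 5 1, axis 6 1, u, v, w, z] :: real ^ 7 ^ 7) = e4 1 2 4 7 u v w z"
  using det_axis_permuted[of "Transposition.transpose 1 3 \<circ> Transposition.transpose 2 5 \<circ> Transposition.transpose 3 6 \<circ> Transposition.transpose 4 6" u v w z]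
  by (simp_all add: permutes_compose permutes_swap_id sign_compose permutation_compose permutation_swap_id sign_swap_id transpose_def)

text \<open>The model of \<open>star_phi\<close>: the sum of \<open>hodge_star3\<close> for
  \<open>phi0\<close>, taken over the standard basis instead of the basis chosen by
  \<open>onb\<close>.\<close>

definition hodge0 :: "real ^ 7 \<Rightarrow> real ^ 7 \<Rightarrow> real ^ 7 \<Rightarrow> real ^ 7 \<Rightarrow> real" where
  "hodge0 u v w z = (1 / 6) * (\<Sum>i\<in>UNIV. \<Sum>j\<in>UNIV. \<Sum>k\<in>UNIV.
     phi0 (axis i 1) (axis j 1) (axis k 1) * det (vector [axis i 1, axis j 1, axis k 1, u, v, w, z] :: real ^ 7 ^ 7))"

lemma sum_axis_axis_axis:
  "(\<Sum>i\<in>UNIV. \<Sum>j\<in>UNIV. \<Sum>k\<in>UNIV. (axis i 1 $ a * (axis j 1 $ b * axis k 1 $ c)) * T i j k) = T a b c"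
  for T :: "'n::finite \<Rightarrow> 'n \<Rightarrow> 'n \<Rightarrow> real"
proof -
  have "(\<Sum>k\<in>UNIV. (axis i 1 $ a * (axis j 1 $ b * axis k 1 $ c)) * T i j k) 
    = (if j = b then if i = a then T i j c else 0 else 0)" for i j
    by (auto simp: axis_def if_distrib[of "\<lambda>x. x * _"] cong: if_cong)
  then show ?thesis by simp
qed

text \<open>On unit vectors \<open>e3 a b c\<close> is nonzero only for the six orderings of
  \<open>a, b, c\<close>, with the sign of the ordering, and the alternating \<open>T\<close>
  carries the same sign. The resulting 6 cancels the \<open>1 / 6\<close> of the Hodge star.\<close>

lemma sum_e3_axis:
  assumes 1: "\<And>i j k. T j i k = - T i j k" and 2: "\<And>i j k. T i k j = - T i j k"
  shows "(\<Sum>i\<in>UNIV. \<Sum>j\<in>UNIV. \<Sum>k\<in>UNIV. e3 a b c (axis i 1) (axis j 1) (axis k 1) * T i j k) = 6 * T a b c"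
proof -
  have "(\<Sum>i\<in>UNIV. \<Sum>j\<in>UNIV. \<Sum>k\<in>UNIV. e3 a b c (axis i 1) (axis j 1) (axis k 1) * T i j k)
    = T a b c - T a c b - T b a c + T b c a + T c a b - T c b a"
    unfolding e3_expand right_diff_distrib
    by (simp only: left_diff_distrib distrib_right sum.distrib sum_subtractf sum_axis_axis_axis)
  also have "\<dots> = 6 * T a b c"
    using 1[of b a c] 2[of a c b] 1[of c a b] 2[of c a b] 1[of b c a] 2[of b a c] by simp
  finally show ?thesis .
qed
text \<open>The vector paired with \<open>z\<close> is the model of \<open>\<chi>(u, v, w)\<close>.
  Both factors of the triple sum alternate, so each of the seven terms of \<open>phi0\<close>
  contributes a single determinant, and what is left is a polynomial identity.\<close>

lemma hodge0_eq: "hodge0 u v w z = (cross7 (cross7 u v) w - (u \<bullet> w) *\<^sub>R v + (v \<bullet> w) *\<^sub>R u) \<bullet> z"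
proof -
  define T where "T i j k = det (vector [axis i 1, axis j 1, axis k 1, u, v, w, z] :: real ^ 7 ^ 7)" for i j k
  have p: "Transposition.transpose 1 2 permutes (UNIV :: 7 set)" "Transposition.transpose 2 3 permutes (UNIV :: 7 set)"
    by (simp_all add: permutes_swap_id)
  have T1: "T j i k = - T i j k" for i j k
  proof -
    have "(\<chi> l. (vector [axis i 1, axis j 1, axis k 1, u, v, w, z] :: real ^ 7 ^ 7) $ Transposition.transpose 1 2 l)
      = vector [axis j 1, axis i 1, axis k 1, u, v, w, z]"
      by (simp add: vec_eq_iff[where 'b=7] forall_7 transpose_def)
    then show ?thesis
      using det_permute_rows[OF p(1), of "vector [axis i 1, axis j 1, axis k 1, u, v, w, z]"]
      by (simp add: T_def sign_swap_id)
  qed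
  have T2: "T i k j = - T i j k" for i j k
  proof -
    have "(\<chi> l. (vector [axis i 1, axis j 1, axis k 1, u, v, w, z] :: real ^ 7 ^ 7) $ Transposition.transpose 2 3 l)
      = vector [axis i 1, axis k 1, axis j 1, u, v, w, z]"
      by (simp add: vec_eq_iff[where 'b=7] forall_7 transpose_def)
    then show ?thesis
      using det_permute_rows[OF p(2), of "vector [axis i 1, axis j 1, axis k 1, u, v, w, z]"]
      by (simp add: T_def sign_swap_id)
  qed
  have "hodge0 u v w z = T 1 2 3 + T 1 4 5 + T 1 6 7 + T 2 4 6 - T 2 5 7 - T 3 4 7 - T 3 5 6"
    unfolding hodge0_def phi0_def T_def[symmetric]
    by (simp only: left_diff_distrib distrib_right sum.distrib sum_subtractf sum_e3_axis[of T, OF T1 T2]) simp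
  also have "\<dots> = e4 4 5 6 7 u v w z + e4 2 3 6 7 u v w z + e4 2 3 4 5 u v w z + e4 1 3 5 7 u v w z
     - e4 1 3 4 6 u v w z - e4 1 2 5 6 u v w z - e4 1 2 4 7 u v w z"
    unfolding T_def det_axis_123 det_axis_145 det_axis_167 det_axis_246 det_axis_257 det_axis_347 det_axis_356 ..
  also have "\<dots> = (cross7 (cross7 u v) w - (u \<bullet> w) *\<^sub>R v + (v \<bullet> w) *\<^sub>R u) \<bullet> z"
    unfolding inner_7[of _ z] e4_def e3_expand vector_minus_component vector_add_component vector_scaleR_component
      real_scaleR_def cross7_nth inner_7
    by (simp add: algebra_simps)
  finally show ?thesis .
qed


section \<open>Determinants of rank-one perturbations\<close>

definition outer :: "real ^ 'n \<Rightarrow> real ^ 'n \<Rightarrow> real ^ 'n ^ 'n" where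
  "outer x y = (\<chi> i j. x $ i * y $ j)"

lemma outer_mult_vec: "outer x y *v z = (y \<bullet> z) *\<^sub>R x"
  by (simp add: outer_def matrix_vector_mult_def vec_eq_iff inner_vec_def sum_distrib_left mult_ac)

lemma matrix_mult_outer: "A ** outer x y = outer (A *v x) y"
  by (simp add: outer_def matrix_matrix_mult_def matrix_vector_mult_def vec_eq_iff sum_distrib_left mult_ac)

lemma outer_mult_matrix: "outer x y ** A = outer x (transpose A *v y)"
  by (simp add: outer_def matrix_matrix_mult_def matrix_vector_mult_def transpose_def vec_eq_iff sum_distrib_left mult_ac)

lemma transpose_outer: "transpose (outer x y) = outer y x"
  by (simp add: outer_def transpose_def vec_eq_iff mult_ac)

lemma outer_zero_left: "outer 0 y = 0" and outer_zero_right: "outer x 0 = 0"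
  by (simp_all add: outer_def vec_eq_iff)

lemma outer_add_left: "outer (x + x') y = outer x y + outer x' y"
  and outer_add_right: "outer x (y + y') = outer x y + outer x y'"
  by (simp_all add: outer_def vec_eq_iff algebra_simps)

lemma matrix_vector_mult_minus_left: "(- A) *v x = - (A *v x)" for A :: "real ^ 'n ^ 'm"
  by (simp add: matrix_vector_mult_def vec_eq_iff sum_negf)

lemma matrix_add_rdistrib: "(A + B) ** C = A ** C + B ** C" for A B :: "real ^ 'n ^ 'm"
  by (simp add: matrix_matrix_mult_def vec_eq_iff sum.distrib algebra_simps)

lemma det_scaleR: "det (c *\<^sub>R A) = c ^ CARD('n) * det A" for A :: "real ^ 'n ^ 'n"
  by (simp add: det_def prod.distrib sum_distrib_left mult_ac)

text \<open>The matrix determinant lemma, proved by switching on the rank-one term one row at a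
  time: \<open>S\<close> is the set of rows already changed.\<close>

lemma det_one_plus_outer: "det (mat 1 + outer r w) = 1 + r \<bullet> w" for r w :: "real ^ 'n"
proof -
  have mat_1: "(\<chi> i. axis i 1) = (mat 1 :: real ^ 'n ^ 'n)"
    by (auto simp: vec_eq_iff mat_def axis_def)
  have rows: "det (\<chi> i. if i \<in> S then axis i 1 + r $ i *\<^sub>R w else axis i 1) = 1 + (\<Sum>i\<in>S. r $ i * w $ i)"
    for S :: "'n set"
  proof (induction S rule: infinite_finite_induct)
    case (insert k S)
    let ?c = "\<lambda>i. if i \<in> S then axis i 1 + r $ i *\<^sub>R w else axis i 1"
    let ?D = "\<lambda>x. det (\<chi> i. if i = k then x else ?c i)"
    let ?E = "\<lambda>x. det (\<chi> i. if i = k then x else axis i 1)"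
    \<comment> \<open>With \<open>w\<close> itself as row \<open>k\<close>, the multiples of
      \<open>w\<close> in the other rows can be subtracted without changing the determinant.\<close>
    have row: "?D w = ?E w"
    proof -
      have "det (\<chi> i. if i = k then w else if i \<in> S' then axis i 1 + r $ i *\<^sub>R w else axis i 1) = ?E w"
        if "finite S'" "k \<notin> S'" for S'
        using that
      proof (induction S')
        case (insert l S')
        let ?A = "\<chi> i. if i = k then w else if i \<in> insert l S' then axis i 1 + r $ i *\<^sub>R w else axis i 1"
        have "l \<noteq> k" using insert by auto
        have "det (\<chi> i. if i = l then row l ?A + (- r $ l) *s row k ?A else row i ?A) = det ?A"
          by (rule det_row_operation) (use \<open>l \<noteq> k\<close> in auto)
        moreover have "(\<chi> i. if i = l then row l ?A + (- r $ l) *s row k ?A else row i ?A)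
          = (\<chi> i. if i = k then w else if i \<in> S' then axis i 1 + r $ i *\<^sub>R w else axis i 1)"
          using \<open>l \<noteq> k\<close> insert(2) by (auto simp: vec_eq_iff row_def)
        ultimately show ?case using insert by simp
      qed (simp cong: if_cong)
      then show ?thesis using insert by blast
    qed
    \<comment> \<open>Cramer's rule for the identity matrix, transposed to speak about a
      row.\<close>
    have "?E w = w $ k"
    proof -
      have "det (\<chi> i j. if j = k then (mat 1 *v w) $ i else (mat 1 :: real^'n^'n) $ i $ j) = w $ k * det (mat 1 :: real^'n^'n)"
        by (rule cramer_lemma)
      moreover have "(\<chi> i j. if j = k then (mat 1 *v w) $ i else (mat 1 :: real^'n^'n) $ i $ j)
        = transpose (\<chi> i. if i = k then w else axis i 1)"
        unfolding matrix_vector_mul_lid by (auto simp: vec_eq_iff transpose_def mat_def axis_def)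
      ultimately show ?thesis by simp
    qed
    moreover have "?D (axis k 1 + r $ k *\<^sub>R w) = ?D (axis k 1) + r $ k * ?D w"
      using det_row_add[of k "\<lambda>_. axis k 1" "\<lambda>_. r $ k *s w" ?c]
        det_row_mul[of k "r $ k" "\<lambda>_. w" ?c]
      by (simp only: scalar_mult_eq_scaleR)
    moreover have "(\<chi> i. if i = k then axis k 1 else ?c i) = (\<chi> i. ?c i)"
      using insert by (auto simp: vec_eq_iff)
    moreover have "(\<chi> i. if i = k then axis k 1 + r $ k *\<^sub>R w else ?c i)
      = (\<chi> i. if i \<in> insert k S then axis i 1 + r $ i *\<^sub>R w else axis i 1)"
      by (auto simp: vec_eq_iff)
    ultimately show ?case using insert row by simp
  qed (simp_all add: mat_1 cong: if_cong)
  have "(\<chi> i. if i \<in> UNIV then axis i 1 + r $ i *\<^sub>R w else axis i 1) = mat 1 + outer r w"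
    by (auto simp: outer_def mat_def axis_def vec_eq_iff)
  then show ?thesis
    using rows[of UNIV] by (simp only: inner_vec_def inner_real_def)
qed


definition cross_matrix :: "real ^ 7 \<Rightarrow> real ^ 7 ^ 7" where
  "cross_matrix w = matrix (cross7 w)"

lemma linear_cross7: "linear (cross7 w)"
  using bilinear_cross7 by (simp add: bilinear_def)

lemma cross_matrix_mult_vec [simp]: "cross_matrix w *v x = cross7 w x"
  by (simp add: cross_matrix_def linear_cross7)

lemma transpose_cross_matrix: "transpose (cross_matrix w) = - cross_matrix w"
proof -
  have skew: "cross7 w (axis i 1) $ j = - cross7 w (axis j 1) $ i" for i j
    using cross7_inner[of w "axis i 1" "axis j 1"] cross7_inner[of w "axis j 1" "axis i 1"]
      phi0_swap(2)[of w "axis i 1" "axis j 1"]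
    by (simp add: inner_axis)
  show ?thesis
    unfolding vec_eq_iff
  proof (intro allI)
    fix i j show "transpose (cross_matrix w) $ i $ j = (- cross_matrix w) $ i $ j"
      using skew[of i j] by (simp add: cross_matrix_def matrix_def transpose_def)
  qed
qed

lemma cross7_self: "cross7 w w = 0"
  by (simp add: vec_eq_iff forall_7 cross7_nth)

text \<open>Multiply \<open>M + w w\<^sup>T\<close> by its transpose. As \<open>M\<close> is skew,
  kills \<open>w\<close> and satisfies \<open>M\<^sup>2 = w w\<^sup>T - n\<close> with
  \<open>n = w \<bullet> w\<close>, the product is \<open>n + (n - 1) w w\<^sup>T\<close>, whose
  determinant is \<open>n ^ 7 * (1 + (n - 1))\<close>.\<close>

lemma det_cross_matrix_outer_self: "(det (cross_matrix w + outer w w))\<^sup>2 = (w \<bullet> w) ^ 8"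
proof (cases "w = 0")
  case True
  moreover have "mat 0 = (0 :: real ^ 7 ^ 7)"
    by (simp add: mat_def vec_eq_iff)
  ultimately show ?thesis
    using bilinear_lzero[OF bilinear_cross7] det_0[where ?'a = real and ?'n = 7]
    by (simp add: cross_matrix_def matrix_def outer_def zero_vec_def[symmetric])
next
  case False
  let ?n = "w \<bullet> w" and ?M = "cross_matrix w"
  have n: "?n \<noteq> 0" using False by simp
  have "(?M + outer w w) ** transpose (?M + outer w w) = (?M + outer w w) ** (outer w w - ?M)"
  proof -
    have "transpose (?M + outer w w) = transpose ?M + transpose (outer w w)"
      by (simp add: transpose_def vec_eq_iff)
    then show ?thesis by (simp add: transpose_cross_matrix transpose_outer)
  qed
  also have "\<dots> = ?n *\<^sub>R (mat 1 + outer (((?n - 1) / ?n) *\<^sub>R w) w)"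
  proof -
    have "?M *v ((w \<bullet> x) *\<^sub>R w) = 0" for x
      by (simp add: linear_scale[OF linear_cross7] cross7_self)
    moreover have "w \<bullet> cross7 w x = 0" for x
      using cross7_inner[of w x w] phi0_swap(2)[of w w x] by (simp add: inner_commute cross7_inner[symmetric] cross7_self)
    ultimately show ?thesis
      using n by (simp add: matrix_eq matrix_vector_mul_assoc[symmetric] matrix_vector_mult_diff_rdistrib
          matrix_vector_mult_add_rdistrib matrix_vector_mult_diff_distrib
          outer_mult_vec cross7_cross7 scaleR_matrix_vector_assoc[symmetric] algebra_simps diff_divide_distrib inner_diff_right
          linear_diff[OF linear_cross7] linear_scale[OF linear_cross7] cross7_self)
  qed
  finally have "det (?M + outer w w) * det (?M + outer w w) = det (?n *\<^sub>R (mat 1 + outer (((?n - 1) / ?n) *\<^sub>R w) w))"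
    by (metis det_mul det_transpose)
  also have "\<dots> = ?n ^ 7 * (1 + (((?n - 1) / ?n) *\<^sub>R w) \<bullet> w)"
    by (simp add: det_scaleR det_one_plus_outer)
  also have "\<dots> = ?n ^ 8"
    using n by (simp add: field_simps eval_nat_numeral)
  finally show ?thesis by (simp add: power2_eq_square)
qed

text \<open>The congruence by \<open>P = 1 + r w\<^sup>T\<close> fixes \<open>M\<close>, because
  \<open>M\<close> and its transpose kill \<open>w\<close>, and it takes \<open>y y\<^sup>T\<close>
  to \<open>w w\<^sup>T\<close>. This reduces to the case \<open>y = w\<close>.\<close>

lemma det_cross_matrix_outer:
  assumes "w \<bullet> y \<noteq> 0"
  shows "(det (cross_matrix w + outer y y))\<^sup>2 = (w \<bullet> w) ^ 4 * (w \<bullet> y) ^ 4"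
proof -
  let ?n = "w \<bullet> w" and ?M = "cross_matrix w"
  have n: "?n \<noteq> 0" using assms by auto
  \<comment> \<open>The solution of \<open>P y = w\<close>; it gives
    \<open>det P = (w \<bullet> w) / (w \<bullet> y)\<close>.\<close>
  define r where "r = (1 / (w \<bullet> y)) *\<^sub>R (w - y)"
  let ?P = "mat 1 + outer r w"
  have Py: "y + (w \<bullet> y) *\<^sub>R r = w"
    using assms by (simp add: r_def)
  have TP: "transpose ?P = mat 1 + outer w r"
    using transpose_outer[of r w] by (simp add: transpose_def vec_eq_iff mat_def eq_commute)
  have "transpose ?M *v w = 0"
    by (simp add: transpose_cross_matrix matrix_vector_mult_minus_left cross7_self)
  then have "?P ** (?M + outer y y) = ?M + outer w y"
    by (simp add: matrix_add_ldistrib matrix_add_rdistrib outer_mult_matrix matrix_mult_outer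
        matrix_vector_mult_add_rdistrib outer_mult_vec Py outer_zero_right
        flip: add.assoc outer_add_left)
  moreover have "(?M + outer w y) ** transpose ?P = ?M + outer w w"
  proof -
    have "outer w y + outer w y ** outer w r = outer w (y + (w \<bullet> y) *\<^sub>R r)"
      by (simp add: outer_mult_matrix transpose_outer outer_mult_vec outer_add_right)
    then show ?thesis
      by (simp add: TP matrix_add_ldistrib matrix_add_rdistrib matrix_mult_outer cross7_self Py outer_zero_left
          matrix_vector_mult_add_rdistrib)
  qed
  ultimately have "det (?M + outer w w) = det (?P ** (?M + outer y y) ** transpose ?P)"
    by simp
  also have "\<dots> = (?n / (w \<bullet> y))\<^sup>2 * det (?M + outer y y)"
    using assms by (simp add: det_mul det_one_plus_outer r_def inner_diff_left power2_eq_square field_simps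
        inner_commute[of y w])
  finally have "(?n / (w \<bullet> y)) ^ 4 * (det (?M + outer y y))\<^sup>2 = ?n ^ 8"
    using det_cross_matrix_outer_self[of w] by (simp add: power_mult_distrib flip: power_mult)
  also have "\<dots> = (?n / (w \<bullet> y)) ^ 4 * (?n ^ 4 * (w \<bullet> y) ^ 4)"
    using assms by (simp add: power_divide field_simps flip: power_add)
  finally show ?thesis using n assms by simp
qed

section \<open>Recovering the metric from the 3-form\<close>

text \<open>The index order is that of \<open>cross_matrix\<close>: for \<open>a = phi0\<close> the
  two matrices agree.\<close>

definition form_matrix :: "(real ^ 7 \<Rightarrow> real ^ 7 \<Rightarrow> real ^ 7 \<Rightarrow> real) \<Rightarrow> real ^ 7 \<Rightarrow> real ^ 7 ^ 7" where
  "form_matrix a u = (\<chi> i j. a u (axis j 1) (axis i 1))"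

text \<open>A bilinear form transforms by congruence under a change of variables, so the determinant
  picks up the square of \<open>det (matrix k)\<close>, and its own square the fourth power.\<close>

lemma det_form_matrix:
  assumes k: "linear k" "inj k" and a: "\<And>x y z. a x y z = phi0 (k x) (k y) (k z)" and u: "u \<noteq> 0"
  shows "(det (form_matrix a u + outer u u))\<^sup>2 = (det (matrix k)) ^ 4 * (k u \<bullet> k u) ^ 4 * (u \<bullet> u) ^ 4"
proof -
  let ?K = "matrix k"
  have detK: "det ?K \<noteq> 0"
    using k det_nz_iff_inj by blast
  have K: "?K *v x = k x" for x
    by (simp add: k(1))
  have adj: "x \<bullet> (transpose ?K *v y) = k x \<bullet> y" for x y
    by (simp only: transpose_matrix_vector inner_commute[of x] dot_lmul_matrix K inner_commute[of y])
  have "invertible (transpose ?K)"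
    using detK by (simp add: invertible_det_nz)
  \<comment> \<open>Writing \<open>u\<close> as \<open>K\<^sup>T y\<close> brings the rank-one term
    into the congruence as well. Then \<open>k u \<bullet> y = u \<bullet> u\<close> is nonzero, as
    the determinant formula for the model requires.\<close>
  then obtain y where y: "transpose ?K *v y = u"
    by (metis invertible_def matrix_vector_mul_assoc matrix_vector_mul_lid)
  have "form_matrix a u = transpose ?K ** cross_matrix (k u) ** ?K"
  proof -
    have "(transpose ?K ** cross_matrix (k u) ** ?K) $ i $ j = a u (axis j 1) (axis i 1)" for i j
    proof -
      have "(transpose ?K ** cross_matrix (k u) ** ?K) $ i $ j
        = axis i 1 \<bullet> ((transpose ?K ** cross_matrix (k u) ** ?K) *v axis j 1)"
        by (simp add: inner_axis' matrix_vector_mult_basis column_def)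
      also have "\<dots> = cross7 (k u) (k (axis j 1)) \<bullet> k (axis i 1)"
        by (simp only: matrix_vector_mul_assoc[symmetric] adj cross_matrix_mult_vec K inner_commute)
      finally show ?thesis by (simp add: cross7_inner a)
    qed
    then show ?thesis by (simp add: form_matrix_def vec_eq_iff)
  qed
  moreover have "outer u u = transpose ?K ** outer y y ** ?K"
    by (simp only: matrix_mult_outer outer_mult_matrix y)
  ultimately have "form_matrix a u + outer u u = transpose ?K ** (cross_matrix (k u) + outer y y) ** ?K"
    by (simp add: matrix_add_ldistrib matrix_add_rdistrib)
  then have "det (form_matrix a u + outer u u) = (det ?K)\<^sup>2 * det (cross_matrix (k u) + outer y y)"
    by (simp add: det_mul power2_eq_square)
  moreover have "k u \<bullet> y = u \<bullet> u"
    using adj[of u y] y by simp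
  ultimately show ?thesis
    using det_cross_matrix_outer[of "k u" y] u
    by (simp add: power_mult_distrib flip: power_mult)
qed

text \<open>Polarisation evaluates \<open>form_norm\<close> at these vectors, also for
  \<open>i = j\<close>, and its closed form is proved at nonzero vectors.\<close>

lemma axis_plus_axis_neq_0: "axis i 1 + axis j 1 \<noteq> (0 :: real ^ 'n)"
proof
  assume "axis i 1 + axis j 1 = (0 :: real ^ 'n)"
  then have "(axis i 1 + axis j 1 :: real ^ 'n) $ i = 0" by simp
  then show False by (simp add: axis_def split: if_splits)
qed

text \<open>For the pullback \<open>a\<close> of \<open>phi0\<close> under \<open>k\<close> and
  nonzero \<open>u\<close> this is \<open>|det k| |k u|\<^sup>2\<close>. Squaring the determinant
  gives a positive number whatever its sign, and the fourth root of a positive smooth function is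
  smooth.\<close>

definition form_norm :: "(real ^ 7 \<Rightarrow> real ^ 7 \<Rightarrow> real ^ 7 \<Rightarrow> real) \<Rightarrow> real ^ 7 \<Rightarrow> real" where
  "form_norm a u = (det (form_matrix a u + outer u u))\<^sup>2 powr (1 / 4) / (u \<bullet> u)"

text \<open>Polarisation of \<open>form_norm\<close>: the entries are the inner products of the
  \<open>k (axis i 1)\<close>, times \<open>|det k|\<close>.\<close>

definition form_gram :: "(real ^ 7 \<Rightarrow> real ^ 7 \<Rightarrow> real ^ 7 \<Rightarrow> real) \<Rightarrow> real ^ 7 ^ 7" where
  "form_gram a = (\<chi> i j. (form_norm a (axis i 1 + axis j 1) - form_norm a (axis i 1) - form_norm a (axis j 1)) / 2)"

text \<open>The determinant of \<open>form_gram a\<close> is \<open>|det k| ^ 9\<close>, so its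
  power \<open>- (1 / 9)\<close> removes the factor \<open>|det k|\<close>.\<close>

definition form_metric :: "(real ^ 7 \<Rightarrow> real ^ 7 \<Rightarrow> real ^ 7 \<Rightarrow> real) \<Rightarrow> real ^ 7 ^ 7" where
  "form_metric a = (det (form_gram a) powr (- (1 / 9))) *\<^sub>R form_gram a"

context
  fixes k :: "real ^ 7 \<Rightarrow> real ^ 7" and a
  assumes k: "linear k" "inj k" and a: "\<And>x y z. a x y z = phi0 (k x) (k y) (k z)"
begin

lemma form_norm_eq:
  assumes u: "u \<noteq> 0"
  shows "form_norm a u = \<bar>det (matrix k)\<bar> * (k u \<bullet> k u)"
proof -
  have "(det (form_matrix a u + outer u u))\<^sup>2 = (\<bar>det (matrix k)\<bar> * (k u \<bullet> k u) * (u \<bullet> u)) ^ 4"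
    using det_form_matrix[OF k a u] by (simp add: power_mult_distrib)
  moreover have "0 \<le> \<bar>det (matrix k)\<bar> * (k u \<bullet> k u) * (u \<bullet> u)"
    by simp
  moreover have "(x ^ 4) powr (1 / 4) = x" if "0 \<le> x" for x :: real
    using that by (cases "x = 0") (simp_all add: powr_powr flip: powr_numeral)
  ultimately show ?thesis
    using u by (simp add: form_norm_def)
qed

lemma form_det_pos: "u \<noteq> 0 \<Longrightarrow> 0 < (det (form_matrix a u + outer u u))\<^sup>2"
  using det_form_matrix[OF k a, of u] k det_nz_iff_inj[OF k(1)] linear_injective_0[OF k(1)]
  by (auto simp: zero_less_mult_iff zero_less_power_eq)

lemma form_gram_eq: "form_gram a $ i $ j = \<bar>det (matrix k)\<bar> * (k (axis i 1) \<bullet> k (axis j 1))"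
proof -
  have "form_gram a $ i $ j = \<bar>det (matrix k)\<bar> *
      (k (axis i 1 + axis j 1) \<bullet> k (axis i 1 + axis j 1) - k (axis i 1) \<bullet> k (axis i 1) - k (axis j 1) \<bullet> k (axis j 1)) / 2"
    by (simp add: form_gram_def form_norm_eq axis_eq_0_iff axis_plus_axis_neq_0 algebra_simps)
  then show ?thesis
    by (simp add: linear_add[OF k(1)] inner_add_left inner_add_right inner_commute)
qed

lemma det_form_gram: "det (form_gram a) = \<bar>det (matrix k)\<bar> ^ 9"
proof -
  have "form_gram a = \<bar>det (matrix k)\<bar> *\<^sub>R (transpose (matrix k) ** matrix k)"
    by (simp add: vec_eq_iff form_gram_eq matrix_def transpose_def matrix_matrix_mult_def inner_vec_def)
  then have "det (form_gram a) = \<bar>det (matrix k)\<bar> ^ 7 * (det (matrix k))\<^sup>2"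
    by (simp add: det_scaleR det_mul power2_eq_square)
  also have "\<dots> = \<bar>det (matrix k)\<bar> ^ 7 * \<bar>det (matrix k)\<bar> ^ 2"
    by simp
  finally show ?thesis by (simp only: flip: power_add) simp
qed

lemma det_form_gram_pos: "0 < det (form_gram a)"
  using k det_nz_iff_inj[OF k(1)] by (simp add: det_form_gram)

lemma form_metric_eq: "form_metric a $ i $ j = k (axis i 1) \<bullet> k (axis j 1)"
proof -
  have d: "0 < \<bar>det (matrix k)\<bar>"
    using k det_nz_iff_inj[OF k(1)] by simp
  have "(x ^ 9) powr (- (1 / 9)) = inverse x" if "0 < x" for x :: real
    using that by (simp add: powr_powr powr_minus flip: powr_numeral)
  then show ?thesis
    using d by (simp add: form_metric_def det_form_gram form_gram_eq)
qed

end


section \<open>Charts and tangent spaces\<close>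

abbreviation transition_deriv :: "('m, 'n::finite) chart \<Rightarrow> ('m, 'n) chart \<Rightarrow> 'm \<Rightarrow> real ^ 'n \<Rightarrow> real ^ 'n" where
  "transition_deriv c d p \<equiv> frechet_derivative (transition c d) (at (snd c p))"

lemma tangent_space_iff: "v \<in> tangent_space A p \<longleftrightarrow> (\<forall>c. \<not> (c \<in> A \<and> p \<in> fst c) \<longrightarrow> v c = 0) \<and>
     (\<forall>c\<in>A. \<forall>d\<in>A. p \<in> fst c \<inter> fst d \<longrightarrow> v d = transition_deriv c d p (v c))"
  by (simp add: tangent_space_def)

lemma tangent_spaceD:
  assumes "v \<in> tangent_space A p"
  shows "\<not> (c \<in> A \<and> p \<in> fst c) \<Longrightarrow> v c = 0"
    and "c \<in> A \<Longrightarrow> d \<in> A \<Longrightarrow> p \<in> fst c \<Longrightarrow> p \<in> fst d \<Longrightarrow> v d = transition_deriv c d p (v c)"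
  using assms unfolding tangent_space_iff by blast+

context
  fixes A :: "('m::topological_space, 'n::finite) chart set"
  assumes A: "smooth_structure A"
begin

lemma chart_of_atlas:
  assumes "c \<in> A"
  shows "open (fst c)" "open (snd c ` fst c)" "homeomorphism (fst c) (snd c ` fst c) (snd c) (chart_inv c)"
    and "inj_on (snd c) (fst c)"
proof -
  have "is_chart c" using A assms by (simp add: smooth_structure_def)
  then show "open (fst c)" "open (snd c ` fst c)" and h: "homeomorphism (fst c) (snd c ` fst c) (snd c) (chart_inv c)"
    by (simp_all add: is_chart_def)
  then show "inj_on (snd c) (fst c)"
    by (metis homeomorphism_def inj_on_inverseI)
qed

lemma ex_chart: "\<exists>c\<in>A. p \<in> fst c"
proof -
  have "(\<Union>c\<in>A. fst c) = UNIV"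
    using A unfolding smooth_structure_def by (elim conjE)
  then show ?thesis by blast
qed

lemma compatible_atlas: "c \<in> A \<Longrightarrow> d \<in> A \<Longrightarrow> compatible c d"
  using A unfolding smooth_structure_def by blast

lemma atlas_maximal: "is_chart c \<Longrightarrow> (\<And>d. d \<in> A \<Longrightarrow> compatible c d) \<Longrightarrow> c \<in> A"
  using A unfolding smooth_structure_def by blast

lemma open_chart_image: "c \<in> A \<Longrightarrow> open U \<Longrightarrow> open (snd c ` (fst c \<inter> U))"
  using homeomorphism_imp_open_map[OF chart_of_atlas(3), of c "fst c \<inter> U"] chart_of_atlas(2)[of c]
  by (auto simp: openin_open_Int intro: openin_open_trans)

lemma open_overlap: "c \<in> A \<Longrightarrow> d \<in> A \<Longrightarrow> open (snd c ` (fst c \<inter> fst d))"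
  using open_chart_image chart_of_atlas(1) by blast

lemma chart_inv [simp]: "c \<in> A \<Longrightarrow> p \<in> fst c \<Longrightarrow> chart_inv c (snd c p) = p"
  using chart_of_atlas(4) by simp

lemma transition_chart: "c \<in> A \<Longrightarrow> p \<in> fst c \<Longrightarrow> transition c d (snd c p) = snd d p"
  by simp

lemma smooth_transition: "c \<in> A \<Longrightarrow> d \<in> A \<Longrightarrow> smooth_on (snd c ` (fst c \<inter> fst d)) (transition c d)"
  using compatible_atlas by (auto simp: compatible_def)

lemma differentiable_transition:
  "c \<in> A \<Longrightarrow> d \<in> A \<Longrightarrow> p \<in> fst c \<inter> fst d \<Longrightarrow> transition c d differentiable at (snd c p)"
  by (rule smooth_on_imp_differentiable[OF smooth_transition]) auto

lemma has_derivative_transition: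
  "c \<in> A \<Longrightarrow> d \<in> A \<Longrightarrow> p \<in> fst c \<inter> fst d \<Longrightarrow> (transition c d has_derivative transition_deriv c d p) (at (snd c p))"
  using differentiable_transition frechet_derivative_works by blast

lemma linear_transition_deriv: "c \<in> A \<Longrightarrow> d \<in> A \<Longrightarrow> p \<in> fst c \<inter> fst d \<Longrightarrow> linear (transition_deriv c d p)"
  using has_derivative_transition has_derivative_linear by blast

lemma transition_deriv_self: "c \<in> A \<Longrightarrow> p \<in> fst c \<Longrightarrow> transition_deriv c c p x = x"
proof -
  assume c: "c \<in> A" "p \<in> fst c"
  have "frechet_derivative (\<lambda>x. x) (at (snd c p)) = transition_deriv c c p"
    by (rule frechet_derivative_transform_within_open[of _ _ "snd c ` fst c"]) (use c chart_of_atlas in auto)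
  then show ?thesis by (metis frechet_derivative_ident)
qed

lemma transition_deriv_trans:
  assumes "c \<in> A" "d \<in> A" "e \<in> A" "p \<in> fst c" "p \<in> fst d" "p \<in> fst e"
  shows "transition_deriv d e p (transition_deriv c d p x) = transition_deriv c e p x"
proof -
  have "(transition c d has_derivative transition_deriv c d p) (at (snd c p))"
    "(transition d e has_derivative transition_deriv d e p) (at (transition c d (snd c p)))"
    using assms has_derivative_transition[of c d p] has_derivative_transition[of d e p] by auto
  then have "(transition d e \<circ> transition c d has_derivative transition_deriv d e p \<circ> transition_deriv c d p) (at (snd c p))"
    by (rule diff_chain_at)
  moreover have "open (snd c ` (fst c \<inter> (fst d \<inter> fst e)))"
    using assms by (intro open_chart_image open_Int chart_of_atlas) auto
  ultimately have "(transition c e has_derivative transition_deriv d e p \<circ> transition_deriv c d p) (at (snd c p))"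
    by (rule has_derivative_transform_within_open) (use assms in auto)
  then show ?thesis
    using frechet_derivative_at by (metis comp_apply)
qed

lemma coord_vec_in: "c \<in> A \<Longrightarrow> p \<in> fst c \<Longrightarrow> coord_vec A c p x \<in> tangent_space A p"
  by (auto simp: tangent_space_iff coord_vec_def transition_deriv_trans simp del: o_apply)

lemma coord_vec_same [simp]: "c \<in> A \<Longrightarrow> p \<in> fst c \<Longrightarrow> coord_vec A c p x c = x"
  unfolding coord_vec_def by (simp only: transition_deriv_self simp_thms if_True)

lemma coord_vec_coord:
  assumes "c \<in> A" "p \<in> fst c" "v \<in> tangent_space A p"
  shows "coord_vec A c p (v c) = v"
proof
  fix d show "coord_vec A c p (v c) d = v d"
  proof (cases "d \<in> A \<and> p \<in> fst d")
    case True
    then have "v d = transition_deriv c d p (v c)"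
      by (intro tangent_spaceD(2)[OF assms(3)] assms(1,2)) auto
    then show ?thesis
      using True by (simp only: coord_vec_def simp_thms if_True)
  next
    case False
    then show ?thesis
      using tangent_spaceD(1)[OF assms(3) False] by (simp only: coord_vec_def if_False)
  qed
qed

lemma linear_coord_vec:
  assumes "c \<in> A" "p \<in> fst c"
  shows "linear (coord_vec A c p)"
proof (rule linearI; rule ext)
  fix x y :: "real ^ 'n" and r and d :: "('m, 'n) chart"
  have lin: "linear (transition_deriv c d p)" if "d \<in> A \<and> p \<in> fst d"
    by (rule linear_transition_deriv) (use assms that in auto)
  show "coord_vec A c p (x + y) d = (coord_vec A c p x + coord_vec A c p y) d"
    using linear_add[OF lin] unfolding coord_vec_def plus_fun_apply by simp
  show "coord_vec A c p (r *\<^sub>R x) d = (r *\<^sub>R coord_vec A c p x) d"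
    using linear_scale[OF lin] unfolding coord_vec_def scaleR_fun_def by simp
qed

lemma subspace_tangent_space: "subspace (tangent_space A p)"
proof -
  obtain c where c: "c \<in> A" "p \<in> fst c" using ex_chart by blast
  then have "tangent_space A p = range (coord_vec A c p)"
    using coord_vec_in coord_vec_coord by (metis (no_types, lifting) image_subset_iff rangeI subsetI subset_antisym)
  then show ?thesis
    using linear_subspace_image[OF linear_coord_vec[OF c] subspace_UNIV] by simp
qed

section \<open>Restricted charts, slice charts and sections in a given chart\<close>

text \<open>Smoothness of sections and endomorphisms is stated with an extension to the whole domain
  of a chart, so a local construction has to be presented in a smaller chart. Maximality of the
  atlas supplies it.\<close>

lemma restrict_chart:
  assumes c: "c \<in> A" and U: "open U" "U \<subseteq> fst c"
  shows "(U, snd c) \<in> A"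
proof -
  have inj: "inj_on (snd c) (fst c)" "inj_on (snd c) U"
    using chart_of_atlas(4)[OF c] U inj_on_subset by auto
  \<comment> \<open>Shrinking the domain changes \<open>inv_into\<close>, but not on the image of
    the smaller domain.\<close>
  have inv: "inv_into U (snd c) y = chart_inv c y" if "y \<in> snd c ` U" for y
    using that inj U by auto
  have "fst c \<inter> U = U" using U by auto
  then have opn: "open (snd c ` U)"
    using open_chart_image[OF c U(1)] by simp
  have "homeomorphism U (snd c ` U) (snd c) (chart_inv c)"
    using chart_of_atlas(3)[OF c] U(2) by (rule homeomorphism_of_subsets) (use U in auto)
  then have "homeomorphism U (snd c ` U) (snd c) (inv_into U (snd c))"
    by (rule homeomorphism_cong) (use inv in auto)
  then have chart: "is_chart (U, snd c)"
    using U opn by (simp add: is_chart_def)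
  have "compatible (U, snd c) d" if d: "d \<in> A" for d
  proof -
    have 1: "open (snd c ` (U \<inter> fst d))"
      using open_chart_image[OF c, of "U \<inter> fst d"] U chart_of_atlas(1)[OF d]
      by (metis \<open>fst c \<inter> U = U\<close> inf_assoc open_Int)
    have 2: "smooth_on (snd c ` (U \<inter> fst d)) (transition c d)"
      by (rule smooth_on_subset[OF smooth_transition[OF c d]]) (use U in auto)
    have "smooth_on (snd c ` (U \<inter> fst d)) (transition (U, snd c) d)"
      by (rule smooth_on_cong[OF 1 _ 2]) (use inv in \<open>auto simp del: chart_inv\<close>)
    moreover have "smooth_on (snd d ` (U \<inter> fst d)) (transition d (U, snd c))"
      using smooth_on_subset[OF smooth_transition[OF d c], of "snd d ` (U \<inter> fst d)"] U by auto
    ultimately show ?thesis by (simp add: compatible_def)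
  qed
  then show ?thesis
    using atlas_maximal[OF chart] by blast
qed

text \<open>A tangent vector is a family indexed by charts, and the restricted chart is a different
  index. The entries agree because \<open>transition\<close> sees of its target only the coordinate
  map.\<close>

lemma tangent_restrict_chart:
  assumes "c \<in> A" "open U" "U \<subseteq> fst c" "p \<in> U" "v \<in> tangent_space A p"
  shows "v (U, snd c) = v c"
proof -
  have "v (U, snd c) = transition_deriv c (U, snd c) p (v c)"
    using assms restrict_chart[of c U] by (intro tangent_spaceD(2)[OF assms(5)]) auto
  also have "\<dots> = transition_deriv c c p (v c)"
    by simp
  also have "\<dots> = v c"
    using assms transition_deriv_self by blast
  finally show ?thesis .
qed

text \<open>This makes \<open>tangent_sub\<close> independent of the slice chart. In
  \<open>c\<close> the line through \<open>p\<close> in direction \<open>v c\<close> stays in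
  \<open>S\<close>, hence near \<open>p\<close> it runs in \<open>Y\<close>; seen through
  \<open>d\<close> it lies in \<open>T\<close>. Its difference quotients belong to \<open>T\<close>,
  and so does their limit \<open>v d\<close>, because subspaces are closed.\<close>

lemma slice_coords_transition:
  assumes c: "slice_chart A Y c S" "p \<in> fst c" and d: "slice_chart A Y d T" "p \<in> fst d"
    and p: "p \<in> Y" and v: "v \<in> tangent_space A p" "v c \<in> S"
  shows "v d \<in> T"
proof -
  have cA: "c \<in> A" and dA: "d \<in> A" and S: "subspace S" and T: "subspace T"
    and cS: "snd c ` (fst c \<inter> Y) = snd c ` fst c \<inter> S" and dT: "snd d ` (fst d \<inter> Y) = snd d ` fst d \<inter> T"
    using c d by (auto simp: slice_chart_def)
  define \<gamma> where "\<gamma> t = snd c p + t *\<^sub>R v c" for t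
  have pS: "snd c p \<in> S" using cS p c(2) by blast
  have \<gamma>S: "\<gamma> t \<in> S" for t
    by (simp add: \<gamma>_def pS v S subspace_add subspace_scale)
  have T\<gamma>: "transition c d (\<gamma> t) \<in> T" if t: "\<gamma> t \<in> snd c ` (fst c \<inter> fst d)" for t
  proof -
    obtain q where q: "q \<in> fst c" "q \<in> fst d" "\<gamma> t = snd c q" using t by blast
    then have "snd c q \<in> snd c ` (fst c \<inter> Y)" using \<gamma>S[of t] cS by simp
    then have "q \<in> Y" using chart_of_atlas(4)[OF cA] q(1) by (auto dest: inj_onD)
    then show ?thesis using dT q cA by auto
  qed
  let ?f = "transition c d \<circ> \<gamma>"
  have "(\<gamma> has_derivative (\<lambda>t. t *\<^sub>R v c)) (at 0)"
    unfolding \<gamma>_def by (auto intro!: derivative_eq_intros)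
  moreover have "(transition c d has_derivative transition_deriv c d p) (at (\<gamma> 0))"
    using has_derivative_transition[OF cA dA, of p] c d by (simp add: \<gamma>_def)
  ultimately have "(?f has_derivative transition_deriv c d p \<circ> (\<lambda>t. t *\<^sub>R v c)) (at 0)"
    by (rule diff_chain_at)
  moreover have "transition_deriv c d p \<circ> (\<lambda>t. t *\<^sub>R v c) = (\<lambda>t. t *\<^sub>R v d)"
    unfolding comp_def[of "transition_deriv c d p"]
    using linear_scale[OF linear_transition_deriv[OF cA dA, of p]] tangent_spaceD(2)[OF v(1) cA dA c(2) d(2)] c d
    by simp
  ultimately have "(?f has_derivative (\<lambda>t. t *\<^sub>R v d)) (at 0)"
    by metis
  then have "((\<lambda>t. norm (?f t - ?f 0 - t *\<^sub>R v d) / norm t) \<longlongrightarrow> 0) (at 0)"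
    unfolding has_derivative_at by simp
  moreover have "norm (?f t - ?f 0 - t *\<^sub>R v d) / norm t = norm ((1 / t) *\<^sub>R (?f t - ?f 0) - v d)" if "t \<noteq> 0" for t
  proof -
    have "(1 / t) *\<^sub>R (?f t - ?f 0) - v d = (1 / t) *\<^sub>R (?f t - ?f 0 - t *\<^sub>R v d)"
      using that by (simp add: scaleR_diff_right)
    then show ?thesis by (simp add: divide_inverse mult.commute del: o_apply)
  qed
  ultimately have "((\<lambda>t. norm ((1 / t) *\<^sub>R (?f t - ?f 0) - v d)) \<longlongrightarrow> 0) (at 0)"
    by (subst (asm) filterlim_cong[OF refl refl]) (auto simp: eventually_at_filter simp del: o_apply)
  then have lim: "((\<lambda>t. (1 / t) *\<^sub>R (?f t - ?f 0)) \<longlongrightarrow> v d) (at 0)"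
    using Lim_null tendsto_norm_zero_iff by blast
  \<comment> \<open>The line may leave the overlap of the two charts, so membership in
    \<open>T\<close> is claimed for small \<open>t\<close> only.\<close>
  have "\<forall>\<^sub>F t in at 0. \<gamma> t \<in> snd c ` (fst c \<inter> fst d)"
  proof -
    have "(\<gamma> \<longlongrightarrow> \<gamma> 0) (at 0)"
      unfolding \<gamma>_def by (intro tendsto_intros)
    moreover have "\<gamma> 0 \<in> snd c ` (fst c \<inter> fst d)"
      using c d by (simp add: \<gamma>_def)
    ultimately show ?thesis
      using open_overlap[OF cA dA] topological_tendstoD by blast
  qed
  then have "\<forall>\<^sub>F t in at 0. (1 / t) *\<^sub>R ((transition c d \<circ> \<gamma>) t - (transition c d \<circ> \<gamma>) 0) \<in> T"
  proof eventually_elim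
    case (elim t)
    have "\<gamma> 0 \<in> snd c ` (fst c \<inter> fst d)"
      using c d by (simp add: \<gamma>_def)
    then show ?case
      using T\<gamma>[OF elim] T\<gamma>[of 0] T by (simp add: subspace_diff subspace_scale)
  qed
  then show ?thesis
    using Lim_in_closed_set[OF closed_subspace[OF T] _ _ lim] by simp
qed

lemma tangent_sub_eq:
  assumes "slice_chart A Y c S" "p \<in> fst c" "p \<in> Y"
  shows "tangent_sub A Y p = {v \<in> tangent_space A p. v c \<in> S}"
  using assms slice_coords_transition[of Y _ _ p c S] unfolding tangent_sub_def by blast

text \<open>The definition of a smooth section grants at each point some chart of its own; to
  multiply two sections they must be written in a common one.\<close>

lemma smooth_section_in_chart:
  assumes s: "smooth_section A Z s" and p: "p \<in> Z" "p \<in> fst c" and c: "c \<in> A"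
  obtains W F where "open W" "p \<in> W" "W \<subseteq> fst c" "smooth_on (snd c ` W) F"
    "\<And>q. q \<in> Z \<inter> W \<Longrightarrow> s q c = F (snd c q)"
proof -
  obtain d G where d: "d \<in> A" "p \<in> fst d" and G: "smooth_on (snd d ` fst d) G"
    "\<And>q. q \<in> Z \<inter> fst d \<Longrightarrow> s q d = G (snd d q)"
    using s p unfolding smooth_section_def by metis
  let ?W = "fst c \<inter> fst d" and ?\<tau> = "transition c d"
  let ?D = "\<lambda>y. frechet_derivative (transition d c) (at y)"
  \<comment> \<open>Change of coordinates by the derivative of the transition map, expanded in
    \<open>Basis\<close> so that only derivatives in fixed directions occur.\<close>
  define F where "F t = (\<Sum>b\<in>Basis. (G (?\<tau> t) \<bullet> b) *\<^sub>R ?D (?\<tau> t) b)" for t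
  have opn: "open (snd c ` ?W)" "open (snd d ` (fst d \<inter> fst c))" "open (snd d ` fst d)"
    using open_overlap c d chart_of_atlas(2) by auto
  have \<tau>: "smooth_on (snd c ` ?W) ?\<tau>" "?\<tau> ` (snd c ` ?W) \<subseteq> snd d ` (fst d \<inter> fst c)" "?\<tau> ` (snd c ` ?W) \<subseteq> snd d ` fst d"
    using smooth_transition[OF c d(1)] c by auto
  have "smooth_on (snd c ` ?W) (\<lambda>t. G (?\<tau> t))"
    by (rule smooth_on_compose[OF opn(1,3) \<tau>(3,1) G(1)])
  moreover have "smooth_on (snd c ` ?W) (\<lambda>t. ?D (?\<tau> t) b)" for b
    by (rule smooth_on_compose[OF opn(1,2) \<tau>(2,1) smooth_on_frechet_derivative[OF smooth_transition[OF d(1) c]]])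
  ultimately have "smooth_on (snd c ` ?W) F"
    unfolding F_def
    by (intro smooth_on_sum smooth_on_scaleR smooth_on_bounded_linear[OF bounded_linear_inner_left] opn) auto
  moreover have "s q c = F (snd c q)" if q: "q \<in> Z \<inter> ?W" for q
  proof -
    have lin: "linear (transition_deriv d c q)"
      using linear_transition_deriv[OF d(1) c, of q] q by auto
    have "s q \<in> tangent_space A q" using s q by (simp add: smooth_section_def)
    from tangent_spaceD(2)[OF this d(1) c] have "s q c = transition_deriv d c q (s q d)"
      using q by blast
    also have "\<dots> = F (snd c q)"
      using q c G(2)[of q] by (simp add: F_def linear_sum[OF lin, symmetric] linear_scale[OF lin, symmetric] euclidean_representation
          del: o_apply add: transition_chart)
    finally show ?thesis .
  qed
  ultimately show ?thesis
    using that[of ?W F] p d open_Int[OF chart_of_atlas(1)[OF c] chart_of_atlas(1)[OF d(1)]] by auto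
qed

end


section \<open>Frames, the induced metric and the cross product on a manifold\<close>

definition local_form :: "('m, 7) chart set \<Rightarrow> ('m, 7) form3 \<Rightarrow> ('m, 7) chart \<Rightarrow> real ^ 7 \<Rightarrow>
    real ^ 7 \<Rightarrow> real ^ 7 \<Rightarrow> real ^ 7 \<Rightarrow> real" where
  "local_form A \<phi> c t x y z = (let p = chart_inv c t in
     \<phi> p (coord_vec A c p x) (coord_vec A c p y) (coord_vec A c p z))"

text \<open>Cramer's rule for the equation \<open>G z = a(x, y, _)\<close>, a formula from which
  smoothness can be read off. The power \<open>- 1\<close> is the reciprocal of the positive
  determinant, in the form that \<open>smooth_on_powr\<close> covers.\<close>

definition local_cross :: "('m, 7) chart set \<Rightarrow> ('m, 7) form3 \<Rightarrow> ('m, 7) chart \<Rightarrow> real ^ 7 \<Rightarrow>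
    real ^ 7 \<Rightarrow> real ^ 7 \<Rightarrow> real ^ 7" where
  "local_cross A \<phi> c t x y = (let a = local_form A \<phi> c t; G = form_metric a in
     \<chi> l. det (\<chi> i j. if j = l then a x y (axis i 1) else G $ i $ j) * det G powr (- 1))"

text \<open>Computed in the chosen frame and hence without visible regularity;
  \<open>g2_cross_local\<close> expresses it by \<open>local_cross\<close>.\<close>

definition g2_cross :: "('m, 7) chart set \<Rightarrow> ('m, 7) form3 \<Rightarrow> 'm \<Rightarrow> ('m, 7) tvec \<Rightarrow> ('m, 7) tvec \<Rightarrow> ('m, 7) tvec" where
  "g2_cross A \<phi> p u v = some_g2_frame A \<phi> p
     (cross7 (inv (some_g2_frame A \<phi> p) u) (inv (some_g2_frame A \<phi> p) v))"

lemma linear_sum_axis: "linear f \<Longrightarrow> f x = (\<Sum>i\<in>UNIV. x $ i *\<^sub>R f (axis i 1))" for x :: "real ^ 'n"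
  using linear_sum[of f "\<lambda>i. x $ i *\<^sub>R axis i 1" UNIV] basis_expansion[of x]
  by (simp add: linear_scale scalar_mult_eq_scaleR)

context
  fixes A :: "('m::topological_space, 7) chart set" and \<phi> :: "('m, 7) form3"
  assumes A: "smooth_structure A" and \<phi>: "g2_structure A \<phi>"
begin

abbreviation frame :: "'m \<Rightarrow> real ^ 7 \<Rightarrow> ('m, 7) tvec" where
  "frame p \<equiv> some_g2_frame A \<phi> p"

lemma frame: "linear (frame p)" "inj (frame p)" "range (frame p) = tangent_space A p"
  "\<phi> p (frame p x) (frame p y) (frame p z) = phi0 x y z"
proof -
  have "g2_frame A \<phi> p (frame p)"
    using \<phi> unfolding g2_structure_def some_g2_frame_def by (metis someI_ex)
  then show "linear (frame p)" "inj (frame p)" "range (frame p) = tangent_space A p"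
    "\<phi> p (frame p x) (frame p y) (frame p z) = phi0 x y z"
    by (auto simp: g2_frame_def bij_betw_def)
qed

lemma inv_frame [simp]: "inv (frame p) (frame p x) = x"
  using frame(2) by simp

lemma frame_in [simp]: "frame p x \<in> tangent_space A p"
  using frame(3) by blast

lemma frame_inv [simp]: "v \<in> tangent_space A p \<Longrightarrow> frame p (inv (frame p) v) = v"
  using frame(3) by (simp add: f_inv_into_f)

lemma form_eq_phi0:
  assumes "u \<in> tangent_space A p" "v \<in> tangent_space A p" "w \<in> tangent_space A p"
  shows "\<phi> p u v w = phi0 (inv (frame p) u) (inv (frame p) v) (inv (frame p) w)"
  using frame(4)[of p "inv (frame p) u" "inv (frame p) v" "inv (frame p) w"] assms by simp

lemma inv_frame_combination:
  assumes "u \<in> tangent_space A p" "v \<in> tangent_space A p"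
  shows "inv (frame p) (a *\<^sub>R u + b *\<^sub>R v) = a *\<^sub>R inv (frame p) u + b *\<^sub>R inv (frame p) v"
proof -
  have "frame p (a *\<^sub>R inv (frame p) u + b *\<^sub>R inv (frame p) v) = a *\<^sub>R u + b *\<^sub>R v"
    using assms by (simp add: linear_add[OF frame(1)] linear_scale[OF frame(1)])
  then show ?thesis by (metis inv_frame)
qed

context
  fixes c p
  assumes c: "c \<in> A" "p \<in> fst c"
begin

text \<open>The isomorphism of coordinate vectors with \<open>\<real>\<^sup>7\<close> under which
  the local form is the pullback of \<open>phi0\<close>. It is the \<open>k\<close> to which the
  linear algebra above is applied.\<close>

definition pull :: "real ^ 7 \<Rightarrow> real ^ 7" where
  "pull x = inv (frame p) (coord_vec A c p x)"

lemma frame_pull: "frame p (pull x) = coord_vec A c p x"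
  by (simp add: pull_def coord_vec_in[OF A] c)

lemma pull_coord: "v \<in> tangent_space A p \<Longrightarrow> pull (v c) = inv (frame p) v"
  by (simp add: pull_def coord_vec_coord[OF A] c)

lemma linear_pull: "linear pull"
proof (rule linearI)
  fix x y :: "real ^ 7" and r
  show "pull (x + y) = pull x + pull y"
    using inv_frame_combination[of "coord_vec A c p x" p "coord_vec A c p y" 1 1] coord_vec_in[OF A c]
    by (simp add: pull_def linear_add[OF linear_coord_vec[OF A c]])
  show "pull (r *\<^sub>R x) = r *\<^sub>R pull x"
    using inv_frame_combination[of "coord_vec A c p x" p 0 r 0] coord_vec_in[OF A c] subspace_0[OF subspace_tangent_space[OF A]]
    by (simp add: pull_def linear_scale[OF linear_coord_vec[OF A c]])
qed

lemma inj_pull: "inj pull"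
  by (metis (no_types, lifting) A c coord_vec_same frame_pull injI)

lemma surj_pull: "surj pull"
  using linear_inj_imp_surj[OF linear_pull inj_pull] .

lemma local_form_eq: "local_form A \<phi> c (snd c p) x y z = phi0 (pull x) (pull y) (pull z)"
  using frame(4)[of p "pull x" "pull y" "pull z"] by (simp add: local_form_def frame_pull chart_inv[OF A] c Let_def)

abbreviation "local_metric \<equiv> form_metric (local_form A \<phi> c (snd c p))"

lemma local_metric_eq: "local_metric $ i $ j = pull (axis i 1) \<bullet> pull (axis j 1)"
  by (rule form_metric_eq[OF linear_pull inj_pull local_form_eq])

lemma local_metric_mult: "(local_metric *v x) $ i = pull (axis i 1) \<bullet> pull x"
  unfolding linear_sum_axis[OF linear_pull, of x]
  by (simp add: matrix_vector_mult_def local_metric_eq inner_sum_right mult.commute)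

lemma g2_metric_local:
  assumes "u \<in> tangent_space A p" "v \<in> tangent_space A p"
  shows "g2_metric A \<phi> p u v = (\<Sum>i\<in>UNIV. \<Sum>j\<in>UNIV. u c $ i * v c $ j * local_metric $ i $ j)"
proof -
  have "g2_metric A \<phi> p u v = pull (u c) \<bullet> pull (v c)"
    using assms by (simp add: g2_metric_def pull_coord)
  also have "\<dots> = (\<Sum>i\<in>UNIV. (u c $ i *\<^sub>R pull (axis i 1)) \<bullet> (\<Sum>j\<in>UNIV. v c $ j *\<^sub>R pull (axis j 1)))"
    by (simp only: linear_sum_axis[OF linear_pull, of "u c"] linear_sum_axis[OF linear_pull, of "v c"] inner_sum_left)
  finally show ?thesis
    by (simp add: inner_sum_right local_metric_eq mult_ac)
qed

lemma det_local_metric_pos: "0 < det local_metric"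
proof -
  have "local_metric = transpose (matrix pull) ** matrix pull"
    by (simp add: vec_eq_iff local_metric_eq matrix_def transpose_def matrix_matrix_mult_def inner_vec_def)
  then have "det local_metric = (det (matrix pull))\<^sup>2"
    by (simp add: det_mul power2_eq_square)
  then show ?thesis
    using det_nz_iff_inj[OF linear_pull] inj_pull by simp
qed

text \<open>The coordinate vector \<open>z\<close> of the true product solves the linear system with
  matrix \<open>local_metric\<close>, because the product is defined by its inner products. The
  determinant is nonzero, so \<open>z\<close> is what Cramer's rule gives.\<close>

lemma pull_local_cross: "pull (local_cross A \<phi> c (snd c p) x y) = cross7 (pull x) (pull y)"
proof -
  obtain z where z: "pull z = cross7 (pull x) (pull y)"
    using surj_pull by (metis surjD)
  let ?b = "\<chi> i. local_form A \<phi> c (snd c p) x y (axis i 1)"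
  have "local_metric *v z = ?b"
    by (simp add: vec_eq_iff local_metric_mult z local_form_eq cross7_inner[symmetric] inner_commute)
  moreover have "det local_metric \<noteq> 0" "det local_metric powr (- 1) = inverse (det local_metric)"
    using det_local_metric_pos by (auto simp: powr_minus)
  ultimately have "z = local_cross A \<phi> c (snd c p) x y"
    using cramer[of local_metric z ?b] by (simp add: local_cross_def Let_def divide_inverse cong: if_cong)
  then show ?thesis using z by simp
qed

lemma g2_cross_local:
  assumes "u \<in> tangent_space A p" "v \<in> tangent_space A p"
  shows "g2_cross A \<phi> p u v c = local_cross A \<phi> c (snd c p) (u c) (v c)"
proof -
  have "g2_cross A \<phi> p u v = frame p (pull (local_cross A \<phi> c (snd c p) (u c) (v c)))"
    using assms by (simp add: g2_cross_def pull_local_cross pull_coord)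
  then show ?thesis
    by (simp add: frame_pull coord_vec_same[OF A] c)
qed

end

end

section \<open>Smoothness of the metric and of the cross product in charts\<close>

context
  fixes A :: "('m::topological_space, 7) chart set" and \<phi> :: "('m, 7) form3"
  assumes A: "smooth_structure A" and \<phi>: "g2_structure A \<phi>"
begin

lemma linear_local_form:
  assumes c: "c \<in> A" "t \<in> snd c ` fst c"
  shows "linear (\<lambda>x. local_form A \<phi> c t x y z)" "linear (\<lambda>y. local_form A \<phi> c t x y z)"
proof -
  obtain p where p: "p \<in> fst c" "t = snd c p" using c by blast
  note lin = linear_add[OF linear_pull[OF A \<phi> c(1) p(1)]] linear_scale[OF linear_pull[OF A \<phi> c(1) p(1)]]
    bilinear_ladd[OF bilinear_cross7] bilinear_radd[OF bilinear_cross7]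
    bilinear_lmul[OF bilinear_cross7] bilinear_rmul[OF bilinear_cross7]
  show "linear (\<lambda>x. local_form A \<phi> c t x y z)" "linear (\<lambda>y. local_form A \<phi> c t x y z)"
    unfolding p(2) local_form_eq[OF A \<phi> c(1) p(1)] cross7_inner[symmetric]
    by (auto intro!: linearI simp: lin inner_add_left)
qed

lemma smooth_local_form:
  "c \<in> A \<Longrightarrow> smooth_on (snd c ` fst c) (\<lambda>t. local_form A \<phi> c t x y z)"
  using \<phi> unfolding local_form_def g2_structure_def smooth_form3_def by blast

text \<open>Determinants, polarisation and powers of positive functions preserve smoothness.
  Positivity is a pointwise fact, so the frames, which vary without regularity, may be used to prove
  it.\<close>

lemma smooth_local_metric:
  assumes c: "c \<in> A"
  shows "smooth_on (snd c ` fst c) (\<lambda>t. form_metric (local_form A \<phi> c t) $ i $ j)"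
proof -
  let ?S = "snd c ` fst c" and ?a = "local_form A \<phi> c"
  have S: "open ?S" using chart_of_atlas[OF A c] by simp
  have det: "0 < det (form_gram (?a t))" if "t \<in> ?S" for t
  proof -
    obtain p where p: "p \<in> fst c" "t = snd c p" using \<open>t \<in> ?S\<close> by blast
    show ?thesis
      unfolding p(2) by (rule det_form_gram_pos[OF linear_pull[OF A \<phi> c p(1)] inj_pull[OF A \<phi> c p(1)] local_form_eq[OF A \<phi> c p(1)]])
  qed
  have norm: "smooth_on ?S (\<lambda>t. form_norm (?a t) u)" if u: "u \<noteq> 0" for u
  proof -
    have pos: "0 < (det (form_matrix (?a t) u + outer u u))\<^sup>2" if "t \<in> ?S" for t
    proof -
      obtain p where p: "p \<in> fst c" "t = snd c p" using \<open>t \<in> ?S\<close> by blast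
      show ?thesis
        unfolding p(2) by (rule form_det_pos[OF linear_pull[OF A \<phi> c p(1)] inj_pull[OF A \<phi> c p(1)] local_form_eq[OF A \<phi> c p(1)] u])
    qed
    have "smooth_on ?S (\<lambda>t. (det (form_matrix (?a t) u + outer u u))\<^sup>2)"
      unfolding power2_eq_square
      by (intro smooth_on_mult smooth_on_det S)
         (auto simp: form_matrix_def outer_def intro!: smooth_on_add smooth_on_const S smooth_local_form c)
    then have "smooth_on ?S (\<lambda>t. (det (form_matrix (?a t) u + outer u u))\<^sup>2 powr (1 / 4) * (1 / (u \<bullet> u)))"
      by (intro smooth_on_mult smooth_on_powr smooth_on_const S pos)
    then show ?thesis by (simp add: form_norm_def)
  qed
  have gram: "smooth_on ?S (\<lambda>t. form_gram (?a t) $ i $ j)" for i j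
  proof -
    have "axis i 1 + axis j 1 \<noteq> (0 :: real ^ 7)"
      using axis_plus_axis_neq_0 .
    then have "smooth_on ?S (\<lambda>t. (form_norm (?a t) (axis i 1 + axis j 1) - form_norm (?a t) (axis i 1) - form_norm (?a t) (axis j 1)) * (1 / 2))"
      by (intro smooth_on_mult smooth_on_diff smooth_on_const S norm) (auto simp: axis_eq_0_iff)
    then show ?thesis by (simp add: form_gram_def)
  qed
  have "smooth_on ?S (\<lambda>t. det (form_gram (?a t)) powr (- (1 / 9)) * form_gram (?a t) $ i $ j)"
    by (intro smooth_on_mult smooth_on_powr smooth_on_det S gram det)
  then show ?thesis by (simp add: form_metric_def)
qed

lemma smooth_local_cross:
  assumes c: "c \<in> A" and T: "open T" "T \<subseteq> snd c ` fst c" and X: "smooth_on T X" "smooth_on T Y"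
  shows "smooth_on T (\<lambda>t. local_cross A \<phi> c t (X t) (Y t))"
proof -
  let ?a = "local_form A \<phi> c"
  have form: "smooth_on T (\<lambda>t. ?a t (X t) (Y t) z)" for z
  proof (rule smooth_on_cong[OF T(1)])
    \<comment> \<open>The local form is smooth for constant arguments; bilinear expansion reduces
      the moving arguments to these.\<close>
    show "smooth_on T (\<lambda>t. \<Sum>i\<in>UNIV. X t $ i * (\<Sum>j\<in>UNIV. Y t $ j * ?a t (axis i 1) (axis j 1) z))"
      by (intro smooth_on_sum smooth_on_mult smooth_on_nth T(1) X smooth_on_subset[OF smooth_local_form[OF c] T(2)])
    fix t assume "t \<in> T"
    then have t: "t \<in> snd c ` fst c" using T by blast
    have "?a t x (Y t) z = (\<Sum>j\<in>UNIV. Y t $ j * ?a t x (axis j 1) z)" for x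
      using linear_sum_axis[OF linear_local_form(2)[OF c t, of x z], of "Y t"] by simp
    moreover have "?a t (X t) (Y t) z = (\<Sum>i\<in>UNIV. X t $ i * ?a t (axis i 1) (Y t) z)"
      using linear_sum_axis[OF linear_local_form(1)[OF c t, of "Y t" z], of "X t"] by simp
    ultimately show "(\<Sum>i\<in>UNIV. X t $ i * (\<Sum>j\<in>UNIV. Y t $ j * ?a t (axis i 1) (axis j 1) z)) = ?a t (X t) (Y t) z" by simp
  qed
  have metric: "smooth_on T (\<lambda>t. form_metric (?a t) $ i $ j)" for i j
    using smooth_on_subset[OF smooth_local_metric[OF c] T(2)] .
  have pos: "0 < det (form_metric (?a t))" if "t \<in> T" for t
  proof -
    obtain p where p: "p \<in> fst c" "t = snd c p" using \<open>t \<in> T\<close> T by blast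
    show ?thesis unfolding p(2) by (rule det_local_metric_pos[OF A \<phi> c p(1)])
  qed
  have "smooth_on T (\<lambda>t. (\<chi> i j. if j = l then ?a t (X t) (Y t) (axis i 1) else form_metric (?a t) $ i $ j) $ i' $ j')" for l i' j'
    by (cases "j' = l") (use form metric in auto)
  then show ?thesis
    unfolding local_cross_def Let_def
    by (intro smooth_on_vec smooth_on_mult smooth_on_powr smooth_on_det T(1) metric pos)
qed

lemma smooth_local_metric_along:
  assumes c: "c \<in> A" and T: "open T" "T \<subseteq> snd c ` fst c" and X: "smooth_on T X"
  shows "smooth_on T (\<lambda>t. \<Sum>i\<in>UNIV. \<Sum>j\<in>UNIV. X t $ i * X t $ j * form_metric (local_form A \<phi> c t) $ i $ j)"
  by (intro smooth_on_sum smooth_on_mult smooth_on_nth T(1) X smooth_on_subset[OF smooth_local_metric[OF c] T(2)])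

lemma g2_cross_in [simp]: "g2_cross A \<phi> p u v \<in> tangent_space A p"
  by (simp add: g2_cross_def frame_in[OF A \<phi>])

text \<open>Applied to a smooth local basis of the plane field, this gives a smooth local vector
  field on the ray of \<open>n\<close>.\<close>

lemma smooth_section_cross:
  assumes s: "smooth_section A Z s" "smooth_section A Z s'"
  shows "smooth_section A Z (\<lambda>p. g2_cross A \<phi> p (s p) (s' p))"
  unfolding smooth_section_def
proof (intro ballI conjI)
  fix p assume p: "p \<in> Z"
  show "g2_cross A \<phi> p (s p) (s' p) \<in> tangent_space A p" by simp
  obtain c where c: "c \<in> A" "p \<in> fst c" using ex_chart[OF A] by blast
  obtain W F where W: "open W" "p \<in> W" "W \<subseteq> fst c" and F: "smooth_on (snd c ` W) F"
    "\<And>q. q \<in> Z \<inter> W \<Longrightarrow> s q c = F (snd c q)"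
    using smooth_section_in_chart[OF A s(1) p c(2,1)] by metis
  obtain W' F' where W': "open W'" "p \<in> W'" "W' \<subseteq> fst c" and F': "smooth_on (snd c ` W') F'"
    "\<And>q. q \<in> Z \<inter> W' \<Longrightarrow> s' q c = F' (snd c q)"
    using smooth_section_in_chart[OF A s(2) p c(2,1)] by metis
  let ?U = "W \<inter> W'"
  have U: "open ?U" "?U \<subseteq> fst c" "fst c \<inter> ?U = ?U" using W W' by auto
  have cU: "(?U, snd c) \<in> A"
    by (rule restrict_chart[OF A c(1) U(1,2)])
  have opn: "open (snd c ` ?U)"
    using open_chart_image[OF A c(1) U(1)] U(3) by simp
  have "smooth_on (snd c ` ?U) (\<lambda>t. local_cross A \<phi> c t (F t) (F' t))"
    by (rule smooth_local_cross[OF c(1) opn _ smooth_on_subset[OF F(1)] smooth_on_subset[OF F'(1)]]) (use U in auto)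
  moreover have "g2_cross A \<phi> q (s q) (s' q) (?U, snd c) = local_cross A \<phi> c (snd c q) (F (snd c q)) (F' (snd c q))"
    if q: "q \<in> Z \<inter> ?U" for q
  proof -
    have "s q \<in> tangent_space A q" "s' q \<in> tangent_space A q"
      using s q by (auto simp: smooth_section_def)
    then have "g2_cross A \<phi> q (s q) (s' q) c = local_cross A \<phi> c (snd c q) (s q c) (s' q c)"
      by (intro g2_cross_local[OF A \<phi>] c) (use q U in auto)
    then show ?thesis
      using tangent_restrict_chart[OF A c(1) U(1,2), of q "g2_cross A \<phi> q (s q) (s' q)"] q F(2) F'(2) by simp
  qed
  ultimately have "smooth_on (snd (?U, snd c) ` fst (?U, snd c)) (\<lambda>t. local_cross A \<phi> c t (F t) (F' t)) \<and>
      (\<forall>q\<in>Z \<inter> fst (?U, snd c). g2_cross A \<phi> q (s q) (s' q) (?U, snd c) = local_cross A \<phi> c (snd (?U, snd c) q) (F (snd (?U, snd c) q)) (F' (snd (?U, snd c) q)))"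
    by simp
  moreover have "p \<in> fst (?U, snd c)"
    using W W' by simp
  ultimately show "\<exists>c\<in>A. p \<in> fst c \<and> (\<exists>F. smooth_on (snd c ` fst c) F \<and>
      (\<forall>q\<in>Z \<inter> fst c. g2_cross A \<phi> q (s q) (s' q) c = F (snd c q)))"
    using cU by blast
qed

end


section \<open>The complex structure defined by a vector field\<close>

text \<open>The cross product with the unit vector \<open>s / |s|\<close>; it is the complex
  structure in both halves of the theorem.\<close>

definition unit_cross :: "('m, 7) chart set \<Rightarrow> ('m, 7) form3 \<Rightarrow> 'm \<Rightarrow> ('m, 7) tvec \<Rightarrow> ('m, 7) tvec \<Rightarrow> ('m, 7) tvec" where
  "unit_cross A \<phi> p s v = g2_metric A \<phi> p s s powr (- (1 / 2)) *\<^sub>R g2_cross A \<phi> p s v"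

context
  fixes A :: "('m::topological_space, 7) chart set" and \<phi> :: "('m, 7) form3"
  assumes A: "smooth_structure A" and \<phi>: "g2_structure A \<phi>"
begin

lemma inv_frame_scaleR: "v \<in> tangent_space A p \<Longrightarrow>
    inv (some_g2_frame A \<phi> p) (r *\<^sub>R v) = r *\<^sub>R inv (some_g2_frame A \<phi> p) v"
  using inv_frame_combination[OF A \<phi>, of v p v r 0] by simp

lemma inv_frame_eq_0_iff: "v \<in> tangent_space A p \<Longrightarrow> inv (some_g2_frame A \<phi> p) v = 0 \<longleftrightarrow> v = 0"
  by (metis A \<phi> frame(1) frame_inv inv_frame linear_0)

lemma g2_metric_pos: "v \<in> tangent_space A p \<Longrightarrow> v \<noteq> 0 \<Longrightarrow> 0 < g2_metric A \<phi> p v v"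
  by (simp add: g2_metric_def inv_frame_eq_0_iff)

lemma inv_frame_g2_cross: "inv (some_g2_frame A \<phi> p) (g2_cross A \<phi> p u v)
    = cross7 (inv (some_g2_frame A \<phi> p) u) (inv (some_g2_frame A \<phi> p) v)"
  by (simp add: g2_cross_def inv_frame[OF A \<phi>])

lemma unit_cross_in [simp]: "unit_cross A \<phi> p s v \<in> tangent_space A p"
  by (simp add: unit_cross_def subspace_scale[OF subspace_tangent_space[OF A]] g2_cross_in[OF A \<phi>])

lemma inv_frame_unit_cross: "inv (some_g2_frame A \<phi> p) (unit_cross A \<phi> p s v)
    = g2_metric A \<phi> p s s powr (- (1 / 2)) *\<^sub>R cross7 (inv (some_g2_frame A \<phi> p) s) (inv (some_g2_frame A \<phi> p) v)"
  by (simp add: unit_cross_def inv_frame_scaleR g2_cross_in[OF A \<phi>] inv_frame_g2_cross)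

lemma inj_inv_frame:
  assumes "u \<in> tangent_space A p" "v \<in> tangent_space A p"
    and "inv (some_g2_frame A \<phi> p) u = inv (some_g2_frame A \<phi> p) v"
  shows "u = v"
  using assms frame_inv[OF A \<phi>] by metis

lemma unit_cross_combination:
  assumes "v \<in> tangent_space A p" "w \<in> tangent_space A p"
  shows "unit_cross A \<phi> p s (a *\<^sub>R v + b *\<^sub>R w) = a *\<^sub>R unit_cross A \<phi> p s v + b *\<^sub>R unit_cross A \<phi> p s w"
proof (rule inj_inv_frame[of _ p])
  show "a *\<^sub>R unit_cross A \<phi> p s v + b *\<^sub>R unit_cross A \<phi> p s w \<in> tangent_space A p"
    using subspace_tangent_space[OF A, of p] by (simp add: subspace_add subspace_scale)
  show "inv (some_g2_frame A \<phi> p) (unit_cross A \<phi> p s (a *\<^sub>R v + b *\<^sub>R w))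
    = inv (some_g2_frame A \<phi> p) (a *\<^sub>R unit_cross A \<phi> p s v + b *\<^sub>R unit_cross A \<phi> p s w)"
    using assms by (simp add: inv_frame_unit_cross inv_frame_combination[OF A \<phi>]
        linear_add[OF linear_cross7] linear_scale[OF linear_cross7] scaleR_add_right mult.commute)
qed simp

text \<open>The double cross product of \<open>s\<close> with an orthogonal \<open>v\<close> is
  \<open>- |s|\<^sup>2 v\<close>, and normalising twice divides by
  \<open>|s|\<^sup>2\<close>.\<close>

lemma unit_cross_twice:
  assumes "s \<in> tangent_space A p" "s \<noteq> 0" "v \<in> tangent_space A p" "g2_metric A \<phi> p s v = 0"
  shows "unit_cross A \<phi> p s (unit_cross A \<phi> p s v) = - v"
proof (rule inj_inv_frame[of _ p])
  show "- v \<in> tangent_space A p"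
    using subspace_neg[OF subspace_tangent_space[OF A] assms(3)] .
  have pos: "0 < inv (some_g2_frame A \<phi> p) s \<bullet> inv (some_g2_frame A \<phi> p) s"
    using g2_metric_pos[OF assms(1,2)] by (simp add: g2_metric_def)
  have "x powr (- (1 / 2)) * (x powr (- (1 / 2)) * x) = 1" if "0 < x" for x :: real
    using that by (simp add: powr_minus field_simps flip: powr_add)
  note this[OF pos]
  then show "inv (some_g2_frame A \<phi> p) (unit_cross A \<phi> p s (unit_cross A \<phi> p s v)) = inv (some_g2_frame A \<phi> p) (- v)"
    using assms pos inv_frame_scaleR[OF assms(3), of "- 1"]
    by (simp add: inv_frame_unit_cross g2_metric_def linear_scale[OF linear_cross7] cross7_cross7)
qed simp

text \<open>Only the ray of \<open>s\<close> matters, so a pointwise choice of \<open>s\<close> can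
  be replaced by a smooth one that differs from it by positive factors.\<close>

lemma unit_cross_scaleR_left:
  assumes "s \<in> tangent_space A p" "0 < r"
  shows "unit_cross A \<phi> p (r *\<^sub>R s) v = unit_cross A \<phi> p s v"
proof (rule inj_inv_frame[of _ p])
  have "r * (r * r) powr (- (1 / 2)) = 1"
    using assms(2) by (simp add: powr_mult powr_minus field_simps flip: powr_add)
  then have "(r * (r * x)) powr (- (1 / 2)) * r = x powr (- (1 / 2))" if "0 \<le> x" for x
    using that assms(2) powr_mult[of "r * r" x "- (1 / 2)"] by (simp add: mult_ac)
  then show "inv (some_g2_frame A \<phi> p) (unit_cross A \<phi> p (r *\<^sub>R s) v) = inv (some_g2_frame A \<phi> p) (unit_cross A \<phi> p s v)"
    using assms(1) by (simp add: inv_frame_unit_cross g2_metric_def inv_frame_scaleR bilinear_lmul[OF bilinear_cross7])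
qed simp_all

lemma linear_local_cross:
  assumes c: "c \<in> A" "p \<in> fst c"
  shows "linear (local_cross A \<phi> c (snd c p) x)"
proof (rule linearI)
  note lin = linear_add[OF linear_pull[OF A \<phi> c]] linear_scale[OF linear_pull[OF A \<phi> c]]
    linear_add[OF linear_cross7] linear_scale[OF linear_cross7]
  note pull = pull_local_cross[OF A \<phi> c]
  fix y z :: "real ^ 7" and r
  show "local_cross A \<phi> c (snd c p) x (y + z) = local_cross A \<phi> c (snd c p) x y + local_cross A \<phi> c (snd c p) x z"
    by (rule injD[OF inj_pull[OF A \<phi> c]]) (simp add: pull lin)
  show "local_cross A \<phi> c (snd c p) x (r *\<^sub>R y) = r *\<^sub>R local_cross A \<phi> c (snd c p) x y"
    by (rule injD[OF inj_pull[OF A \<phi> c]]) (simp add: pull lin)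
qed

lemma smooth_unit_cross:
  assumes W0: "open W0" and s: "smooth_section A (Y \<inter> W0) s" and p: "p \<in> Y \<inter> W0" and nz: "s p \<noteq> 0"
  obtains c F where "c \<in> A" "p \<in> fst c" "fst c \<subseteq> W0" "smooth_on (snd c ` fst c) (F :: real ^ 7 \<Rightarrow> real ^ 7 ^ 7)"
    "\<And>q v. q \<in> Y \<inter> fst c \<Longrightarrow> v \<in> tangent_space A q \<Longrightarrow> unit_cross A \<phi> q (s q) v c = F (snd c q) *v v c"
proof -
  obtain c where c: "c \<in> A" "p \<in> fst c" using ex_chart[OF A] by blast
  obtain W F where W: "open W" "p \<in> W" "W \<subseteq> fst c" and F: "smooth_on (snd c ` W) F"
    "\<And>q. q \<in> Y \<inter> W0 \<inter> W \<Longrightarrow> s q c = F (snd c q)"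
    using smooth_section_in_chart[OF A s p c(2,1)] by metis
  have opn: "open (snd c ` W)"
    using open_chart_image[OF A c(1) W(1)] W(3) by (simp add: Int_absorb1)
  define N where "N t = (\<Sum>i\<in>UNIV. \<Sum>j\<in>UNIV. F t $ i * F t $ j * form_metric (local_form A \<phi> c t) $ i $ j)" for t
  have N: "smooth_on (snd c ` W) N"
    unfolding N_def by (rule smooth_local_metric_along[OF A \<phi> c(1) opn _ F(1)]) (use W in auto)
  have st: "s q \<in> tangent_space A q" if "q \<in> Y \<inter> W0" for q
    using s that by (simp add: smooth_section_def)
  have metric: "g2_metric A \<phi> q (s q) (s q) = N (snd c q)" if q: "q \<in> Y \<inter> W0 \<inter> W" for q
    using g2_metric_local[OF A \<phi> c(1), of q "s q" "s q"] q W st F(2)[OF q] by (auto simp: N_def)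
  \<comment> \<open>Off \<open>Y\<close> the extension \<open>F\<close> of \<open>s\<close> may
    vanish, and the normalisation fails there. Positivity of \<open>N\<close>, the squared length of
    \<open>F\<close>, is an open condition that holds at \<open>p\<close>.\<close>
  define D where "D = snd c ` W \<inter> N -` {0<..}"
  have D: "open D" "D \<subseteq> snd c ` W"
    unfolding D_def using continuous_open_preimage[OF smooth_on_imp_continuous_on[OF N] opn] by auto
  define U where "U = (fst c \<inter> snd c -` D) \<inter> W0"
  have "continuous_on (fst c) (snd c)"
    using chart_of_atlas(3)[OF A c(1)] by (simp add: homeomorphism_def)
  then have U: "open U"
    unfolding U_def using continuous_open_preimage[OF _ chart_of_atlas(1)[OF A c(1)] D(1)] W0 by blast
  have UW: "U \<subseteq> W" "U \<subseteq> fst c" "U \<subseteq> W0"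
    using D(2) W(3) chart_of_atlas(4)[OF A c(1)] by (auto simp: U_def dest: inj_onD)
  have SU: "snd c ` U \<subseteq> D" by (auto simp: U_def)
  have SUc: "snd c ` U \<subseteq> snd c ` fst c" using UW by blast
  have SUW: "snd c ` U \<subseteq> snd c ` W" using UW by blast
  have pU: "p \<in> U"
    using metric[of p] g2_metric_pos[OF st[OF p] nz] p c W by (auto simp: U_def D_def)
  have cU: "(U, snd c) \<in> A"
    by (rule restrict_chart[OF A c(1) U UW(2)])
  have opnU: "open (snd c ` U)"
    using open_chart_image[OF A c(1) U] UW(2) by (simp add: Int_absorb1)
  \<comment> \<open>The columns of the matrix are the images of the coordinate vectors.\<close>
  define F' where "F' t = (\<chi> i j. N t powr (- (1 / 2)) * local_cross A \<phi> c t (F t) (axis j 1) $ i)" for t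
  have "smooth_on (snd c ` U) F'"
    unfolding F'_def
  proof (intro smooth_on_vec smooth_on_mult smooth_on_powr smooth_on_nth opnU)
    show "smooth_on (snd c ` U) N" using smooth_on_subset[OF N SUW] .
    show "smooth_on (snd c ` U) (\<lambda>t. local_cross A \<phi> c t (F t) (axis j 1))" for j
      by (rule smooth_local_cross[OF A \<phi> c(1) opnU SUc smooth_on_subset[OF F(1) SUW] smooth_on_const])
    show "0 < N t" if "t \<in> snd c ` U" for t
      using that SU by (auto simp: D_def)
  qed
  moreover have "unit_cross A \<phi> q (s q) v (U, snd c) = F' (snd c q) *v v (U, snd c)"
    if q: "q \<in> Y \<inter> U" and v: "v \<in> tangent_space A q" for q v
  proof -
    have q': "q \<in> Y \<inter> W0 \<inter> W" "q \<in> Y \<inter> W0" "q \<in> fst c" using q UW by auto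
    let ?L = "local_cross A \<phi> c (snd c q) (F (snd c q))"
    have "unit_cross A \<phi> q (s q) v c = N (snd c q) powr (- (1 / 2)) *\<^sub>R ?L (v c)"
      using g2_cross_local[OF A \<phi> c(1) q'(3) st[OF q'(2)] v] F(2)[OF q'(1)]
      by (simp add: unit_cross_def scaleR_fun_def metric[OF q'(1)])
    also have "?L (v c) = (\<Sum>j\<in>UNIV. v c $ j *\<^sub>R ?L (axis j 1))"
      by (rule linear_sum_axis[OF linear_local_cross[OF c(1) q'(3)]])
    also have "N (snd c q) powr (- (1 / 2)) *\<^sub>R \<dots> = F' (snd c q) *v v c"
      by (simp add: vec_eq_iff F'_def matrix_vector_mult_def sum_distrib_left mult_ac)
    finally show ?thesis
      using tangent_restrict_chart[OF A c(1) U UW(2) _ v] tangent_restrict_chart[OF A c(1) U UW(2) _ unit_cross_in] q by simp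
  qed
  ultimately show ?thesis
    using that[of "(U, snd c)" F'] cU pU UW by simp
qed

text \<open>The common core of both halves: the fibres have to be orthogonal to \<open>s\<close> and
  closed under the product with \<open>s\<close>. The last hypothesis leaves \<open>s\<close> itself
  free up to positive factors, since the matrix is built from the smooth representative
  \<open>s'\<close>.\<close>

lemma almost_complex_unit_cross:
  assumes V: "\<And>p. p \<in> Y \<Longrightarrow> subspace (V p)" "\<And>p. p \<in> Y \<Longrightarrow> V p \<subseteq> tangent_space A p"
    and s: "\<And>p. p \<in> Y \<Longrightarrow> s p \<in> tangent_space A p" "\<And>p. p \<in> Y \<Longrightarrow> s p \<noteq> 0"
    and orth: "\<And>p v. p \<in> Y \<Longrightarrow> v \<in> V p \<Longrightarrow> g2_metric A \<phi> p (s p) v = 0"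
    and cross: "\<And>p v. p \<in> Y \<Longrightarrow> v \<in> V p \<Longrightarrow> g2_cross A \<phi> p (s p) v \<in> V p"
    and smooth: "\<And>p. p \<in> Y \<Longrightarrow> \<exists>W s'. open W \<and> p \<in> W \<and> smooth_section A (Y \<inter> W) s' \<and>
      (\<forall>q\<in>Y \<inter> W. \<exists>r>0. s q = r *\<^sub>R s' q)"
  shows "almost_complex_structure A Y V (\<lambda>p. unit_cross A \<phi> p (s p))"
  unfolding almost_complex_structure_def bundle_endomorphism_def
proof (intro conjI ballI allI)
  fix p assume p: "p \<in> Y"
  show "unit_cross A \<phi> p (s p) v \<in> V p" if "v \<in> V p" for v
    unfolding unit_cross_def by (rule subspace_scale[OF V(1)[OF p] cross[OF p that]])
  show "unit_cross A \<phi> p (s p) (a *\<^sub>R v + b *\<^sub>R w) = a *\<^sub>R unit_cross A \<phi> p (s p) v + b *\<^sub>R unit_cross A \<phi> p (s p) w"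
    if "v \<in> V p" "w \<in> V p" for v w a b
    by (rule unit_cross_combination) (use that V(2)[OF p] in auto)
  show "unit_cross A \<phi> p (s p) (unit_cross A \<phi> p (s p) v) = - v" if "v \<in> V p" for v
    by (rule unit_cross_twice) (use that V(2)[OF p] s[OF p] orth[OF p] in auto)
  obtain W s' where W: "open W" "p \<in> W" and s': "smooth_section A (Y \<inter> W) s'"
    and r: "\<And>q. q \<in> Y \<inter> W \<Longrightarrow> \<exists>r>0. s q = r *\<^sub>R s' q"
    using smooth[OF p] by metis
  have "s' p \<noteq> 0"
    using r[of p] s(2)[OF p] p W by auto
  then obtain c and F :: "real ^ 7 \<Rightarrow> real ^ 7 ^ 7" where c: "c \<in> A" "p \<in> fst c" "fst c \<subseteq> W" and F: "smooth_on (snd c ` fst c) F"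
    "\<And>q v. q \<in> Y \<inter> fst c \<Longrightarrow> v \<in> tangent_space A q \<Longrightarrow> unit_cross A \<phi> q (s' q) v c = F (snd c q) *v v c"
    using smooth_unit_cross[OF W(1) s', of p] p W by (metis IntI)
  have "unit_cross A \<phi> q (s q) v c = F (snd c q) *v v c" if q: "q \<in> Y \<inter> fst c" and v: "v \<in> V q" for q v
  proof -
    have "q \<in> Y \<inter> W" using q c by blast
    then obtain r where "0 < r" "s q = r *\<^sub>R s' q" using r by blast
    moreover have "s' q \<in> tangent_space A q"
      using s' \<open>q \<in> Y \<inter> W\<close> by (simp add: smooth_section_def)
    ultimately show ?thesis
      using F(2)[of q v] q v V(2)[of q] by (auto simp: unit_cross_scaleR_left)
  qed
  then show "\<exists>c\<in>A. p \<in> fst c \<and> (\<exists>F :: real ^ 7 \<Rightarrow> real ^ 7 ^ 7. smooth_on (snd c ` fst c) F \<and>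
      (\<forall>q\<in>Y \<inter> fst c. \<forall>v\<in>V q. unit_cross A \<phi> q (s q) v c = F (snd c q) *v v c))"
    using c F(1) by blast
qed

end


section \<open>Coassociative and associative subspaces of the model\<close>

text \<open>The map \<open>x \<times> _\<close> is injective on the complement of \<open>x\<close>
  in \<open>T\<close>, and its image is orthogonal to \<open>T\<close> because \<open>phi0\<close>
  vanishes on \<open>T\<close>; this complement and the orthogonal space \<open>?N\<close> both have
  dimension 3. So \<open>s = x \<times> a\<close> with \<open>a\<close> in \<open>T\<close>, and
  \<open>s \<times> x\<close> is a combination of \<open>x\<close> and \<open>a\<close>, hence
  orthogonal to \<open>?N\<close>.\<close>

lemma cross7_coassociative:
  assumes T: "subspace T" "dim T = 4" and zero: "\<And>u v w. u \<in> T \<Longrightarrow> v \<in> T \<Longrightarrow> w \<in> T \<Longrightarrow> phi0 u v w = 0"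
    and s: "\<And>t. t \<in> T \<Longrightarrow> s \<bullet> t = 0" and x: "x \<in> T"
  shows "cross7 s x \<in> T"
proof (cases "x = 0")
  case True
  then show ?thesis
    using subspace_0[OF T(1)] by (simp add: linear_0[OF linear_cross7])
next
  case False
  let ?N = "{y \<in> UNIV. \<forall>t\<in>T. orthogonal t y}" and ?T1 = "{y \<in> T. \<forall>t\<in>span {x}. orthogonal t y}"
  have sub1: "subspace ?T1"
    using T(1) by (auto simp: subspace_def orthogonal_def inner_add_right)
  have subN: "subspace ?N"
    by (auto simp: subspace_def orthogonal_def inner_add_right)
  have "dim ?N + dim T = dim (UNIV :: (real ^ 7) set)"
    by (rule dim_subspace_orthogonal_to_vectors) (use T in auto)
  then have dimN: "dim ?N = 3"
    using T(2) by (simp add: dim_UNIV)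
  have "dim ?T1 + dim (span {x}) = dim T"
    by (rule dim_subspace_orthogonal_to_vectors) (use T x span_minimal[of "{x}" T] in auto)
  then have dim1: "dim ?T1 = 3"
    using False T(2) by (simp add: dim_insert)
  have inj: "inj_on (cross7 x) (span ?T1)"
    unfolding span_eq_iff[THEN iffD2, OF sub1]
  proof (rule inj_onI)
    fix y z assume yz: "y \<in> ?T1" "z \<in> ?T1" "cross7 x y = cross7 x z"
    then have "y - z \<in> ?T1" using subspace_diff[OF sub1] by blast
    then have "x \<bullet> (y - z) = 0"
      using span_base[of x "{x}"] by (auto simp: orthogonal_def)
    moreover have "cross7 x (cross7 x (y - z)) = 0"
      using yz(3) by (simp add: linear_diff[OF linear_cross7] linear_0[OF linear_cross7])
    ultimately show "y = z"
      using False by (simp add: cross7_cross7)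
  qed
  have "cross7 x ` ?T1 = ?N"
  proof (rule subspace_dim_equal)
    show "subspace (cross7 x ` ?T1)"
      by (rule linear_subspace_image[OF linear_cross7 sub1])
    show "cross7 x ` ?T1 \<subseteq> ?N"
      using zero x by (auto simp: orthogonal_def inner_commute[of _ "cross7 _ _"] cross7_inner)
    show "dim ?N \<le> dim (cross7 x ` ?T1)"
      using dim_image_eq[OF linear_cross7 inj] dim1 dimN by simp
  qed (rule subN)
  then have N: "\<exists>b\<in>T. n = cross7 x b" if "n \<in> ?N" for n
    using that by blast
  have "s \<in> ?N"
    using s by (simp add: orthogonal_def inner_commute)
  then obtain a where a: "a \<in> T" "s = cross7 x a" using N[of s] by blast
  have "cross7 s x \<bullet> n = 0" if n: "n \<in> ?N" for n
  proof -
    obtain b where b: "b \<in> T" "n = cross7 x b" using N[OF n] by blast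
    have "cross7 s x = - ((x \<bullet> a) *\<^sub>R x - (x \<bullet> x) *\<^sub>R a)"
      unfolding cross7_cross7[symmetric] a(2)[symmetric] by (rule cross7_swap)
    moreover have "x \<bullet> n = 0" "a \<bullet> n = 0"
      using a(1) x b zero by (simp_all add: inner_commute[of _ "cross7 _ _"] cross7_inner)
    ultimately show ?thesis
      by (simp add: inner_diff_left)
  qed
  moreover have "?N = T\<^sup>\<bottom>"
    by (auto simp: orthogonal_comp_def orthogonal_commute)
  ultimately have "cross7 s x \<in> T\<^sup>\<bottom>\<^sup>\<bottom>"
    by (auto simp: orthogonal_comp_def orthogonal_def inner_commute)
  then show ?thesis
    using orthogonal_comp_self[OF T(1)] by simp
qed

text \<open>Equality in \<open>phi0 a1 a2 a3 \<le> |a1 \<times> a2| |a3|\<close> forces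
  \<open>a1 \<times> a2 = a3\<close>. The double cross product then yields the rest of the
  multiplication table, that of the imaginary quaternions, and bilinearity extends closure from the
  basis to \<open>T\<close>.\<close>

lemma cross7_associative:
  assumes e: "a1 \<bullet> a1 = 1" "a2 \<bullet> a2 = 1" "a3 \<bullet> a3 = 1" "a1 \<bullet> a2 = 0" "phi0 a1 a2 a3 = 1"
    and T: "subspace T" "T = span {a1, a2, a3}" and uv: "u \<in> T" "v \<in> T"
  shows "cross7 u v \<in> T"
proof -
  have "(cross7 a1 a2 - a3) \<bullet> (cross7 a1 a2 - a3) = 0"
    using e cross7_inner_self[of a1 a2] cross7_inner[of a1 a2 a3]
    by (simp add: inner_diff_left inner_diff_right inner_commute)
  then have c12: "cross7 a1 a2 = a3" by simp
  have c13: "cross7 a1 a3 = - a2"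
    using cross7_cross7[of a1 a2] e c12 by simp
  have "cross7 a2 (cross7 a2 a1) = - a1"
    using cross7_cross7[of a2 a1] e by (simp add: inner_commute)
  then have c23: "cross7 a2 a3 = a1"
    using cross7_swap[of a1 a2] c12 by (simp add: linear_neg[OF linear_cross7])
  have mem: "a1 \<in> T" "a2 \<in> T" "a3 \<in> T"
    unfolding T(2) by (simp_all add: span_base)
  have basis: "cross7 a b \<in> T" if "a \<in> {a1, a2, a3}" "b \<in> {a1, a2, a3}" for a b
  proof -
    have "cross7 a2 a1 = - a3" "cross7 a3 a1 = a2" "cross7 a3 a2 = - a1"
      by (simp_all only: cross7_swap[of a2 a1] cross7_swap[of a3 a1] cross7_swap[of a3 a2] c12 c13 c23 minus_minus)
    note swapped = this
    show ?thesis
      using that by (auto simp: swapped c12 c13 c23 mem cross7_self subspace_0[OF T(1)] subspace_neg[OF T(1)])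
  qed
  have right: "cross7 a b \<in> T" if "a \<in> {a1, a2, a3}" "b \<in> T" for a b
  proof -
    have "cross7 a ` span {a1, a2, a3} = span (cross7 a ` {a1, a2, a3})"
      by (rule linear_span_image[symmetric]) (rule linear_cross7)
    also have "\<dots> \<subseteq> T"
      using that(1) by (intro span_minimal T(1)) (use basis in blast)
    finally show ?thesis using that(2) T(2) by blast
  qed
  have lin: "linear (\<lambda>a. cross7 a v)"
    using bilinear_cross7 by (simp add: bilinear_def)
  have "(\<lambda>a. cross7 a v) ` span {a1, a2, a3} = span ((\<lambda>a. cross7 a v) ` {a1, a2, a3})"
    by (rule linear_span_image[symmetric]) (rule lin)
  also have "\<dots> \<subseteq> T"
    by (intro span_minimal T(1)) (use right uv in blast)
  finally show ?thesis using uv(1) T(2) by blast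
qed

section \<open>Orthonormal families and orientations\<close>

lemma orthonormal_family:
  assumes "orthonormal (\<bullet>) (e :: (real ^ 'm) ^ 'k)"
  shows "inj (($) e)" "independent (range (($) e))"
proof -
  have e: "e $ i \<bullet> e $ j = (if i = j then 1 else 0)" for i j
    using assms by (simp add: orthonormal_def)
  show "inj (($) e)"
    by (rule injI) (metis e zero_neq_one)
  show "independent (range (($) e))"
  proof (rule pairwise_orthogonal_independent)
    show "pairwise orthogonal (range (($) e))"
      by (auto simp: pairwise_def orthogonal_def e)
    show "0 \<notin> range (($) e)"
      by (metis (no_types, lifting) e imageE inner_zero_left zero_neq_one)
  qed
qed

text \<open>A negatively oriented orthonormal basis is turned into a positively oriented one by a reflection.\<close>

lemma orthonormal_in_oriented_plane:
  fixes b :: "(real ^ 'm) ^ 'k"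
  assumes b: "independent_family b"
  shows "\<exists>e\<in>oriented_plane b. orthonormal (\<bullet>) e"
proof -
  let ?S = "span (range (($) b))"
  have inj: "inj (($) b)" and ind: "independent (range (($) b))"
    using b by (auto simp: independent_family_def)
  have "dim ?S = CARD('k)"
    using dim_eq_card_independent[OF ind] card_image[OF inj] by simp
  then obtain B where B: "B \<subseteq> ?S" "pairwise orthogonal B" "\<And>x. x \<in> B \<Longrightarrow> norm x = 1" "card B = CARD('k)" "independent B"
    using orthonormal_basis_subspace[of ?S] by (metis subspace_span)
  have "finite B" using B(5) by (simp add: independent_imp_finite)
  then obtain h where h: "bij_betw h (UNIV :: 'k set) B"
    using B(4) finite_same_card_bij[of "UNIV :: 'k set" B] by auto
  define e where "e = (\<chi> i. h i)"
  have e: "orthonormal (\<bullet>) e"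
  proof -
    have "h i \<in> B" for i using h by (auto simp: bij_betw_def)
    moreover have "h i \<noteq> h j" if "i \<noteq> j" for i j
      using h that by (auto simp: bij_betw_def dest: injD)
    ultimately show ?thesis
      using B(2,3) by (auto simp: orthonormal_def e_def pairwise_def orthogonal_def norm_eq_1)
  qed
  have ee: "e $ i \<bullet> e $ j = (if i = j then 1 else 0)" for i j
    using e by (simp add: orthonormal_def)
  have "\<exists>c. e $ i = (\<Sum>j\<in>UNIV. c j *\<^sub>R b $ j)" for i
  proof -
    have "e $ i \<in> ?S" using h B(1) by (auto simp: e_def bij_betw_def)
    then obtain c where "e $ i = (\<Sum>v\<in>range (($) b). c v *\<^sub>R v)"
      using span_finite[of "range (($) b)"] by auto
    then show ?thesis
      by (intro exI[of _ "\<lambda>j. c (b $ j)"]) (simp add: sum.reindex[OF inj])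
  qed
  then obtain c where c: "\<And>i. e $ i = (\<Sum>j\<in>UNIV. c i j *\<^sub>R b $ j)" by metis
  define Q :: "real ^ 'k ^ 'k" where "Q = (\<chi> i j. c i j)"
  \<comment> \<open>A kernel vector of the transpose of \<open>Q\<close> would be a linear relation
    between the orthonormal vectors of \<open>e\<close>.\<close>
  have "det Q \<noteq> 0"
  proof
    assume "det Q = 0"
    then have "det (transpose Q) = 0" by simp
    then obtain x where x: "x \<noteq> 0" "transpose Q *v x = 0"
      using det_nz_iff_inj_gen[of "(*v) (transpose Q)"] linear_injective_0[of "(*v) (transpose Q)"]
      by (metis det_nz_iff_inj matrix_of_matrix_vector_mul matrix_vector_mul_linear)
    have "(\<Sum>i\<in>UNIV. x $ i *\<^sub>R e $ i) = (\<Sum>j\<in>UNIV. (\<Sum>i\<in>UNIV. x $ i * c i j) *\<^sub>R b $ j)"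
      unfolding c scaleR_sum_right scaleR_sum_left by (subst sum.swap) simp
    moreover have "(\<Sum>i\<in>UNIV. x $ i * c i j) = (transpose Q *v x) $ j" for j
      unfolding transpose_def matrix_vector_mult_def Q_def by (simp add: mult.commute)
    ultimately have "(\<Sum>i\<in>UNIV. x $ i *\<^sub>R e $ i) = 0"
      unfolding x(2) by simp
    then have "(\<Sum>i\<in>UNIV. x $ i *\<^sub>R e $ i) \<bullet> e $ k = 0" for k by simp
    then have "x $ k = 0" for k
      by (simp add: inner_sum_left ee if_distrib[of "\<lambda>y. _ * y"] cong: if_cong)
    then show False using x(1) by (simp add: vec_eq_iff)
  qed
  \<comment> \<open>\<open>undefined\<close> is just some fixed index: this one vector is reflected
    if the orientation is wrong, so the product of all \<open>r i\<close> is the sign of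
    \<open>det Q\<close>.\<close>
  define r where "r i = (if i = undefined then sgn (det Q) else 1)" for i :: 'k
  have r: "r i * r i = 1" for i
    using \<open>det Q \<noteq> 0\<close> by (simp add: r_def sgn_if)
  have "det (\<chi> i. r i *s Q $ i) = (\<Prod>i\<in>UNIV. r i) * det Q"
    using det_rows_mul[of r "\<lambda>i. Q $ i"] by simp
  also have "(\<Prod>i\<in>UNIV. r i) = sgn (det Q)"
    by (simp add: r_def)
  finally have "0 < det (\<chi> i. r i *s Q $ i)"
    using \<open>det Q \<noteq> 0\<close> by (simp add: sgn_if)
  moreover have "(\<chi> i. r i *\<^sub>R e $ i) = (\<chi> i. \<Sum>j\<in>UNIV. (\<chi> i. r i *s Q $ i) $ i $ j *\<^sub>R b $ j)"
    by (simp add: vec_eq_iff[where 'b='k] c Q_def scaleR_sum_right)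
  ultimately have "(\<chi> i. r i *\<^sub>R e $ i) \<in> oriented_plane b"
    unfolding oriented_plane_def by blast
  moreover have "orthonormal (\<bullet>) (\<chi> i. r i *\<^sub>R e $ i)"
    using e r by (simp add: orthonormal_def)
  ultimately show ?thesis by blast
qed


section \<open>The Hodge star and \<open>\<chi>\<close> in a frame\<close>

lemma linear_det_row: "linear (\<lambda>x. det (\<chi> i. if i = k then x else c i))" for c :: "'n::finite \<Rightarrow> real ^ 'n"
proof (rule linearI)
  fix x y :: "real ^ 'n" and r
  show "det (\<chi> i. if i = k then x + y else c i) = det (\<chi> i. if i = k then x else c i) + det (\<chi> i. if i = k then y else c i)"
    by (rule det_row_add)
  show "det (\<chi> i. if i = k then r *\<^sub>R x else c i) = r *\<^sub>R det (\<chi> i. if i = k then x else c i)"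
    using det_row_mul[of k r "\<lambda>_. x" c] unfolding scalar_mult_eq_scaleR by simp
qed

lemma linear_det_vector7:
  "linear (\<lambda>x. det (vector [x, b, c, u, v, w, z] :: real ^ 7 ^ 7))"
  "linear (\<lambda>x. det (vector [a, x, c, u, v, w, z] :: real ^ 7 ^ 7))"
  "linear (\<lambda>x. det (vector [a, b, x, u, v, w, z] :: real ^ 7 ^ 7))"
proof -
  have "(\<lambda>x. det (vector [x, b, c, u, v, w, z] :: real ^ 7 ^ 7))
    = (\<lambda>x. det (\<chi> i. if i = 1 then x else (vector [0, b, c, u, v, w, z] :: real ^ 7 ^ 7) $ i))"
    by (intro ext arg_cong[where f = det]) (simp add: vec_eq_iff[where 'b=7] forall_7)
  then show "linear (\<lambda>x. det (vector [x, b, c, u, v, w, z] :: real ^ 7 ^ 7))"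
    by (simp only: linear_det_row)
  have "(\<lambda>x. det (vector [a, x, c, u, v, w, z] :: real ^ 7 ^ 7))
    = (\<lambda>x. det (\<chi> i. if i = 2 then x else (vector [a, 0, c, u, v, w, z] :: real ^ 7 ^ 7) $ i))"
    by (intro ext arg_cong[where f = det]) (simp add: vec_eq_iff[where 'b=7] forall_7)
  then show "linear (\<lambda>x. det (vector [a, x, c, u, v, w, z] :: real ^ 7 ^ 7))"
    by (simp only: linear_det_row)
  have "(\<lambda>x. det (vector [a, b, x, u, v, w, z] :: real ^ 7 ^ 7))
    = (\<lambda>x. det (\<chi> i. if i = 3 then x else (vector [a, b, 0, u, v, w, z] :: real ^ 7 ^ 7) $ i))"
    by (intro ext arg_cong[where f = det]) (simp add: vec_eq_iff[where 'b=7] forall_7)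
  then show "linear (\<lambda>x. det (vector [a, b, x, u, v, w, z] :: real ^ 7 ^ 7))"
    by (simp only: linear_det_row)
qed

lemma linear_phi0:
  "linear (\<lambda>x. phi0 x b c)" "linear (\<lambda>x. phi0 a x c)" "linear (\<lambda>x. phi0 a b x)"
  unfolding cross7_inner[symmetric]
  by (auto intro!: linearI simp: inner_add_left inner_add_right bilinear_ladd[OF bilinear_cross7]
      bilinear_radd[OF bilinear_cross7] bilinear_lmul[OF bilinear_cross7] bilinear_rmul[OF bilinear_cross7])

text \<open>Both sides are the inner product of two linear functionals, which can be computed in any
  orthonormal basis, here in the rows of \<open>P\<close>.\<close>

lemma sum_orthonormal_basis:
  fixes P :: "real ^ 'n ^ 'n" and f g :: "real ^ 'n \<Rightarrow> real"
  assumes P: "orthogonal_matrix P" and f: "linear f" and g: "linear g"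
  shows "(\<Sum>i\<in>UNIV. f (P $ i) * g (P $ i)) = (\<Sum>i\<in>UNIV. f (axis i 1) * g (axis i 1))"
proof -
  have col: "(\<Sum>i\<in>UNIV. P $ i $ a * P $ i $ b) = (if a = b then 1 else 0)" for a b
  proof -
    have "(transpose P ** P) $ a $ b = (mat 1 :: real ^ 'n ^ 'n) $ a $ b"
      using P by (simp add: orthogonal_matrix_def)
    then show ?thesis
      by (simp add: matrix_matrix_mult_def transpose_def mat_def)
  qed
  have "f (P $ i) * g (P $ i) = (\<Sum>a\<in>UNIV. \<Sum>b\<in>UNIV. (f (axis a 1) * g (axis b 1)) * (P $ i $ a * P $ i $ b))" for i
    unfolding linear_sum_axis[OF f, of "P $ i"] linear_sum_axis[OF g, of "P $ i"]
    by (simp add: sum_product mult_ac)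
  then have "(\<Sum>i\<in>UNIV. f (P $ i) * g (P $ i))
    = (\<Sum>i\<in>UNIV. \<Sum>a\<in>UNIV. \<Sum>b\<in>UNIV. (f (axis a 1) * g (axis b 1)) * (P $ i $ a * P $ i $ b))"
    by simp
  also have "\<dots> = (\<Sum>a\<in>UNIV. \<Sum>b\<in>UNIV. (f (axis a 1) * g (axis b 1)) * (\<Sum>i\<in>UNIV. P $ i $ a * P $ i $ b))"
    unfolding sum_distrib_left by (subst sum.swap, rule sum.cong[OF refl], subst sum.swap, rule refl)
  also have "\<dots> = (\<Sum>i\<in>UNIV. f (axis i 1) * g (axis i 1))"
    by (simp add: col if_distrib[of "\<lambda>x. _ * x"] cong: if_cong)
  finally show ?thesis .
qed

text \<open>\<open>hodge_star3\<close> sums over the basis that \<open>onb\<close> picks, of which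
  only orthonormality and orientation are known. Both factors are linear in each of the three slots,
  so the rows of \<open>P\<close> are exchanged for the standard basis one slot at a time; the swaps
  bring the current slot to the innermost sum.\<close>

lemma hodge0_orthonormal_basis:
  assumes P: "orthogonal_matrix P"
  shows "(1 / 6) * (\<Sum>i\<in>UNIV. \<Sum>j\<in>UNIV. \<Sum>k\<in>UNIV.
     phi0 (P $ i) (P $ j) (P $ k) * det (vector [P $ i, P $ j, P $ k, u, v, w, z] :: real ^ 7 ^ 7)) = hodge0 u v w z"
proof -
  let ?D = "\<lambda>a b c. det (vector [a, b, c, u, v, w, z] :: real ^ 7 ^ 7)"
  note rotate = sum_orthonormal_basis[OF P]
  have "(\<Sum>i\<in>UNIV. \<Sum>j\<in>UNIV. \<Sum>k\<in>UNIV. phi0 (P $ i) (P $ j) (P $ k) * ?D (P $ i) (P $ j) (P $ k))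
    = (\<Sum>i\<in>UNIV. \<Sum>j\<in>UNIV. \<Sum>k\<in>UNIV. phi0 (P $ i) (P $ j) (axis k 1) * ?D (P $ i) (P $ j) (axis k 1))"
    by (intro sum.cong refl rotate linear_phi0 linear_det_vector7)
  also have "\<dots> = (\<Sum>i\<in>UNIV. \<Sum>k\<in>UNIV. \<Sum>j\<in>UNIV. phi0 (P $ i) (P $ j) (axis k 1) * ?D (P $ i) (P $ j) (axis k 1))"
    by (intro sum.cong refl sum.swap)
  also have "\<dots> = (\<Sum>i\<in>UNIV. \<Sum>k\<in>UNIV. \<Sum>j\<in>UNIV. phi0 (P $ i) (axis j 1) (axis k 1) * ?D (P $ i) (axis j 1) (axis k 1))"
    by (intro sum.cong refl rotate linear_phi0 linear_det_vector7)
  also have "\<dots> = (\<Sum>i\<in>UNIV. \<Sum>j\<in>UNIV. \<Sum>k\<in>UNIV. phi0 (P $ i) (axis j 1) (axis k 1) * ?D (P $ i) (axis j 1) (axis k 1))"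
    by (intro sum.cong refl sum.swap)
  also have "\<dots> = (\<Sum>j\<in>UNIV. \<Sum>k\<in>UNIV. \<Sum>i\<in>UNIV. phi0 (P $ i) (axis j 1) (axis k 1) * ?D (P $ i) (axis j 1) (axis k 1))"
    by (subst sum.swap, rule sum.cong[OF refl], rule sum.swap)
  also have "\<dots> = (\<Sum>j\<in>UNIV. \<Sum>k\<in>UNIV. \<Sum>i\<in>UNIV. phi0 (axis i 1) (axis j 1) (axis k 1) * ?D (axis i 1) (axis j 1) (axis k 1))"
    by (intro sum.cong refl rotate linear_phi0 linear_det_vector7)
  also have "\<dots> = (\<Sum>i\<in>UNIV. \<Sum>j\<in>UNIV. \<Sum>k\<in>UNIV. phi0 (axis i 1) (axis j 1) (axis k 1) * ?D (axis i 1) (axis j 1) (axis k 1))"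
    by (subst (3) sum.swap, subst sum.swap, rule refl)
  finally show ?thesis by (simp add: hodge0_def)
qed

lemma self_in_oriented_plane: "b \<in> oriented_plane b"
proof -
  have "b = (\<chi> i. \<Sum>j\<in>UNIV. (mat 1 :: real ^ 'b ^ 'b) $ i $ j *\<^sub>R b $ j)"
    by (simp add: vec_eq_iff mat_def if_distrib[of "\<lambda>x. x *\<^sub>R _"] cong: if_cong)
  then show ?thesis
    unfolding oriented_plane_def by (intro CollectI exI[of _ "mat 1"] conjI) simp_all
qed

context
  fixes A :: "('m::topological_space, 7) chart set" and \<phi> :: "('m, 7) form3"
  assumes A: "smooth_structure A" and \<phi>: "g2_structure A \<phi>"
begin

lemma g2_metric_frame [simp]:
  "g2_metric A \<phi> p (some_g2_frame A \<phi> p x) (some_g2_frame A \<phi> p y) = x \<bullet> y"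
  by (simp add: g2_metric_def inv_frame[OF A \<phi>])

lemma star_phi_frame:
  fixes p
  defines "f \<equiv> some_g2_frame A \<phi> p"
  shows "star_phi A \<phi> p (f u) (f v) (f w) (f z) = hodge0 u v w z"
proof -
  let ?g = "g2_metric A \<phi> p" and ?ori = "g2_orientation A \<phi> p"
  define e where "e = onb ?g ?ori"
  have lin: "linear f" unfolding f_def by (rule frame(1)[OF A \<phi>])
  have g: "?g (f x) (f y) = x \<bullet> y" for x y unfolding f_def by simp
  let ?std = "(\<chi> i. f (axis i 1)) :: ('m, 7) tvec ^ 7"
  have ori: "?ori = oriented_plane ?std"
    by (simp add: g2_orientation_def f_def)
  have "?std \<in> ?ori"
    unfolding ori by (rule self_in_oriented_plane)
  moreover have "orthonormal ?g ?std"
    by (simp add: orthonormal_def g inner_axis_axis)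
  ultimately have e: "e \<in> ?ori" "orthonormal ?g e"
    using someI_ex[of "\<lambda>e. e \<in> ?ori \<and> orthonormal ?g e"] by (auto simp: e_def onb_def)
  then obtain P :: "real ^ 7 ^ 7" where P: "0 < det P" and eP: "e = (\<chi> i. \<Sum>j\<in>UNIV. P $ i $ j *\<^sub>R ?std $ j)"
    unfolding ori oriented_plane_def by blast
  have ei: "e $ i = f (P $ i)" for i
    using linear_sum_axis[OF lin, of "P $ i"] by (simp add: eP)
  have "(P ** transpose P) $ i $ j = (mat 1 :: real ^ 7 ^ 7) $ i $ j" for i j
    using e(2) by (simp add: orthonormal_def ei g matrix_matrix_mult_def transpose_def inner_vec_def mat_def)
  then have PP: "P ** transpose P = mat 1"
    by (simp add: vec_eq_iff)
  then have orth: "orthogonal_matrix P"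
    using matrix_left_right_inverse[of P "transpose P"] by (simp add: orthogonal_matrix_def)
  \<comment> \<open>Orthogonality leaves the sign open, and positive orientation decides it. Hence
    in the frame \<open>vol_form\<close> is the plain determinant.\<close>
  have "det P = 1"
    using det_orthogonal_matrix[OF orth] P by auto
  have vol: "vol_form ?g ?ori (vector [f a, f b, f c, f u, f v, f w, f z]) = det (vector [a, b, c, u, v, w, z] :: real ^ 7 ^ 7)"
    for a b c
  proof -
    let ?y = "vector [a, b, c, u, v, w, z] :: real ^ 7 ^ 7"
    have "vector [f a, f b, f c, f u, f v, f w, f z] = (\<chi> j. f (?y $ j))"
      by (simp add: vec_eq_iff[where 'b=7] forall_7)
    then have "vol_form ?g ?ori (vector [f a, f b, f c, f u, f v, f w, f z]) = det (\<chi> i j. P $ i \<bullet> ?y $ j)"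
      by (simp add: vol_form_def e_def[symmetric] ei g)
    also have "(\<chi> i j. P $ i \<bullet> ?y $ j) = P ** transpose ?y"
      by (simp add: vec_eq_iff matrix_matrix_mult_def transpose_def inner_vec_def)
    finally show ?thesis
      using \<open>det P = 1\<close> by (simp add: det_mul)
  qed
  have "\<phi> p (f x) (f y) (f z) = phi0 x y z" for x y z
    unfolding f_def by (rule frame(4)[OF A \<phi>])
  then have "star_phi A \<phi> p (f u) (f v) (f w) (f z) = (1 / 6) * (\<Sum>i\<in>UNIV. \<Sum>j\<in>UNIV. \<Sum>k\<in>UNIV.
     phi0 (P $ i) (P $ j) (P $ k) * det (vector [P $ i, P $ j, P $ k, u, v, w, z] :: real ^ 7 ^ 7))"
    by (simp add: star_phi_def hodge_star3_def e_def[symmetric] ei vol)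
  then show ?thesis
    using hodge0_orthonormal_basis[OF orth] by simp
qed

text \<open>The definite description in \<open>chi_form\<close> has a unique solution because a
  vector is determined by its inner products with all others.\<close>

lemma chi_form_frame:
  fixes p
  defines "f \<equiv> some_g2_frame A \<phi> p"
  shows "chi_form A \<phi> p (f u) (f v) (f w) = f (cross7 (cross7 u v) w - (u \<bullet> w) *\<^sub>R v + (v \<bullet> w) *\<^sub>R u)"
    (is "_ = f ?x")
proof -
  have T: "tangent_space A p = range f" unfolding f_def by (rule frame(3)[OF A \<phi>, symmetric])
  have g: "g2_metric A \<phi> p (f x) (f y) = x \<bullet> y" for x y unfolding f_def by simp
  have star: "star_phi A \<phi> p (f u) (f v) (f w) (f z) = ?x \<bullet> z" for z
    unfolding f_def star_phi_frame hodge0_eq ..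
  show ?thesis
    unfolding chi_form_def T
  proof (rule the_equality)
    show "f ?x \<in> range f \<and> (\<forall>z\<in>range f. g2_metric A \<phi> p (f ?x) z = star_phi A \<phi> p (f u) (f v) (f w) z)"
      by (auto simp: g star)
    fix y assume y: "y \<in> range f \<and> (\<forall>z\<in>range f. g2_metric A \<phi> p y z = star_phi A \<phi> p (f u) (f v) (f w) z)"
    then obtain x where x: "y = f x" by blast
    then have "x \<bullet> z = ?x \<bullet> z" for z
      using y by (auto simp: g star)
    then have "x = ?x"
      using vector_eq_rdot by blast
    then show "y = f ?x" using x by simp
  qed
qed

end


section \<open>Associative and coassociative submanifolds\<close>

lemma oriented_plane_in_subspace:
  assumes "subspace V" "\<And>i. b $ i \<in> V" "b' \<in> oriented_plane b"
  shows "b' $ i \<in> V"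
  using assms(2,3) by (auto simp: oriented_plane_def intro!: subspace_sum[OF assms(1)] subspace_scale[OF assms(1)])

lemma independent_family_preimage:
  assumes f: "linear f" and b: "independent_family (\<chi> i. f (b $ i))"
  shows "independent_family b"
proof -
  have inj: "inj_on f (range (($) b))" "inj (($) b)"
    using b by (auto simp: independent_family_def inj_on_def)
  have "independent (range (($) b))"
    unfolding dependent_def
  proof
    assume "\<exists>a\<in>range (($) b). a \<in> span (range (($) b) - {a})"
    then obtain a where a: "a \<in> range (($) b)" "a \<in> span (range (($) b) - {a})" by blast
    then have "f a \<in> span (f ` (range (($) b) - {a}))"
      using linear_span_image[OF f] by blast
    also have "f ` (range (($) b) - {a}) = f ` range (($) b) - {f a}"
      using inj_on_image_set_diff[OF inj(1), of "range (($) b)" "{a}"] a(1) by auto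
    also have "f ` range (($) b) = range (($) (\<chi> i. f (b $ i)))"
      by auto
    finally show False
      using b a(1) unfolding independent_family_def dependent_def by force
  qed
  then show ?thesis
    using inj by (simp add: independent_family_def)
qed

text \<open>If the product vanished, so would the double product of the first vector with the
  second, and its formula exhibits the second as a multiple of the first.\<close>

lemma cross7_independent_neq_0:
  fixes b :: "(real ^ 7) ^ 2"
  assumes "independent_family b"
  shows "cross7 (b $ 1) (b $ 2) \<noteq> 0"
proof
  assume "cross7 (b $ 1) (b $ 2) = 0"
  then have eq: "(b $ 1 \<bullet> b $ 2) *\<^sub>R b $ 1 = (b $ 1 \<bullet> b $ 1) *\<^sub>R b $ 2"
    using cross7_cross7[of "b $ 1" "b $ 2"] by (simp add: linear_0[OF linear_cross7])
  have ind: "independent {b $ 1, b $ 2}" and ne: "b $ 1 \<noteq> b $ 2"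
    using assms by (auto simp: independent_family_def UNIV_2 dest: injD)
  have "b $ 1 \<noteq> 0"
    using ind dependent_zero[of "{b $ 1, b $ 2}"] by auto
  then have "b $ 2 = ((b $ 1 \<bullet> b $ 2) / (b $ 1 \<bullet> b $ 1)) *\<^sub>R b $ 1"
    using arg_cong[OF eq, of "\<lambda>v. (1 / (b $ 1 \<bullet> b $ 1)) *\<^sub>R v"] by simp
  then have "b $ 2 \<in> span {b $ 1}"
    by (metis span_base span_scale singletonI)
  moreover have "{b $ 1, b $ 2} - {b $ 2} = {b $ 1}"
    using ne by auto
  ultimately show False
    using ind unfolding dependent_def by auto
qed

section \<open>Tangent and normal spaces of submanifolds in a frame\<close>

context
  fixes A :: "('m::topological_space, 7) chart set" and \<phi> :: "('m, 7) form3"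
  assumes A: "smooth_structure A" and \<phi>: "g2_structure A \<phi>"
begin

lemma tangent_space_frame: "v \<in> tangent_space A p \<Longrightarrow> \<exists>x. v = some_g2_frame A \<phi> p x"
  using frame(3)[OF A \<phi>] by blast

lemma tangent_sub_subset: "tangent_sub A Y p \<subseteq> tangent_space A p"
  by (auto simp: tangent_sub_def)

text \<open>Tangent vectors live in a function space. Pulled back by the frame, the tangent space of
  \<open>Y\<close> becomes a subspace of \<open>\<real>\<^sup>7\<close>, where dimensions and
  orthogonal complements can be used; it is the image of the slice subspace under the isomorphism
  \<open>pull\<close>.\<close>

lemma tangent_sub_frame:
  assumes Y: "submanifold A k Y" and p: "p \<in> Y"
  shows "subspace (some_g2_frame A \<phi> p -` tangent_sub A Y p)" "dim (some_g2_frame A \<phi> p -` tangent_sub A Y p) = k"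
proof -
  obtain c S where c: "slice_chart A Y c S" "p \<in> fst c" "dim S = k"
    using Y p unfolding submanifold_def by blast
  then have cA: "c \<in> A" and S: "subspace S"
    by (auto simp: slice_chart_def)
  let ?pull = "pull A \<phi> c p"
  note lin = linear_pull[OF A \<phi> cA c(2)] and inj = inj_pull[OF A \<phi> cA c(2)]
  have "some_g2_frame A \<phi> p -` tangent_sub A Y p = ?pull ` S"
  proof (intro subset_antisym subsetI)
    fix x assume "x \<in> some_g2_frame A \<phi> p -` tangent_sub A Y p"
    then have "some_g2_frame A \<phi> p x c \<in> S" "some_g2_frame A \<phi> p x \<in> tangent_space A p"
      unfolding tangent_sub_eq[OF A c(1,2) p] by auto
    then show "x \<in> ?pull ` S"
      using pull_coord[OF A \<phi> cA c(2)] inv_frame[OF A \<phi>] by (metis imageI)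
  next
    fix x assume "x \<in> ?pull ` S"
    then show "x \<in> some_g2_frame A \<phi> p -` tangent_sub A Y p"
      unfolding tangent_sub_eq[OF A c(1,2) p]
      by (auto simp: frame_pull[OF A \<phi> cA c(2)] coord_vec_in[OF A cA c(2)] coord_vec_same[OF A cA c(2)])
  qed
  then show "subspace (some_g2_frame A \<phi> p -` tangent_sub A Y p)" "dim (some_g2_frame A \<phi> p -` tangent_sub A Y p) = k"
    using linear_subspace_image[OF lin S] dim_image_eq[OF lin inj_on_subset[OF inj subset_UNIV], of S] c(3) by auto
qed

lemma tangent_sub_image:
  "tangent_sub A Y p = some_g2_frame A \<phi> p ` (some_g2_frame A \<phi> p -` tangent_sub A Y p)"
  unfolding image_vimage_eq frame(3)[OF A \<phi>] using tangent_sub_subset by (rule Int_absorb2[symmetric])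

lemma subspace_tangent_sub:
  assumes "submanifold A k Y" "p \<in> Y"
  shows "subspace (tangent_sub A Y p)"
  using linear_subspace_image[OF frame(1)[OF A \<phi>] tangent_sub_frame(1)[OF assms]] tangent_sub_image by metis

lemma subspace_normal_bundle: "subspace (normal_bundle A \<phi> Y p)"
proof -
  have sub: "subspace {x. \<forall>w\<in>tangent_sub A Y p. x \<bullet> inv (some_g2_frame A \<phi> p) w = 0}"
    by (auto simp: subspace_def inner_add_left)
  have eq: "normal_bundle A \<phi> Y p = some_g2_frame A \<phi> p ` {x. \<forall>w\<in>tangent_sub A Y p. x \<bullet> inv (some_g2_frame A \<phi> p) w = 0}"
  proof (intro subset_antisym subsetI)
    fix v assume "v \<in> normal_bundle A \<phi> Y p"
    then show "v \<in> some_g2_frame A \<phi> p ` {x. \<forall>w\<in>tangent_sub A Y p. x \<bullet> inv (some_g2_frame A \<phi> p) w = 0}"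
      by (intro image_eqI[of _ _ "inv (some_g2_frame A \<phi> p) v"])
         (auto simp: normal_bundle_def g2_metric_def frame_inv[OF A \<phi>])
  qed (auto simp: normal_bundle_def g2_metric_def inv_frame[OF A \<phi>] frame_in[OF A \<phi>])
  show ?thesis
    unfolding eq by (rule linear_subspace_image[OF frame(1)[OF A \<phi>] sub])
qed

lemma g2_metric_cross:
  assumes "u \<in> tangent_space A p" "v \<in> tangent_space A p" "w \<in> tangent_space A p"
  shows "g2_metric A \<phi> p (g2_cross A \<phi> p u v) w = \<phi> p u v w"
  using assms by (simp add: g2_metric_def inv_frame_g2_cross[OF A \<phi>] cross7_inner form_eq_phi0[OF A \<phi>])

text \<open>The volume form takes the value 1 on the orthonormal basis that defines it. So
  \<open>\<phi>\<close> is 1 on this basis, which is the hypothesis of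
  \<open>cross7_associative\<close>.\<close>

lemma associative_cross:
  assumes Y: "associative A \<phi> Y" and p: "p \<in> Y" and uv: "u \<in> tangent_sub A Y p" "v \<in> tangent_sub A Y p"
  shows "g2_cross A \<phi> p u v \<in> tangent_sub A Y p"
proof -
  let ?E = "some_g2_frame A \<phi> p" and ?g = "g2_metric A \<phi> p"
  obtain ori :: "'m \<Rightarrow> (('m, 7) tvec ^ 3) set" where sub: "submanifold A 3 Y" and ori: "oriented_plane_field A Y ori"
    and vol: "\<And>u v w. u \<in> tangent_sub A Y p \<Longrightarrow> v \<in> tangent_sub A Y p \<Longrightarrow> w \<in> tangent_sub A Y p \<Longrightarrow>
      \<phi> p u v w = vol_form ?g (ori p) (vector [u, v, w])"
    using Y p unfolding associative_def by blast
  obtain b where b: "independent_family b" "\<And>i. b $ i \<in> tangent_sub A Y p" "ori p = oriented_plane b"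
    using ori p unfolding oriented_plane_field_def by (metis IntI)
  define b' where "b' = (\<chi> i. inv ?E (b $ i))"
  have Eb': "b = (\<chi> i. ?E (b' $ i))"
    by (simp add: b'_def vec_eq_iff[where 'b=3] frame_inv[OF A \<phi> subsetD[OF tangent_sub_subset b(2)]])
  have "independent_family b'"
    using independent_family_preimage[OF frame(1)[OF A \<phi>, of p], of b'] b(1) Eb' by simp
  \<comment> \<open>The basis chosen by \<open>onb\<close> has the required properties once some
    positively oriented orthonormal basis is exhibited.\<close>
  then obtain e' where e': "e' \<in> oriented_plane b'" "orthonormal (\<bullet>) e'"
    using orthonormal_in_oriented_plane by blast
  have "(\<chi> i. ?E (e' $ i)) \<in> ori p"
  proof -
    obtain Q :: "real ^ 3 ^ 3" where "0 < det Q" "e' = (\<chi> i. \<Sum>j\<in>UNIV. Q $ i $ j *\<^sub>R b' $ j)"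
      using e'(1) by (auto simp: oriented_plane_def)
    then show ?thesis
      unfolding b(3) Eb' oriented_plane_def
      by (auto simp: linear_sum[OF frame(1)[OF A \<phi>]] linear_scale[OF frame(1)[OF A \<phi>]])
  qed
  moreover have "orthonormal ?g (\<chi> i. ?E (e' $ i))"
    using e'(2) by (simp add: orthonormal_def g2_metric_frame[OF A \<phi>])
  ultimately have e: "onb ?g (ori p) \<in> ori p" "orthonormal ?g (onb ?g (ori p))"
    unfolding onb_def by (metis (mono_tags, lifting) someI_ex)+
  define x where "x = (\<chi> i. inv ?E (onb ?g (ori p) $ i))"
  let ?T = "?E -` tangent_sub A Y p"
  have T: "subspace ?T" "dim ?T = 3"
    using tangent_sub_frame[OF sub p] by auto
  have tan: "onb ?g (ori p) $ i \<in> tangent_sub A Y p" for i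
    by (rule oriented_plane_in_subspace[OF subspace_tangent_sub[OF sub p] b(2)]) (use e(1) b(3) in simp)
  have Ex: "?E (x $ i) = onb ?g (ori p) $ i" for i
    by (simp add: x_def frame_inv[OF A \<phi> subsetD[OF tangent_sub_subset tan]])
  have xT: "x $ i \<in> ?T" for i
    using tan[of i] by (simp add: Ex)
  have x: "orthonormal (\<bullet>) x"
    using e(2) by (simp add: orthonormal_def g2_metric_frame[OF A \<phi>] flip: Ex)
  have "\<phi> p (?E (x $ 1)) (?E (x $ 2)) (?E (x $ 3)) = 1"
  proof -
    have "(\<chi> i j. ?g (onb ?g (ori p) $ i) (vector [?E (x $ 1), ?E (x $ 2), ?E (x $ 3)] $ j)) = (mat 1 :: real ^ 3 ^ 3)"
      using e(2) by (simp add: vec_eq_iff forall_3 Ex orthonormal_def mat_def)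
    then show ?thesis
      using vol[of "?E (x $ 1)" "?E (x $ 2)" "?E (x $ 3)"] tan by (simp add: vol_form_def Ex)
  qed
  then have phi: "phi0 (x $ 1) (x $ 2) (x $ 3) = 1"
    by (simp add: frame(4)[OF A \<phi>])
  have range: "range (($) x) = {x $ 1, x $ 2, x $ 3}"
    by (auto simp: UNIV_3)
  have "?T = span {x $ 1, x $ 2, x $ 3}"
  proof (rule subset_antisym)
    show "?T \<subseteq> span {x $ 1, x $ 2, x $ 3}"
      unfolding range[symmetric]
      by (rule card_ge_dim_independent) (use xT orthonormal_family[OF x] card_image[of "($) x" UNIV] T(2) in auto)
    show "span {x $ 1, x $ 2, x $ 3} \<subseteq> ?T"
      by (rule span_minimal[OF _ T(1)]) (use xT in blast)
  qed
  moreover have "inv ?E u \<in> ?T" "inv ?E v \<in> ?T"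
    using uv by (simp_all add: frame_inv[OF A \<phi> subsetD[OF tangent_sub_subset]])
  ultimately have "cross7 (inv ?E u) (inv ?E v) \<in> ?T"
    using x T(1) phi by (intro cross7_associative[of "x $ 1" "x $ 2" "x $ 3"]) (auto simp: orthonormal_def)
  then show ?thesis
    by (simp add: g2_cross_def)
qed

lemma coassociative_cross:
  assumes X: "coassociative A \<phi> X" and p: "p \<in> X" and s: "s \<in> normal_bundle A \<phi> X p" and v: "v \<in> tangent_sub A X p"
  shows "g2_cross A \<phi> p s v \<in> tangent_sub A X p"
proof -
  let ?E = "some_g2_frame A \<phi> p"
  have sub: "submanifold A 4 X" and zero: "\<And>u v w. u \<in> tangent_sub A X p \<Longrightarrow> v \<in> tangent_sub A X p \<Longrightarrow>
      w \<in> tangent_sub A X p \<Longrightarrow> \<phi> p u v w = 0"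
    using X p by (auto simp: coassociative_def)
  have "cross7 (inv ?E s) (inv ?E v) \<in> ?E -` tangent_sub A X p"
  proof (rule cross7_coassociative[OF tangent_sub_frame[OF sub p]])
    show "phi0 x y z = 0" if "x \<in> ?E -` tangent_sub A X p" "y \<in> ?E -` tangent_sub A X p" "z \<in> ?E -` tangent_sub A X p" for x y z
      using zero[of "?E x" "?E y" "?E z"] that by (simp add: frame(4)[OF A \<phi>])
    show "inv ?E s \<bullet> t = 0" if "t \<in> ?E -` tangent_sub A X p" for t
      using s that by (auto simp: normal_bundle_def g2_metric_def inv_frame[OF A \<phi>] dest!: bspec[of _ _ "?E t"])
    show "inv ?E v \<in> ?E -` tangent_sub A X p"
      using v by (simp add: frame_inv[OF A \<phi> subsetD[OF tangent_sub_subset]])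
  qed
  then show ?thesis
    by (simp add: g2_cross_def)
qed

text \<open>An alternating product of two vectors is multiplied by the determinant of the change of
  basis, which is positive within one orientation.\<close>

lemma plane_cross:
  fixes b :: "('m, 7) tvec ^ 2"
  assumes b: "\<And>i. b $ i \<in> tangent_space A p" and b': "b' \<in> oriented_plane b"
  shows "\<exists>r>0. g2_cross A \<phi> p (b' $ 1) (b' $ 2) = r *\<^sub>R g2_cross A \<phi> p (b $ 1) (b $ 2)"
proof -
  let ?E = "some_g2_frame A \<phi> p"
  obtain Q :: "real ^ 2 ^ 2" where Q: "0 < det Q" and b'Q: "b' = (\<chi> i. \<Sum>j\<in>UNIV. Q $ i $ j *\<^sub>R b $ j)"
    using b' by (auto simp: oriented_plane_def)
  have "inv ?E (b' $ i) = Q $ i $ 1 *\<^sub>R inv ?E (b $ 1) + Q $ i $ 2 *\<^sub>R inv ?E (b $ 2)" for i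
    using b by (simp add: b'Q sum_2 inv_frame_combination[OF A \<phi>])
  then have "cross7 (inv ?E (b' $ 1)) (inv ?E (b' $ 2)) = det Q *\<^sub>R cross7 (inv ?E (b $ 1)) (inv ?E (b $ 2))"
    using cross7_swap[of "inv ?E (b $ 2)" "inv ?E (b $ 1)"]
    by (simp add: det_2 bilinear_ladd[OF bilinear_cross7] bilinear_radd[OF bilinear_cross7] bilinear_lmul[OF bilinear_cross7]
        bilinear_rmul[OF bilinear_cross7] cross7_self algebra_simps)
  then have "g2_cross A \<phi> p (b' $ 1) (b' $ 2) = det Q *\<^sub>R g2_cross A \<phi> p (b $ 1) (b $ 2)"
    by (simp add: g2_cross_def linear_scale[OF frame(1)[OF A \<phi>]])
  then show ?thesis using Q by blast
qed

lemma plane_cross_neq_0: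
  fixes b :: "('m, 7) tvec ^ 2"
  assumes "\<And>i. b $ i \<in> tangent_space A p" "independent_family b"
  shows "g2_cross A \<phi> p (b $ 1) (b $ 2) \<noteq> 0"
proof -
  let ?E = "some_g2_frame A \<phi> p" and ?b' = "\<chi> i. inv (some_g2_frame A \<phi> p) (b $ i)"
  have "(\<chi> i. ?E (?b' $ i)) = b"
    using assms(1) by (simp add: vec_eq_iff[where 'b=2] frame_inv[OF A \<phi>])
  then have "independent_family ?b'"
    using independent_family_preimage[OF frame(1)[OF A \<phi>, of p], of ?b'] assms(2) by simp
  then have "cross7 (inv ?E (b $ 1)) (inv ?E (b $ 2)) \<noteq> 0"
    using cross7_independent_neq_0[of ?b'] by simp
  then show ?thesis
    using inv_frame_g2_cross[OF A \<phi>, of p "b $ 1" "b $ 2"] inv_frame_eq_0_iff[OF A \<phi> g2_cross_in[OF A \<phi>]] by metis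
qed

section \<open>The two almost complex structures\<close>

text \<open>For orthonormal \<open>u, v\<close> the product \<open>u \<times> v\<close> is a unit
  vector, so the normalising factor is 1; orthogonality of \<open>x\<close> removes the correction
  terms of \<open>\<chi>\<close>.\<close>

lemma chi_form_eq_unit_cross:
  assumes uv: "u \<in> tangent_space A p" "v \<in> tangent_space A p" "orthonormal (g2_metric A \<phi> p) (vector [u, v] :: ('m, 7) tvec ^ 2)"
    and x: "x \<in> tangent_space A p" "g2_metric A \<phi> p u x = 0" "g2_metric A \<phi> p v x = 0"
  shows "chi_form A \<phi> p u v x = unit_cross A \<phi> p (g2_cross A \<phi> p u v) x"
proof -
  let ?E = "some_g2_frame A \<phi> p"
  obtain u' v' x' where E: "u = ?E u'" "v = ?E v'" "x = ?E x'"
    using uv x tangent_space_frame by metis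
  have orth: "u' \<bullet> u' = 1" "v' \<bullet> v' = 1" "u' \<bullet> v' = 0" "u' \<bullet> x' = 0" "v' \<bullet> x' = 0"
    using uv(3) x by (auto simp: orthonormal_def forall_2 E g2_metric_frame[OF A \<phi>])
  have "g2_metric A \<phi> p (g2_cross A \<phi> p u v) (g2_cross A \<phi> p u v) = 1"
    using orth by (simp add: g2_metric_def inv_frame_g2_cross[OF A \<phi>] E inv_frame[OF A \<phi>] cross7_inner_self)
  then have "unit_cross A \<phi> p (g2_cross A \<phi> p u v) x = ?E (cross7 (cross7 u' v') x')"
    by (simp add: unit_cross_def g2_cross_def E inv_frame[OF A \<phi>])
  then show ?thesis
    using orth by (simp add: E chi_form_frame[OF A \<phi>])
qed

lemma associative_almost_complex:
  assumes Y: "associative A \<phi> Y" and P: "oriented_plane_field A Y (P :: 'm \<Rightarrow> (('m, 7) tvec ^ 2) set)"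
  shows "\<exists>J. almost_complex_structure A Y (normal_bundle A \<phi> Y) J \<and>
                 (\<forall>p\<in>Y. \<forall>u v. vector [u, v] \<in> P p \<and>
                    orthonormal (g2_metric A \<phi> p) (vector [u, v] :: ('m, 7) tvec ^ 2) \<longrightarrow>
                    (\<forall>x\<in>normal_bundle A \<phi> Y p. J p x = chi_form A \<phi> p u v x))"
proof -
  \<comment> \<open>This choice may jump from point to point; by \<open>s_eq\<close> that affects
    \<open>s\<close> only through positive factors.\<close>
  define b where "b p = (SOME b. b \<in> P p)" for p
  define s where "s p = g2_cross A \<phi> p (b p $ 1) (b p $ 2)" for p
  have sub: "submanifold A 3 Y" using Y by (simp add: associative_def)
  have plane: "\<exists>c. independent_family c \<and> (\<forall>i. c $ i \<in> tangent_sub A Y p) \<and> P p = oriented_plane c" if "p \<in> Y" for p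
    using P that unfolding oriented_plane_field_def by (metis IntI)
  have tan: "c $ i \<in> tangent_sub A Y p" if "p \<in> Y" "c \<in> P p" for c i p
    using plane[OF that(1)] oriented_plane_in_subspace[OF subspace_tangent_sub[OF sub that(1)]] that(2) by metis
  have bP: "b p \<in> P p" if "p \<in> Y" for p
    unfolding b_def using plane[OF that] self_in_oriented_plane by (metis someI_ex)
  have s_eq: "\<exists>r>0. s p = r *\<^sub>R g2_cross A \<phi> p (c $ 1) (c $ 2)" if p: "p \<in> Y" and c: "P p = oriented_plane c" for c p
    unfolding s_def
  proof (rule plane_cross)
    show "c $ i \<in> tangent_space A p" for i
      using tan[OF p, of c i] c self_in_oriented_plane[of c] tangent_sub_subset by auto
    show "b p \<in> oriented_plane c" using bP[OF p] c by simp
  qed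
  have s_tan: "s p \<in> tangent_sub A Y p" if "p \<in> Y" for p
    unfolding s_def by (intro associative_cross[OF Y that] tan[OF that bP[OF that]])
  have normal: "v \<in> tangent_space A p" "g2_metric A \<phi> p w v = 0"
    if "v \<in> normal_bundle A \<phi> Y p" "w \<in> tangent_sub A Y p" for v w p
    using that by (auto simp: normal_bundle_def g2_metric_def inner_commute)
  have "almost_complex_structure A Y (normal_bundle A \<phi> Y) (\<lambda>p. unit_cross A \<phi> p (s p))"
  proof (rule almost_complex_unit_cross[OF A \<phi>])
    fix p assume p: "p \<in> Y"
    show "subspace (normal_bundle A \<phi> Y p)" by (rule subspace_normal_bundle)
    show "normal_bundle A \<phi> Y p \<subseteq> tangent_space A p" by (auto simp: normal_bundle_def)
    show sT: "s p \<in> tangent_space A p" using s_tan[OF p] tangent_sub_subset by blast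
    obtain c where c: "independent_family c" "\<And>i. c $ i \<in> tangent_sub A Y p" "P p = oriented_plane c"
      using plane[OF p] by blast
    then have "g2_cross A \<phi> p (c $ 1) (c $ 2) \<noteq> 0"
      using plane_cross_neq_0[of c p] tangent_sub_subset by blast
    then show "s p \<noteq> 0" using s_eq[OF p c(3)] by auto
    fix v assume v: "v \<in> normal_bundle A \<phi> Y p"
    show "g2_metric A \<phi> p (s p) v = 0" by (rule normal(2)[OF v s_tan[OF p]])
    \<comment> \<open>As \<open>\<phi>\<close> alternates, \<open>s \<times> v\<close> paired with a
      tangent \<open>w\<close> is minus \<open>s \<times> w\<close> paired with \<open>v\<close>. On
      an associative submanifold \<open>s \<times> w\<close> is tangent, and \<open>v\<close> is
      normal.\<close>
    have "g2_metric A \<phi> p (g2_cross A \<phi> p (s p) v) w = 0" if w: "w \<in> tangent_sub A Y p" for w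
    proof -
      have wT: "w \<in> tangent_space A p" and vT: "v \<in> tangent_space A p"
        using w tangent_sub_subset normal(1)[OF v w] by auto
      have "g2_metric A \<phi> p (g2_cross A \<phi> p (s p) v) w = - \<phi> p (s p) w v"
        using phi0_swap(2)[of "inv (some_g2_frame A \<phi> p) (s p)" "inv (some_g2_frame A \<phi> p) v" "inv (some_g2_frame A \<phi> p) w"]
          sT vT wT by (simp add: g2_metric_cross form_eq_phi0[OF A \<phi>])
      also have "\<dots> = - g2_metric A \<phi> p (g2_cross A \<phi> p (s p) w) v"
        using sT vT wT by (simp add: g2_metric_cross)
      also have "\<dots> = 0"
        using normal(2)[OF v associative_cross[OF Y p s_tan[OF p] w]] by simp
      finally show ?thesis .
    qed
    then show "g2_cross A \<phi> p (s p) v \<in> normal_bundle A \<phi> Y p"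
      by (simp add: normal_bundle_def g2_cross_in[OF A \<phi>])
  next
    fix p assume "p \<in> Y"
    then obtain W c where W: "open W" "p \<in> W" "\<And>i. smooth_section A (Y \<inter> W) (\<lambda>q. c q $ i)"
      "\<And>q. q \<in> Y \<inter> W \<Longrightarrow> P q = oriented_plane (c q)"
      using P unfolding oriented_plane_field_def by metis
    then show "\<exists>W s'. open W \<and> p \<in> W \<and> smooth_section A (Y \<inter> W) s' \<and> (\<forall>q\<in>Y \<inter> W. \<exists>r>0. s q = r *\<^sub>R s' q)"
      using smooth_section_cross[OF A \<phi> W(3)[of 1] W(3)[of 2]] s_eq
      by (intro exI[of _ W] exI[of _ "\<lambda>q. g2_cross A \<phi> q (c q $ 1) (c q $ 2)"]) auto
  qed
  moreover have "unit_cross A \<phi> p (s p) x = chi_form A \<phi> p u v x"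
    if p: "p \<in> Y" and uv: "vector [u, v] \<in> P p" "orthonormal (g2_metric A \<phi> p) (vector [u, v] :: ('m, 7) tvec ^ 2)"
      and x: "x \<in> normal_bundle A \<phi> Y p" for p u v x
  proof -
    have tan_uv: "u \<in> tangent_sub A Y p" "v \<in> tangent_sub A Y p"
      using tan[OF p uv(1), of 1] tan[OF p uv(1), of 2] by simp_all
    then have T: "u \<in> tangent_space A p" "v \<in> tangent_space A p"
      using tangent_sub_subset by blast+
    obtain c where c: "\<And>i. c $ i \<in> tangent_sub A Y p" "P p = oriented_plane c"
      using plane[OF p] by blast
    have cT: "c $ i \<in> tangent_space A p" for i using c(1) tangent_sub_subset by blast
    \<comment> \<open>Both \<open>s p\<close> and \<open>g2_cross A \<phi> p u v\<close> are
      positive multiples of this vector, so they give the same \<open>unit_cross\<close>.\<close>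
    let ?w = "g2_cross A \<phi> p (c $ 1) (c $ 2)"
    obtain r where r: "0 < r" "s p = r *\<^sub>R ?w" using s_eq[OF p c(2)] by blast
    obtain r' where r': "0 < r'" "g2_cross A \<phi> p u v = r' *\<^sub>R ?w"
      using plane_cross[OF cT, of "vector [u, v]"] uv(1) c(2) by auto
    have "unit_cross A \<phi> p (s p) x = unit_cross A \<phi> p (g2_cross A \<phi> p u v) x"
      unfolding r(2) r'(2) by (simp add: unit_cross_scaleR_left[OF A \<phi> g2_cross_in[OF A \<phi>]] r(1) r'(1))
    then show ?thesis
      using chi_form_eq_unit_cross[OF T uv(2), of x] normal[OF x] tan_uv by simp
  qed
  ultimately show ?thesis by blast
qed

text \<open>Here \<open>s\<close> is itself a smooth section over all of \<open>X\<close>, so the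
  positive factors are 1.\<close>

lemma coassociative_almost_complex:
  assumes X: "coassociative A \<phi> X" and s: "smooth_section A X s"
    and nz: "\<And>p. p \<in> X \<Longrightarrow> s p \<in> normal_bundle A \<phi> X p \<and> s p \<noteq> 0"
  shows "almost_complex_structure A X (tangent_sub A X) (\<lambda>p. unit_cross A \<phi> p (s p))"
proof (rule almost_complex_unit_cross[OF A \<phi>])
  have sub: "submanifold A 4 X" using X by (simp add: coassociative_def)
  fix p assume p: "p \<in> X"
  show "subspace (tangent_sub A X p)" by (rule subspace_tangent_sub[OF sub p])
  show "tangent_sub A X p \<subseteq> tangent_space A p" by (rule tangent_sub_subset)
  show "s p \<in> tangent_space A p" "s p \<noteq> 0"
    using nz[OF p] by (auto simp: normal_bundle_def)
  show "\<exists>W s'. open W \<and> p \<in> W \<and> smooth_section A (X \<inter> W) s' \<and> (\<forall>q\<in>X \<inter> W. \<exists>r>0. s q = r *\<^sub>R s' q)"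
    using s by (intro exI[of _ UNIV] exI[of _ s]) (auto intro!: exI[of _ 1])
  fix v assume v: "v \<in> tangent_sub A X p"
  show "g2_metric A \<phi> p (s p) v = 0"
    using nz[OF p] v by (simp add: normal_bundle_def)
  show "g2_cross A \<phi> p (s p) v \<in> tangent_sub A X p"
    using coassociative_cross[OF X p _ v] nz[OF p] by blast
qed

end

theorem lemma2:
  fixes A :: "('m::{t2_space, second_countable_topology}, 7) chart set"
    and \<phi> :: "('m, 7) form3"
  assumes "smooth_structure A"
    and "g2_structure A \<phi>"
  shows "(\<forall>(Y :: 'm set) (P :: 'm \<Rightarrow> (('m, 7) tvec ^ 2) set).
            associative A \<phi> Y \<and> oriented_plane_field A Y P \<longrightarrow>
            (\<exists>J. almost_complex_structure A Y (normal_bundle A \<phi> Y) J \<and>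
                 (\<forall>p\<in>Y. \<forall>u v. vector [u, v] \<in> P p \<and>
                    orthonormal (g2_metric A \<phi> p) (vector [u, v] :: ('m, 7) tvec ^ 2) \<longrightarrow>
                    (\<forall>x\<in>normal_bundle A \<phi> Y p. J p x = chi_form A \<phi> p u v x)))) \<and>
         (\<forall>(X :: 'm set) (s :: 'm \<Rightarrow> ('m, 7) tvec).
            coassociative A \<phi> X \<and> smooth_section A X s \<and>
            (\<forall>p\<in>X. s p \<in> normal_bundle A \<phi> X p \<and> s p \<noteq> 0) \<longrightarrow>
            (\<exists>J. almost_complex_structure A X (tangent_sub A X) J))"
proof (intro conjI allI impI; elim conjE)
  fix Y and P :: "'m \<Rightarrow> (('m, 7) tvec ^ 2) set"
  assume "associative A \<phi> Y" "oriented_plane_field A Y P"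
  then show "\<exists>J. almost_complex_structure A Y (normal_bundle A \<phi> Y) J \<and>
      (\<forall>p\<in>Y. \<forall>u v. vector [u, v] \<in> P p \<and>
         orthonormal (g2_metric A \<phi> p) (vector [u, v] :: ('m, 7) tvec ^ 2) \<longrightarrow>
         (\<forall>x\<in>normal_bundle A \<phi> Y p. J p x = chi_form A \<phi> p u v x))"
    by (rule associative_almost_complex[OF assms])
next
  fix X s
  assume "coassociative A \<phi> X" "smooth_section A X s"
    and "\<forall>p\<in>X. s p \<in> normal_bundle A \<phi> X p \<and> s p \<noteq> 0"
  then show "\<exists>J. almost_complex_structure A X (tangent_sub A X) J"
    by (intro exI[of _ "\<lambda>p. unit_cross A \<phi> p (s p)"] coassociative_almost_complex[OF assms]) auto
qed

end
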